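(* Let $\mathcal P=(\Delta,\mathcal F)$ be a simple lattice multi-polytope of dimension $n$. Then $$\sum_{I\in\Sigma^{(n)}}\frac{w(I)\,t^{u_I}}{|N/N_I|}\sum_{g\in N/N_I}\frac{1}{\prod_{i\in I}\bigl(1-\chi_I(u_i^I,g)t^{-u_i^I}\bigr)}=\sum_{u\in N^*}\mathrm{DH}_{\mathcal P_+}(u)t^{u}\in\mathbb C[N^*]$$ as elements of $\mathbb C(N^*_\Delta)$. In particular, if the multi-fan $\Delta$ is non-singular, then $N^*_\Delta=N^*$ and $$\sum_{I\in\Sigma^{(n)}}\frac{w(I)\,t^{u_I}}{\prod_{i\in I}(1-t^{-u_i^I})}=\sum_{u\in N^*}\mathrm{DH}_{\mathcal P_+}(u)t^{u}.$$
   Context: **Multi-fans.** Let $N$ be a lattice of rank $n$ and $N_{\mathbb R}=N\otimes\mathbb R$. A cone in $N$ is a strongly convex rational polyhedral cone in $N_{\mathbb R}$ (the set of nonnegative real combinations of finitely many vectors of $N$, containing no line). $\mathrm{Cone}(N)$ is the set of all cones, partially ordered by $\tau\prec\sigma$ iff $\tau$ is a proper face of $\sigma$. A multi-fan of dimension $n$ in $N$ is a triple $\Delta=(\Sigma,C,w^{\pm})$ where $\Sigma$ is a finite partially ordered set with a unique minimum element $*$; $C:\Sigma\to\mathrm{Cone}(N)$ is a map with (1) $C( * )=\{0\}$, (2) $I<J$ implies $C(I)\prec C(J)$, (3) for each $J\in\Sigma$, $C$ restricts to an isomorphism of ordered sets from $\{I\in\Sigma: I\le J\}$ onto $\{\kappa\in\mathrm{Cone}(N):\kappa\preceq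 C(J)\}$; and, with $\Sigma^{(m)}=\{I\in\Sigma:\dim C(I)=m\}$ (write $|I|=m$ for $I\in\Sigma^{(m)}$), $w^+,w^-:\Sigma^{(n)}\to\mathbb Z_{\ge0}$ are functions such that $w^+(I)>0$ or $w^-(I)>0$ for each $I$. Put $w=w^+-w^-$. A vector $v\in N_{\mathbb R}$ is generic if it lies on no linear subspace spanned by a cone $C(I)$ of dimension $<n$. $\Delta$ is pre-complete if $\Sigma^{(n)}\ne\emptyset$ and $d_v=\sum_{v\in C(I),\,I\in\Sigma^{(n)}}w(I)$ is independent of the generic vector $v$. For $K\in\Sigma$ the projected multi-fan $\Delta_K=(\Sigma_K,C_K,w_K^\pm)$ has $\Sigma_K=\{J\in\Sigma:K\le J\}$, $C_K(J)$ = the image of $C(J)$ in the quotient of $N_{\mathbb R}$ by the span of $C(K)$ (with lattice the quotient of $N$ by the subgroup generated by $C(K)\cap N$), and $w_K^\pm$ the restrictions of $w^\pm$. $\Delta$ is complete if $\Delta$ and all $\Delta_K$, $K\in\Sigma$, are pre-complete. $\Delta$ is simplicial (resp. non-singular) if every $C(I)$ is generated by linearly independent vectors (resp. by part of a $\mathbb Z$-basis of $N$); if simplicial, $\Sigma$ is identified with an augmented simplicial set (abstract simplicial complex including the empty set as minimum) of subsets of $\{1,\dots,d\}$ with $\Sigma^{(1)}=\{\{1\},\dots,\{d\}\}$, and $|I|$ is the cardinality of $I$. **Multi-polytopes.** Put $V=N_{\mathbb R}$, $V^*=\mathrm{Hom}(V,\mathbb R)$, $N^*=\mathrm{Hom}(N,\mathbb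 Z)\subset V^*$. A multi-polytope is a pair $\mathcal P=(\Delta,\mathcal F)$ where $\Delta$ is a complete multi-fan and $\mathcal F$ assigns to each $I\in\Sigma^{(1)}$ an affine hyperplane $\mathcal F(I)\subset V^*$ on which the elements of $C(I)$ are constant. It is simple if $\Delta$ is simplicial. For simple $\mathcal P$ let $v_i$ be the primitive vector of $N$ in $C(\{i\})$ and write $F_i=\mathcal F(\{i\})=\{u\in V^*:\langle u,v_i\rangle=c_i\}$. For $I\in\Sigma^{(n)}$, $\bigcap_{i\in I}F_i$ is a point $u_I$ (a vertex); $\{u_i^I\}_{i\in I}\subset V^*$ is the basis dual to $\{v_i\}_{i\in I}$. $\mathcal P$ is a lattice multi-polytope if every vertex $u_I$ lies in $N^*$. **Duistermaat-Heckman function.** Fix a generic $v\in V$. For $I\in\Sigma^{(n)}$ put $(-1)^I=(-1)^{\sharp\{i\in I:\langle u_i^I,v\rangle>0\}}$, $(u_i^I)^+=u_i^I$ if $\langle u_i^I,v\rangle>0$ and $-u_i^I$ if $\langle u_i^I,v\rangle<0$; let $\phi_I$ be the characteristic function of the cone with apex $u_I$ spanned by the $(u_i^I)^+$, $i\in I$. Then $\mathrm{DH}_{\mathcal P}=\sum_{I\in\Sigma^{(n)}}(-1)^Iw(I)\phi_I$ on $V^*\setminus\bigcup_iF_i$ (it is independent of $v$ and has bounded support). $\mathcal P_+$ is the multi-polytope on $\Delta$ obtained by moving each $F_i$ slightly in the direction of $v_i$, i.e. replacing $c_i$ by $c_i+\varepsilon$ for sufficiently small $\varepsilon>0$; the moved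 hyperplanes miss $N^*$. **Group ring.** For $I\in\Sigma^{(n)}$, $N_I$ is the sublattice of $N$ generated by the $v_i$ ($i\in I$), so $N/N_I$ is finite. For $u\in N_I^*=\mathrm{Hom}(N_I,\mathbb Z)\supset N^*$ and $g\in N/N_I$, $\chi_I(u,g)=\exp(2\pi\sqrt{-1}\langle u,v_g\rangle)$, where $v_g\in N$ represents $g$. $N^*_\Delta$ is the lattice in $V^*$ generated by all $u_i^I$ ($I\in\Sigma^{(n)}$, $i\in I$). $\mathbb C[N^*_\Delta]$ is its group ring, with basis $t^u$ ($u\in N^*_\Delta$) and $t^ut^{u'}=t^{u+u'}$; $\mathbb C(N^*_\Delta)$ is its quotient field. *)

theory Defs
  imports
    "HOL-Analysis.Analysis"
    "HOL-Library.Poly_Mapping"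
    "HOL-Computational_Algebra.Fraction_Field"
    "HOL-Computational_Algebra.Group_Closure"
begin

text \<open>
  Lattices live in a Euclidean space and need not span it: \<open>N\<^sub>\<real>\<close> is \<^term>\<open>span N\<close> and the
  rank of \<open>N\<close> is \<^term>\<open>dim N\<close>. In this way every rank, including 0, is covered, and projected
  multi-fans are again multi-fans over the same type.
\<close>

text \<open>
  The lexicographic order of the values on a standard basis. It is compatible with addition
  and serves only to make the group ring of the dual space an integral domain, so that its
  field of fractions is available.
\<close>

instantiation blinfun ::
  (euclidean_space, "{real_normed_vector, linordered_ab_group_add}") linorder
begin

definition less_blinfun :: "'a \<Rightarrow>\<^sub>L 'b \<Rightarrow> 'a \<Rightarrow>\<^sub>L 'b \<Rightarrow> bool" where
  "less_blinfun f g \<longleftrightarrow>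
    (\<exists>b\<in>Basis. blinfun_apply f b < blinfun_apply g b \<and>
      (\<forall>b'\<in>Basis. to_nat_on Basis b' < to_nat_on Basis b \<longrightarrow>
         blinfun_apply f b' = blinfun_apply g b'))"

definition less_eq_blinfun :: "'a \<Rightarrow>\<^sub>L 'b \<Rightarrow> 'a \<Rightarrow>\<^sub>L 'b \<Rightarrow> bool" where
  "less_eq_blinfun f g \<longleftrightarrow> f = g \<or> f < g"

instance
proof
  let ?i = "to_nat_on (Basis :: 'a set)"
  have inj: "b = b'" if "b \<in> Basis" "b' \<in> Basis" "?i b = ?i b'" for b b' :: 'a
    using that inj_on_to_nat_on[OF countable_finite[OF finite_Basis]]
    by (auto dest: inj_onD)
  have irr: "\<not> f < f" for f :: "'a \<Rightarrow>\<^sub>L 'b"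
    by (auto simp: less_blinfun_def)
  have tr: "f < h" if fg: "f < g" and gh: "g < h" for f g h :: "'a \<Rightarrow>\<^sub>L 'b"
  proof -
    from fg obtain b where b: "b \<in> Basis" "blinfun_apply f b < blinfun_apply g b"
      "\<And>b'. b' \<in> Basis \<Longrightarrow> ?i b' < ?i b \<Longrightarrow> blinfun_apply f b' = blinfun_apply g b'"
      unfolding less_blinfun_def by blast
    from gh obtain c where c: "c \<in> Basis" "blinfun_apply g c < blinfun_apply h c"
      "\<And>b'. b' \<in> Basis \<Longrightarrow> ?i b' < ?i c \<Longrightarrow> blinfun_apply g b' = blinfun_apply h b'"
      unfolding less_blinfun_def by blast
    consider "?i b < ?i c" | "?i c < ?i b" | "b = c"
      using inj[OF b(1) c(1)] by linarith
    then show ?thesis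
    proof cases
      case 1
      then show ?thesis unfolding less_blinfun_def
        using b c by (intro bexI[of _ b]) auto
    next
      case 2
      then show ?thesis unfolding less_blinfun_def
        using b c by (intro bexI[of _ c]) auto
    next
      case 3
      then show ?thesis unfolding less_blinfun_def
        using b c by (intro bexI[of _ b]) auto
    qed
  qed
  fix f g h :: "'a \<Rightarrow>\<^sub>L 'b"
  show "(f < g) = (f \<le> g \<and> \<not> g \<le> f)"
    using irr tr by (auto simp: less_eq_blinfun_def)
  show "f \<le> f" by (simp add: less_eq_blinfun_def)
  show "f \<le> g \<Longrightarrow> g \<le> h \<Longrightarrow> f \<le> h"
    using tr by (auto simp: less_eq_blinfun_def)
  show "f \<le> g \<Longrightarrow> g \<le> f \<Longrightarrow> f = g"
    using irr tr by (auto simp: less_eq_blinfun_def)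
  show "f \<le> g \<or> g \<le> f"
  proof (cases "f = g")
    case False
    define D where "D = {b \<in> Basis. blinfun_apply f b \<noteq> blinfun_apply g b}"
    have "D \<noteq> {}"
      using False blinfun_euclidean_eqI[of f g] by (auto simp: D_def)
    then obtain b where b: "b \<in> D" "\<And>b'. b' \<in> D \<Longrightarrow> ?i b \<le> ?i b'"
      using ex_has_least_nat[of "\<lambda>b. b \<in> D" _ ?i] by blast
    have "blinfun_apply f b' = blinfun_apply g b'" if "b' \<in> Basis" "?i b' < ?i b" for b'
      using b(2)[of b'] that by (auto simp: D_def)
    moreover have "blinfun_apply f b < blinfun_apply g b \<or> blinfun_apply g b < blinfun_apply f b"
      using b(1) by (auto simp: D_def)
    ultimately have "f < g \<or> g < f"
      using b(1) unfolding less_blinfun_def D_def by force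
    then show ?thesis by (auto simp: less_eq_blinfun_def)
  qed (simp add: less_eq_blinfun_def)
qed

end

instance blinfun ::
  (euclidean_space, "{real_normed_vector, linordered_ab_group_add}") ordered_cancel_comm_monoid_add
  by intro_classes
    (auto simp: less_eq_blinfun_def less_blinfun_def blinfun.add_left)

definition lattice_basis :: "'v::euclidean_space set \<Rightarrow> 'v set \<Rightarrow> bool" where
  "lattice_basis N B \<longleftrightarrow> independent B \<and> group_closure B = N"

definition is_lattice :: "'v::euclidean_space set \<Rightarrow> bool" where
  "is_lattice N \<longleftrightarrow> (\<exists>B. lattice_basis N B)"

definition contains_line :: "'v::real_vector set \<Rightarrow> bool" where
  "contains_line S \<longleftrightarrow> (\<exists>x d. d \<noteq> 0 \<and> (\<forall>r. x + r *\<^sub>R d \<in> S))"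

definition Cones :: "'v::euclidean_space set \<Rightarrow> 'v set set" where
  "Cones N = {\<sigma>. (\<exists>S. finite S \<and> S \<subseteq> N \<and> \<sigma> = convex_cone hull S) \<and> \<not> contains_line \<sigma>}"

text \<open>
  \<^term>\<open>{} face_of \<sigma>\<close> always holds in the library; it does no harm below, where only faces
  that are cones occur.
\<close>

definition proper_face :: "'v::euclidean_space set \<Rightarrow> 'v set \<Rightarrow> bool" where
  "proper_face \<tau> \<sigma> \<longleftrightarrow> \<tau> face_of \<sigma> \<and> \<tau> \<noteq> \<sigma>"

text \<open>
  \<open>Hom(N\<^sub>\<real>, \<real>)\<close>, each functional being extended by 0 to the orthogonal complement of \<open>N\<^sub>\<real>\<close>.
\<close>

definition dual_space :: "'v::euclidean_space set \<Rightarrow> ('v \<Rightarrow>\<^sub>L real) set" where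
  "dual_space N = {u. \<forall>x\<in>(span N)\<^sup>\<bottom>. blinfun_apply u x = 0}"

definition dual_lattice :: "'v::euclidean_space set \<Rightarrow> ('v \<Rightarrow>\<^sub>L real) set" where
  "dual_lattice N = {u \<in> dual_space N. \<forall>x\<in>N. blinfun_apply u x \<in> \<int>}"

record ('s, 'v) multi_fan =
  lat :: "'v set"
  faces :: "'s set"
  le_rel :: "'s rel"
  cone_of :: "'s \<Rightarrow> 'v set"
  wplus :: "'s \<Rightarrow> nat"
  wminus :: "'s \<Rightarrow> nat"

definition fan_rank :: "('s, 'v::euclidean_space) multi_fan \<Rightarrow> nat" where
  "fan_rank \<Delta> = dim (lat \<Delta>)"

definition skel :: "('s, 'v::euclidean_space) multi_fan \<Rightarrow> nat \<Rightarrow> 's set" where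
  "skel \<Delta> m = {I \<in> faces \<Delta>. dim (cone_of \<Delta> I) = m}"

definition top_skel :: "('s, 'v::euclidean_space) multi_fan \<Rightarrow> 's set" where
  "top_skel \<Delta> = skel \<Delta> (fan_rank \<Delta>)"

definition weight :: "('s, 'v::euclidean_space) multi_fan \<Rightarrow> 's \<Rightarrow> int" where
  "weight \<Delta> I = int (wplus \<Delta> I) - int (wminus \<Delta> I)"

definition is_multi_fan :: "('s, 'v::euclidean_space) multi_fan \<Rightarrow> bool" where
  "is_multi_fan \<Delta> \<longleftrightarrow>
     is_lattice (lat \<Delta>) \<and>
     finite (faces \<Delta>) \<and> partial_order_on (faces \<Delta>) (le_rel \<Delta>) \<and>
     cone_of \<Delta> ` faces \<Delta> \<subseteq> Cones (lat \<Delta>) \<and>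
     (\<exists>m\<in>faces \<Delta>. (\<forall>I\<in>faces \<Delta>. (m, I) \<in> le_rel \<Delta>) \<and> cone_of \<Delta> m = {0}) \<and>
     (\<forall>I J. (I, J) \<in> le_rel \<Delta> \<and> I \<noteq> J \<longrightarrow> proper_face (cone_of \<Delta> I) (cone_of \<Delta> J)) \<and>
     (\<forall>J\<in>faces \<Delta>.
        bij_betw (cone_of \<Delta>) {I. (I, J) \<in> le_rel \<Delta>}
          {\<kappa> \<in> Cones (lat \<Delta>). \<kappa> face_of cone_of \<Delta> J} \<and>
        (\<forall>I I'. (I, J) \<in> le_rel \<Delta> \<and> (I', J) \<in> le_rel \<Delta> \<longrightarrow>
           ((I, I') \<in> le_rel \<Delta> \<longleftrightarrow> cone_of \<Delta> I face_of cone_of \<Delta> I'))) \<and>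
     (\<forall>I\<in>top_skel \<Delta>. wplus \<Delta> I > 0 \<or> wminus \<Delta> I > 0)"

definition generic :: "('s, 'v::euclidean_space) multi_fan \<Rightarrow> 'v \<Rightarrow> bool" where
  "generic \<Delta> v \<longleftrightarrow> v \<in> span (lat \<Delta>) \<and>
     (\<forall>I\<in>faces \<Delta>. dim (cone_of \<Delta> I) < fan_rank \<Delta> \<longrightarrow> v \<notin> span (cone_of \<Delta> I))"

definition covering_degree :: "('s, 'v::euclidean_space) multi_fan \<Rightarrow> 'v \<Rightarrow> int" where
  "covering_degree \<Delta> v = (\<Sum>I\<in>{I \<in> top_skel \<Delta>. v \<in> cone_of \<Delta> I}. weight \<Delta> I)"

definition pre_complete :: "('s, 'v::euclidean_space) multi_fan \<Rightarrow> bool" where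
  "pre_complete \<Delta> \<longleftrightarrow> top_skel \<Delta> \<noteq> {} \<and>
     (\<exists>d. \<forall>v. generic \<Delta> v \<longrightarrow> covering_degree \<Delta> v = d)"

text \<open>
  The quotient of \<open>N\<^sub>\<real>\<close> by a subspace \<open>W\<close> is realised as the orthogonal complement of \<open>W\<close> in
  \<open>N\<^sub>\<real>\<close>, the quotient map being the orthogonal projection. For a cone \<open>C(K)\<close> with span \<open>W\<close>, the
  image of \<open>N\<close> is the quotient of \<open>N\<close> by \<open>N \<inter> W\<close>, the subgroup generated by \<open>C(K) \<inter> N\<close>.
\<close>

definition quotient_map :: "'v::euclidean_space set \<Rightarrow> 'v \<Rightarrow> 'v" where
  "quotient_map W x = (THE p. p \<in> W\<^sup>\<bottom> \<and> x - p \<in> W)"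

definition projected :: "('s, 'v::euclidean_space) multi_fan \<Rightarrow> 's \<Rightarrow> ('s, 'v) multi_fan" where
  "projected \<Delta> K =
     (let \<pi> = quotient_map (span (cone_of \<Delta> K)); S = {J \<in> faces \<Delta>. (K, J) \<in> le_rel \<Delta>} in
      \<lparr> lat = \<pi> ` lat \<Delta>,
        faces = S,
        le_rel = le_rel \<Delta> \<inter> S \<times> S,
        cone_of = (\<lambda>J. \<pi> ` cone_of \<Delta> J),
        wplus = wplus \<Delta>,
        wminus = wminus \<Delta> \<rparr>)"

definition complete_fan :: "('s, 'v::euclidean_space) multi_fan \<Rightarrow> bool" where
  "complete_fan \<Delta> \<longleftrightarrow> pre_complete \<Delta> \<and> (\<forall>K\<in>faces \<Delta>. pre_complete (projected \<Delta> K))"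

definition simplicial_fan :: "('s, 'v::euclidean_space) multi_fan \<Rightarrow> bool" where
  "simplicial_fan \<Delta> \<longleftrightarrow>
     (\<forall>I\<in>faces \<Delta>. \<exists>S. independent S \<and> cone_of \<Delta> I = convex_cone hull S)"

definition nonsingular_fan :: "('s, 'v::euclidean_space) multi_fan \<Rightarrow> bool" where
  "nonsingular_fan \<Delta> \<longleftrightarrow>
     (\<forall>I\<in>faces \<Delta>. \<exists>B S. lattice_basis (lat \<Delta>) B \<and> S \<subseteq> B \<and> cone_of \<Delta> I = convex_cone hull S)"

text \<open>
  For a simplicial multi-fan, \<open>I\<close> is identified with the set of elements of \<open>\<Sigma>\<^sup>(\<^sup>1\<^sup>)\<close> below it.
\<close>

definition verts :: "('s, 'v::euclidean_space) multi_fan \<Rightarrow> 's \<Rightarrow> 's set" where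
  "verts \<Delta> I = {i \<in> skel \<Delta> 1. (i, I) \<in> le_rel \<Delta>}"

definition primitive :: "'v::euclidean_space set \<Rightarrow> 'v \<Rightarrow> bool" where
  "primitive N x \<longleftrightarrow> x \<in> N \<and> x \<noteq> 0 \<and> (\<forall>y\<in>N. \<forall>k::nat. x = of_nat k *\<^sub>R y \<longrightarrow> k = 1)"

definition ray_vec :: "('s, 'v::euclidean_space) multi_fan \<Rightarrow> 's \<Rightarrow> 'v" where
  "ray_vec \<Delta> i = (THE x. x \<in> cone_of \<Delta> i \<and> primitive (lat \<Delta>) x)"

definition dual_vec :: "('s, 'v::euclidean_space) multi_fan \<Rightarrow> 's \<Rightarrow> 's \<Rightarrow> 'v \<Rightarrow>\<^sub>L real" where
  "dual_vec \<Delta> I i = (THE u. u \<in> dual_space (lat \<Delta>) \<and>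
     (\<forall>j\<in>verts \<Delta> I. blinfun_apply u (ray_vec \<Delta> j) = (if j = i then 1 else 0)))"

definition affine_hyperplane_in :: "'w::real_vector set \<Rightarrow> 'w set \<Rightarrow> bool" where
  "affine_hyperplane_in W H \<longleftrightarrow>
     (\<exists>l c. linear (l :: 'w \<Rightarrow> real) \<and> (\<exists>u\<in>W. l u \<noteq> 0) \<and> H = {u \<in> W. l u = c})"

definition multi_polytope ::
  "('s, 'v::euclidean_space) multi_fan \<Rightarrow> ('s \<Rightarrow> ('v \<Rightarrow>\<^sub>L real) set) \<Rightarrow> bool" where
  "multi_polytope \<Delta> F \<longleftrightarrow> is_multi_fan \<Delta> \<and> complete_fan \<Delta> \<and>
     (\<forall>I\<in>skel \<Delta> 1. affine_hyperplane_in (dual_space (lat \<Delta>)) (F I) \<and>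
        (\<forall>x\<in>cone_of \<Delta> I. \<exists>c. \<forall>u\<in>F I. blinfun_apply u x = c))"

definition simple_multi_polytope ::
  "('s, 'v::euclidean_space) multi_fan \<Rightarrow> ('s \<Rightarrow> ('v \<Rightarrow>\<^sub>L real) set) \<Rightarrow> bool" where
  "simple_multi_polytope \<Delta> F \<longleftrightarrow> multi_polytope \<Delta> F \<and> simplicial_fan \<Delta>"

definition vertex ::
  "('s, 'v::euclidean_space) multi_fan \<Rightarrow> ('s \<Rightarrow> ('v \<Rightarrow>\<^sub>L real) set) \<Rightarrow> 's \<Rightarrow> 'v \<Rightarrow>\<^sub>L real" where
  "vertex \<Delta> F I = (THE u. u \<in> dual_space (lat \<Delta>) \<and> (\<forall>i\<in>verts \<Delta> I. u \<in> F i))"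

definition simple_lattice_multi_polytope ::
  "('s, 'v::euclidean_space) multi_fan \<Rightarrow> ('s \<Rightarrow> ('v \<Rightarrow>\<^sub>L real) set) \<Rightarrow> bool" where
  "simple_lattice_multi_polytope \<Delta> F \<longleftrightarrow> simple_multi_polytope \<Delta> F \<and>
     (\<forall>I\<in>top_skel \<Delta>. vertex \<Delta> F I \<in> dual_lattice (lat \<Delta>))"

definition level ::
  "('s, 'v::euclidean_space) multi_fan \<Rightarrow> ('s \<Rightarrow> ('v \<Rightarrow>\<^sub>L real) set) \<Rightarrow> 's \<Rightarrow> real" where
  "level \<Delta> F i = (THE c. F i = {u \<in> dual_space (lat \<Delta>). blinfun_apply u (ray_vec \<Delta> i) = c})"

definition shifted ::
  "('s, 'v::euclidean_space) multi_fan \<Rightarrow> ('s \<Rightarrow> ('v \<Rightarrow>\<^sub>L real) set) \<Rightarrow> real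
     \<Rightarrow> 's \<Rightarrow> ('v \<Rightarrow>\<^sub>L real) set" where
  "shifted \<Delta> F \<epsilon> i =
     {u \<in> dual_space (lat \<Delta>). blinfun_apply u (ray_vec \<Delta> i) = level \<Delta> F i + \<epsilon>}"

definition dual_vec_pos ::
  "('s, 'v::euclidean_space) multi_fan \<Rightarrow> 'v \<Rightarrow> 's \<Rightarrow> 's \<Rightarrow> 'v \<Rightarrow>\<^sub>L real" where
  "dual_vec_pos \<Delta> v I i =
     (if blinfun_apply (dual_vec \<Delta> I i) v > 0 then dual_vec \<Delta> I i else - dual_vec \<Delta> I i)"

definition vertex_cone ::
  "('s, 'v::euclidean_space) multi_fan \<Rightarrow> ('s \<Rightarrow> ('v \<Rightarrow>\<^sub>L real) set) \<Rightarrow> 'v \<Rightarrow> 's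
     \<Rightarrow> ('v \<Rightarrow>\<^sub>L real) set" where
  "vertex_cone \<Delta> F v I =
     (\<lambda>x. vertex \<Delta> F I + x) ` (convex_cone hull (dual_vec_pos \<Delta> v I ` verts \<Delta> I))"

text \<open>
  The generic vector \<open>v\<close> is kept as a parameter. The Duistermaat-Heckman function is the
  restriction of this total function to the complement of the hyperplanes \<open>F i\<close> in the dual
  space.
\<close>

definition DH ::
  "('s, 'v::euclidean_space) multi_fan \<Rightarrow> ('s \<Rightarrow> ('v \<Rightarrow>\<^sub>L real) set) \<Rightarrow> 'v
     \<Rightarrow> ('v \<Rightarrow>\<^sub>L real) \<Rightarrow> int" where
  "DH \<Delta> F v u =
     (\<Sum>I\<in>top_skel \<Delta>. (-1) ^ card {i \<in> verts \<Delta> I. blinfun_apply (dual_vec \<Delta> I i) v > 0} *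
        weight \<Delta> I * indicator (vertex_cone \<Delta> F v I) u)"

definition sublat :: "('s, 'v::euclidean_space) multi_fan \<Rightarrow> 's \<Rightarrow> 'v set" where
  "sublat \<Delta> I = group_closure (ray_vec \<Delta> ` verts \<Delta> I)"

definition quot_grp :: "('s, 'v::euclidean_space) multi_fan \<Rightarrow> 's \<Rightarrow> 'v set set" where
  "quot_grp \<Delta> I = lat \<Delta> // {(x, y) \<in> lat \<Delta> \<times> lat \<Delta>. x - y \<in> sublat \<Delta> I}"

definition chi :: "('v::euclidean_space \<Rightarrow>\<^sub>L real) \<Rightarrow> 'v set \<Rightarrow> complex" where
  "chi u g = exp (2 * of_real pi * \<i> * of_real (blinfun_apply u (SOME x. x \<in> g)))"

definition dual_lattice_fan :: "('s, 'v::euclidean_space) multi_fan \<Rightarrow> ('v \<Rightarrow>\<^sub>L real) set" where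
  "dual_lattice_fan \<Delta> = group_closure {dual_vec \<Delta> I i | I i. I \<in> top_skel \<Delta> \<and> i \<in> verts \<Delta> I}"

text \<open>
  All group rings are subrings of the group ring \<open>\<complex>[V\<^sup>*]\<close>, the type
  \<^typ>\<open>('v \<Rightarrow>\<^sub>L real) \<Rightarrow>\<^sub>0 complex\<close>, and their quotient fields are subfields of its quotient field;
  \<open>a t\<^sup>u\<close> is \<^term>\<open>Poly_Mapping.single u a\<close>.
\<close>

definition group_ring ::
  "('v::euclidean_space \<Rightarrow>\<^sub>L real) set \<Rightarrow> (('v \<Rightarrow>\<^sub>L real) \<Rightarrow>\<^sub>0 complex) set" where
  "group_ring L = {p. Poly_Mapping.keys p \<subseteq> L}"

definition quot_field ::
  "('v::euclidean_space \<Rightarrow>\<^sub>L real) set \<Rightarrow> (('v \<Rightarrow>\<^sub>L real) \<Rightarrow>\<^sub>0 complex) fract set" where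
  "quot_field L =
     {Fraction_Field.Fract p q | p q. p \<in> group_ring L \<and> q \<in> group_ring L \<and> q \<noteq> 0}"

definition tmon :: "complex \<Rightarrow> ('v::euclidean_space \<Rightarrow>\<^sub>L real)
    \<Rightarrow> (('v \<Rightarrow>\<^sub>L real) \<Rightarrow>\<^sub>0 complex) fract" where
  "tmon a u = Fraction_Field.Fract (Poly_Mapping.single u a) 1"

end

theory Submission
  imports Defs
begin

text \<open>
  Expand every summand on the left in the direction of the generic vector \<open>v\<close>. Averaging over
  \<open>N/N\<^sub>I\<close> keeps exactly the exponents in \<open>N\<^sup>*\<close>, so the coefficient of \<open>t\<^sup>u\<close> in the sum of the
  expansions is the value at \<open>u\<close> of the Duistermaat-Heckman function of the shifted multi-polytope;
  since the levels are integers, any shift by less than 1 has this effect. Fractions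
  whose formal expansions add up to an element of the group ring have that element as their sum,
  so it remains to see that the support is finite.

  At a fixed \<open>u\<close> the value is a sum over \<open>I\<close> of weighted products of factors
  \<open>[\<langle>u\<^sub>i\<^sup>I, v\<rangle> \<le> 0] - [c\<^sub>i < \<langle>u, v\<^sub>i\<rangle>]\<close>. Multiplying out expresses it by the degrees of the
  projected multi-fans \<open>\<Delta>\<^sub>K\<close>, which completeness makes independent of \<open>v\<close>. A summand that does
  not vanish for the direction \<open>x\<close> forces \<open>\<langle>u, x\<rangle> \<ge> \<langle>u\<^sub>I, x\<rangle>\<close>; applied to \<open>x\<close> and \<open>-x\<close> for all
  generic \<open>x\<close>, this bounds \<open>u\<close>.
\<close>

section \<open>Fractions from formal expansions\<close>

text \<open>A formal expansion does not determine its fraction by inversion: for nonzero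
  \<open>k\<close>, a function that is constant on the multiples of \<open>k\<close> and zero
  elsewhere is annihilated by \<open>1 - t^k\<close>. Hence denominators are only ever cleared, and
  the resulting equation \<open>Q * R = P\<close> is read in the group ring, an integral domain.
  This step alone would allow a different direction for every summand; one common \<open>v\<close>
  is used so that the infinite tails of different \<open>I\<close> can cancel.

  The cancellation is visible only after regrouping. The numbers \<open>[c_i < <u, v_i>]\<close>
  depend on the ray \<open>i\<close> and not on \<open>I\<close>, so the terms of different
  \<open>I\<close> above the same face \<open>K\<close> share a monomial and can be collected. What
  remains as coefficient is a degree of the multi-fan projected along \<open>K\<close>, so
  pre-completeness enters for every \<open>K\<close>. The degree is taken at \<open>- x\<close>,
  because the factor asks for a nonpositive pairing with \<open>x\<close>.

  That the vertices lie in the dual lattice enters twice: it makes the levels integers, and it makes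
  the characters at \<open>u_I - u\<close>, summed over the quotient group, detect whether
  \<open>u\<close> is in the dual lattice.\<close>

text \<open>
  The group ring acts by convolution on arbitrary functions on the group, so a fraction has
  formal expansions without any question of convergence.
\<close>

definition conv_act :: "('a::ab_group_add \<Rightarrow>\<^sub>0 complex) \<Rightarrow> ('a \<Rightarrow> complex) \<Rightarrow> 'a \<Rightarrow> complex" where
  "conv_act p f u = (\<Sum>k\<in>Poly_Mapping.keys p. Poly_Mapping.lookup p k * f (u - k))"

lemma conv_act_superset:
  assumes "finite A" "Poly_Mapping.keys p \<subseteq> A"
  shows "conv_act p f u = (\<Sum>k\<in>A. Poly_Mapping.lookup p k * f (u - k))"
  unfolding conv_act_def
  by (rule sum.mono_neutral_left) (use assms in \<open>auto simp: in_keys_iff\<close>)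

lemma conv_act_add: "conv_act (p + q) f u = conv_act p f u + conv_act q f u"
proof -
  let ?A = "Poly_Mapping.keys p \<union> Poly_Mapping.keys q"
  have "Poly_Mapping.keys (p + q) \<subseteq> ?A"
    by (rule keys_add)
  then show ?thesis
    by (simp add: conv_act_superset[of ?A] lookup_add distrib_right sum.distrib)
qed

lemma conv_act_fun_add: "conv_act p (\<lambda>u. f u + g u) u = conv_act p f u + conv_act p g u"
  by (simp add: conv_act_def distrib_left sum.distrib)

lemma conv_act_fun_mult: "conv_act p (\<lambda>u. c * f u) u = c * conv_act p f u"
  by (simp add: conv_act_def sum_distrib_left ac_simps)

lemma conv_act_single: "conv_act (Poly_Mapping.single k a) f u = a * f (u - k)"
  by (cases "a = 0") (auto simp: conv_act_def)

lemma conv_act_one: "conv_act 1 f u = f u"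
  using conv_act_single[of 0 1 f u] by simp

text \<open>Reduces identities that are additive in an argument to the case of a monomial.\<close>

lemma poly_mapping_single_induct:
  assumes "P 0" "\<And>k a. P (Poly_Mapping.single k a)" "\<And>p q. P p \<Longrightarrow> P q \<Longrightarrow> P (p + q)"
  shows "P (p :: 'a \<Rightarrow>\<^sub>0 'b::ab_group_add)"
proof (induction p rule: update_induct)
  case const
  then show ?case by (rule assms(1))
next
  case (update f a b)
  have "Poly_Mapping.update a b f = f + Poly_Mapping.single a b"
    using update by (intro poly_mapping_eqI) (auto simp: lookup_update lookup_add lookup_single in_keys_iff)
  then show ?case using update assms by simp
qed

text \<open>Both sides are additive in \<open>p\<close> and in \<open>q\<close>; for two monomials
  the claim says that two shifts compose to the shift by the sum of the exponents.\<close>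

lemma conv_act_mult: "conv_act (p * q) f u = conv_act p (conv_act q f) u"
proof (induction p arbitrary: u rule: poly_mapping_single_induct)
  case 1
  then show ?case by (simp add: conv_act_def)
next
  case (2 k a)
  show ?case
  proof (induction q arbitrary: u rule: poly_mapping_single_induct)
    case 1
    then show ?case by (simp add: conv_act_def)
  next
    case (2 k' a')
    then show ?case by (simp add: mult_single conv_act_single algebra_simps)
  next
    case (3 q r)
    then show ?case by (simp add: distrib_left conv_act_add conv_act_single)
  qed
next
  case (3 p q)
  then show ?case by (simp add: distrib_right conv_act_add)
qed

text \<open>Every coefficient function arises by acting on the delta function at \<open>0\<close>,
  so this is an instance of the action law.\<close>

lemma conv_act_lookup:
  "conv_act p (Poly_Mapping.lookup q) = Poly_Mapping.lookup (p * q)"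
proof -
  have q: "Poly_Mapping.lookup r = conv_act r (\<lambda>u. if u = 0 then 1 else 0)"
    for r :: "'a \<Rightarrow>\<^sub>0 complex"
  proof
    fix u
    show "Poly_Mapping.lookup r u = conv_act r (\<lambda>u. if u = 0 then 1 else 0) u"
      by (induction r rule: poly_mapping_single_induct)
        (auto simp: conv_act_add conv_act_single lookup_add lookup_single conv_act_def[of 0] when_def)
  qed
  show ?thesis
  proof
    fix u
    have "conv_act p (Poly_Mapping.lookup q) u = conv_act p (conv_act q (\<lambda>u. if u = 0 then 1 else 0)) u"
      using q[of q] by simp
    also have "\<dots> = conv_act (p * q) (\<lambda>u. if u = 0 then 1 else 0) u"
      by (rule conv_act_mult[symmetric])
    also have "\<dots> = Poly_Mapping.lookup (p * q) u"
      using q[of "p * q"] by simp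
    finally show "conv_act p (Poly_Mapping.lookup q) u = Poly_Mapping.lookup (p * q) u" .
  qed
qed

text \<open>Here \<open>e\<close> expands \<open>p / q\<close> in the sense that clearing the
  denominator \<open>q\<close> returns \<open>p\<close>. Cross multiplication passes this on to
  sums; the order on the exponents keeps the product of the denominators nonzero.\<close>

lemma sum_Fract_expansion:
  fixes p q :: "'i \<Rightarrow> 'a::{linorder,ordered_cancel_comm_monoid_add,ab_group_add} \<Rightarrow>\<^sub>0 complex"
  assumes "finite X" "\<And>x. x \<in> X \<Longrightarrow> q x \<noteq> 0"
    and "\<And>x. x \<in> X \<Longrightarrow> conv_act (q x) (e x) = Poly_Mapping.lookup (p x)"
  shows "\<exists>P Q. Q \<noteq> 0 \<and> (\<Sum>x\<in>X. Fract (p x) (q x)) = Fract P Q \<and>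
    conv_act Q (\<lambda>u. \<Sum>x\<in>X. e x u) = Poly_Mapping.lookup P"
  using assms
proof (induction X rule: finite_induct)
  case empty
  have "conv_act 1 (\<lambda>u. 0) = Poly_Mapping.lookup (0 :: 'a \<Rightarrow>\<^sub>0 complex)"
    by (rule ext) (simp add: conv_act_one)
  then show ?case
    by (intro exI[of _ 0] exI[of _ 1]) (simp add: Zero_fract_def)
next
  case (insert x X)
  obtain P Q where PQ: "Q \<noteq> 0" "(\<Sum>x\<in>X. Fract (p x) (q x)) = Fract P Q"
    "conv_act Q (\<lambda>u. \<Sum>x\<in>X. e x u) = Poly_Mapping.lookup P"
    using insert by auto
  have q: "q x \<noteq> 0" "conv_act (q x) (e x) = Poly_Mapping.lookup (p x)"
    using insert by auto
  have "conv_act (q x * Q) (\<lambda>u. e x u + (\<Sum>x\<in>X. e x u)) u =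
     Poly_Mapping.lookup (p x * Q + P * q x) u" for u
  proof -
    \<comment> \<open>By commutativity each expansion can meet its own denominator first:
      \<open>q x\<close> acts on \<open>e x\<close>, and \<open>Q\<close> on the partial
      sum.\<close>
    have "conv_act (q x * Q) (\<lambda>u. e x u + (\<Sum>x\<in>X. e x u)) u =
       conv_act (Q * q x) (e x) u + conv_act (q x * Q) (\<lambda>u. \<Sum>x\<in>X. e x u) u"
      by (simp only: conv_act_fun_add mult.commute[of Q])
    also have "conv_act (Q * q x) (e x) u = Poly_Mapping.lookup (Q * p x) u"
      by (simp only: conv_act_mult q conv_act_lookup)
    also have "conv_act (q x * Q) (\<lambda>u. \<Sum>x\<in>X. e x u) u = Poly_Mapping.lookup (q x * P) u"
      by (simp only: conv_act_mult PQ conv_act_lookup)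
    finally show ?thesis
      by (simp add: lookup_add mult.commute)
  qed
  then show ?case
    using insert.hyps PQ q
    by (intro exI[of _ "p x * Q + P * q x"] exI[of _ "q x * Q"]) (auto simp: fun_eq_iff)
qed

lemma sum_Fract_eq_of_expansion:
  fixes p q :: "'i \<Rightarrow> 'a::{linorder,ordered_cancel_comm_monoid_add,ab_group_add} \<Rightarrow>\<^sub>0 complex"
  assumes "finite X" "\<And>x. x \<in> X \<Longrightarrow> q x \<noteq> 0"
    and "\<And>x. x \<in> X \<Longrightarrow> conv_act (q x) (e x) = Poly_Mapping.lookup (p x)"
    and R: "\<And>u. (\<Sum>x\<in>X. e x u) = Poly_Mapping.lookup R u"
  shows "(\<Sum>x\<in>X. Fract (p x) (q x)) = Fract R 1"
proof -
  obtain P Q where PQ: "Q \<noteq> 0" "(\<Sum>x\<in>X. Fract (p x) (q x)) = Fract P Q"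
    "conv_act Q (\<lambda>u. \<Sum>x\<in>X. e x u) = Poly_Mapping.lookup P"
    using sum_Fract_expansion[of X q e p] assms(1-3) by blast
  have "(\<lambda>u. \<Sum>x\<in>X. e x u) = Poly_Mapping.lookup R"
    by (rule ext) (rule R)
  then have "Poly_Mapping.lookup (Q * R) = Poly_Mapping.lookup P"
    using PQ(3) by (simp only: conv_act_lookup)
  then have "Q * R = P"
    by (simp only: poly_mapping_eq_iff)
  then have "P * 1 = R * Q"
    by (simp only: mult.commute[of R] mult_1_right)
  then show ?thesis
    unfolding PQ(2) using PQ(1) by (simp only: eq_fract one_neq_zero simp_thms)
qed

section \<open>Simplicial cones\<close>

text \<open>Formulated for an indexed family because dual vectors come indexed by
  \<open>verts\<close>; plain sets of generators enter through the identity map.\<close>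

lemma convex_cone_hull_image_finite:
  fixes f :: "'i \<Rightarrow> 'v::real_vector"
  assumes "finite A"
  shows "convex_cone hull (f ` A) = {(\<Sum>i\<in>A. c i *\<^sub>R f i) | c. \<forall>i\<in>A. 0 \<le> c i}"
    (is "_ = ?C")
proof
  show "convex_cone hull (f ` A) \<subseteq> ?C"
  proof (rule hull_minimal)
    show "f ` A \<subseteq> ?C"
    proof
      fix x assume "x \<in> f ` A"
      then obtain j where "j \<in> A" "x = f j" by auto
      then have "x = (\<Sum>i\<in>A. (if i = j then 1 else 0) *\<^sub>R f i)"
        using assms by (simp add: if_distrib[of "\<lambda>c. c *\<^sub>R _"] cong: if_cong)
      then show "x \<in> ?C"
        by (intro CollectI exI[of _ "\<lambda>i. if i = j then 1 else 0"]) auto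
    qed
    show "convex_cone ?C"
      unfolding convex_cone_iff
    proof (intro conjI ballI allI impI)
      show "0 \<in> ?C"
        by (intro CollectI exI[of _ "\<lambda>_. 0"]) auto
    next
      fix x y assume "x \<in> ?C" "y \<in> ?C"
      then obtain c d where "\<forall>i\<in>A. 0 \<le> c i" "x = (\<Sum>i\<in>A. c i *\<^sub>R f i)"
        "\<forall>i\<in>A. 0 \<le> d i" "y = (\<Sum>i\<in>A. d i *\<^sub>R f i)" by auto
      then show "x + y \<in> ?C"
        by (intro CollectI exI[of _ "\<lambda>i. c i + d i"]) (auto simp: scaleR_left_distrib sum.distrib)
    next
      fix x and r :: real assume "x \<in> ?C" "0 \<le> r"
      then obtain c where "\<forall>i\<in>A. 0 \<le> c i" "x = (\<Sum>i\<in>A. c i *\<^sub>R f i)" by auto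
      then show "r *\<^sub>R x \<in> ?C"
        using \<open>0 \<le> r\<close>
        by (intro CollectI exI[of _ "\<lambda>i. r * c i"]) (auto simp: scaleR_sum_right)
    qed
  qed
  show "?C \<subseteq> convex_cone hull (f ` A)"
  proof
    fix x assume "x \<in> ?C"
    then obtain c where c: "\<forall>i\<in>A. 0 \<le> c i" "x = (\<Sum>i\<in>A. c i *\<^sub>R f i)" by auto
    have "(\<Sum>i\<in>B. c i *\<^sub>R f i) \<in> convex_cone hull (f ` A)" if "B \<subseteq> A" for B
      using finite_subset[OF that assms] that
    proof (induction B rule: finite_induct)
      case (insert i B)
      then show ?case
        using c(1)
        by (auto intro!: convex_cone_hull_add convex_cone_hull_mul intro: hull_inc)
    qed (simp add: convex_cone_hull_contains_0)
    then show "x \<in> convex_cone hull (f ` A)"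
      using c by simp
  qed
qed

text \<open>The functional dual to \<open>s\<close>, linear on the whole space; off
  \<open>span S\<close> its values depend on the chosen extension.\<close>

definition coord :: "'v::real_vector set \<Rightarrow> 'v \<Rightarrow> 'v \<Rightarrow> real" where
  "coord S s = (SOME g. linear g \<and> (\<forall>t\<in>S. g t = (if t = s then 1 else 0)))"

lemma coord:
  assumes "independent S"
  shows linear_coord: "linear (coord S s)"
    and coord_basis: "t \<in> S \<Longrightarrow> coord S s t = (if t = s then 1 else 0)"
proof -
  have "\<exists>g. linear g \<and> (\<forall>t\<in>S. g t = (if t = s then 1 else (0::real)))"
    by (rule linear_independent_extend[OF assms])
  then have "linear (coord S s) \<and> (\<forall>t\<in>S. coord S s t = (if t = s then 1 else 0))"
    unfolding coord_def by (rule someI_ex)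
  then show "linear (coord S s)" "t \<in> S \<Longrightarrow> coord S s t = (if t = s then 1 else 0)"
    by auto
qed

lemmas coord_linear_simps =
  linear_add[OF linear_coord] linear_scale[OF linear_coord] linear_diff[OF linear_coord]
  linear_0[OF linear_coord] linear_sum[OF linear_coord]

lemma coord_sum:
  assumes "independent S" "finite S" "s \<in> S"
  shows "coord S s (\<Sum>t\<in>S. c t *\<^sub>R t) = c s"
proof -
  have "coord S s (\<Sum>t\<in>S. c t *\<^sub>R t) = (\<Sum>t\<in>S. if t = s then c t else 0)"
    unfolding coord_linear_simps(5)[OF assms(1)]
    by (rule sum.cong) (auto simp: coord_linear_simps[OF assms(1)] coord_basis[OF assms(1)])
  then show ?thesis using assms by simp
qed

lemma span_coord:
  assumes "independent S" "finite S" "x \<in> span S"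
  shows "x = (\<Sum>s\<in>S. coord S s x *\<^sub>R s)"
proof -
  obtain c where x: "x = (\<Sum>t\<in>S. c t *\<^sub>R t)"
    using assms by (auto simp: span_finite)
  show ?thesis
    by (subst (1) x, rule sum.cong) (simp_all add: x coord_sum[OF assms(1,2)])
qed

lemma span_subset_coord:
  assumes "independent S" "finite S" "T \<subseteq> S"
  shows "x \<in> span T \<longleftrightarrow> x \<in> span S \<and> (\<forall>s\<in>S - T. coord S s x = 0)"
proof
  assume x: "x \<in> span T"
  have "coord S s x = 0" if "s \<in> S - T" for s
    using x
  proof (induction rule: span_induct_alt)
    case base
    then show ?case by (simp add: coord_linear_simps[OF assms(1)])
  next
    case (step c t y)
    then have "coord S s t = 0"
      using that assms(3) coord_basis[OF assms(1), of t s] by auto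
    then show ?case
      using step by (simp add: coord_linear_simps[OF assms(1)])
  qed
  then show "x \<in> span S \<and> (\<forall>s\<in>S - T. coord S s x = 0)"
    using x span_mono[OF assms(3)] by auto
next
  assume x: "x \<in> span S \<and> (\<forall>s\<in>S - T. coord S s x = 0)"
  then have "x = (\<Sum>s\<in>S. coord S s x *\<^sub>R s)"
    using span_coord assms by blast
  also have "\<dots> = (\<Sum>s\<in>T. coord S s x *\<^sub>R s)"
    by (rule sum.mono_neutral_right) (use x assms in auto)
  finally have sum: "x = (\<Sum>s\<in>T. coord S s x *\<^sub>R s)" .
  show "x \<in> span T"
    by (subst sum, intro span_sum span_scale span_base)
qed

section \<open>Simplicial cones, their faces and their generators in coordinates\<close>

lemma convex_cone_hull_subset_span: "convex_cone hull S \<subseteq> span S"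
  by (rule hull_minimal) (simp_all add: span_superset convex_cone_span)

lemma span_convex_cone_hull: "span (convex_cone hull S) = span S"
proof
  show "span (convex_cone hull S) \<subseteq> span S"
    by (simp add: convex_cone_hull_subset_span span_minimal)
  show "span S \<subseteq> span (convex_cone hull S)"
    by (rule span_mono) (rule hull_subset)
qed

lemma convex_cone_hull_coord:
  assumes "independent S" "finite S"
  shows "convex_cone hull S = {x \<in> span S. \<forall>s\<in>S. 0 \<le> coord S s x}"
proof -
  have "convex_cone hull ((\<lambda>s. s) ` S) = {x \<in> span S. \<forall>s\<in>S. 0 \<le> coord S s x}"
    unfolding convex_cone_hull_image_finite[OF assms(2)]
  proof (intro set_eqI iffI)
    fix x assume "x \<in> {(\<Sum>s\<in>S. c s *\<^sub>R s) | c. \<forall>s\<in>S. 0 \<le> c s}"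
    then obtain c where "\<forall>s\<in>S. 0 \<le> c s" "x = (\<Sum>s\<in>S. c s *\<^sub>R s)" by auto
    then show "x \<in> {x \<in> span S. \<forall>s\<in>S. 0 \<le> coord S s x}"
      using coord_sum[OF assms] by (auto intro!: span_sum span_scale intro: span_base)
  next
    fix x assume x: "x \<in> {x \<in> span S. \<forall>s\<in>S. 0 \<le> coord S s x}"
    then have "x = (\<Sum>s\<in>S. coord S s x *\<^sub>R s)"
      using span_coord[OF assms] by auto
    with x show "x \<in> {(\<Sum>s\<in>S. c s *\<^sub>R s) | c. \<forall>s\<in>S. 0 \<le> c s}"
      by auto
  qed
  then show ?thesis by simp
qed

lemma convex_cone_hull_subset_coord:
  assumes "independent S" "finite S" "T \<subseteq> S"
  shows "convex_cone hull T = {x \<in> convex_cone hull S. \<forall>s\<in>S - T. coord S s x = 0}"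
proof (intro set_eqI iffI)
  fix x assume x: "x \<in> convex_cone hull T"
  then show "x \<in> {x \<in> convex_cone hull S. \<forall>s\<in>S - T. coord S s x = 0}"
    using hull_mono[OF assms(3), of convex_cone] convex_cone_hull_subset_span[of T]
      span_subset_coord[OF assms, of x] by auto
next
  fix x assume x: "x \<in> {x \<in> convex_cone hull S. \<forall>s\<in>S - T. coord S s x = 0}"
  then have "x \<in> span S" and pos: "\<forall>s\<in>S. 0 \<le> coord S s x" and z: "\<forall>s\<in>S - T. coord S s x = 0"
    using convex_cone_hull_coord[OF assms(1,2)] by auto
  then have "x = (\<Sum>s\<in>S. coord S s x *\<^sub>R s)"
    using span_coord[OF assms(1,2)] by blast
  also have "\<dots> = (\<Sum>s\<in>T. coord S s x *\<^sub>R s)"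
    by (rule sum.mono_neutral_right) (use z assms in auto)
  finally have "x = (\<Sum>s\<in>T. coord S s x *\<^sub>R s)" .
  moreover have "finite T" using assms finite_subset by auto
  ultimately have "x \<in> convex_cone hull ((\<lambda>s. s) ` T)"
    unfolding convex_cone_hull_image_finite[OF \<open>finite T\<close>] using pos assms(3)
    by (intro CollectI exI[of _ "\<lambda>s. coord S s x"]) auto
  then show "x \<in> convex_cone hull T" by simp
qed

text \<open>On the cone over \<open>T'\<close> all coordinates outside \<open>T'\<close> vanish,
  while a generator \<open>s\<close> has \<open>s\<close>-coordinate 1; so the generators can be
  read off from the cone.\<close>

lemma convex_cone_hull_inj:
  assumes "independent S" "finite S" "T \<subseteq> S" "T' \<subseteq> S"
    and "convex_cone hull T = convex_cone hull T'"
  shows "T = T'"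
proof -
  have sub: "A \<subseteq> B" if "A \<subseteq> S" "B \<subseteq> S" "convex_cone hull A = convex_cone hull B" for A B
  proof
    fix s assume s: "s \<in> A"
    then have "s \<in> convex_cone hull B"
      using that hull_inc[of s A convex_cone] by auto
    then have zero: "coord S t s = 0" if "t \<in> S - B" for t
      using convex_cone_hull_subset_coord[OF assms(1,2) \<open>B \<subseteq> S\<close>] that by auto
    have "coord S s s = 1"
      using coord_basis[OF assms(1)] s that by auto
    then show "s \<in> B" using s that(1) zero[of s] by auto
  qed
  show ?thesis using sub[OF assms(3,4,5)] sub[OF assms(4,3)] assms(5) by auto
qed

text \<open>The smaller cone is cut out by the vanishing of coordinates that are nonnegative on the
  larger one; if such a coordinate vanishes inside a segment, it vanishes at both ends.\<close>

lemma face_of_simplicial_cone: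
  assumes "independent S" "finite S" "T \<subseteq> S"
  shows "convex_cone hull T face_of convex_cone hull S"
  unfolding face_of_def
proof (intro conjI ballI impI)
  show "convex_cone hull T \<subseteq> convex_cone hull S"
    by (rule hull_mono) (rule assms)
  show "convex (convex_cone hull T)"
    by (rule convex_convex_cone_hull)
  note T = convex_cone_hull_subset_coord[OF assms]
  have zero: "a \<in> convex_cone hull T"
    if ab: "a \<in> convex_cone hull S" "b \<in> convex_cone hull S"
      and u: "(1 - u) *\<^sub>R a + u *\<^sub>R b \<in> convex_cone hull T" "0 < u" "u < 1" for a b u
  proof -
    have "coord S s a = 0" if "s \<in> S - T" for s
    proof -
      have "(1 - u) * coord S s a + u * coord S s b = 0"
        using u(1) that unfolding T by (auto simp: coord_linear_simps[OF assms(1)])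
      moreover have "0 \<le> coord S s a" "0 \<le> coord S s b"
        using ab that unfolding convex_cone_hull_coord[OF assms(1,2)] by auto
      ultimately show ?thesis
        using u by (smt (verit) mult_nonneg_nonneg mult_pos_pos)
    qed
    then show ?thesis unfolding T using ab by auto
  qed
  fix a b x
  assume ab: "a \<in> convex_cone hull S" "b \<in> convex_cone hull S" and x: "x \<in> convex_cone hull T"
    and "x \<in> open_segment a b"
  then obtain u where u: "0 < u" "u < 1" "x = (1 - u) *\<^sub>R a + u *\<^sub>R b"
    by (auto simp: in_segment)
  show "a \<in> convex_cone hull T" using zero[of a b u] ab u x by auto
  show "b \<in> convex_cone hull T" using zero[of b a "1 - u"] ab u x by (auto simp: add.commute)
qed

text \<open>If the \<open>s\<close>-coordinate of a point \<open>x\<close> of the face is positive,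
  then \<open>x\<close> is the midpoint of twice its \<open>s\<close>-part and twice the remaining
  part. The face property puts the former into the face, and rescaling gives \<open>s\<close>
  itself. Hence only generators inside the face contribute to \<open>x\<close>.\<close>

lemma face_of_simplicial_coneD:
  assumes S: "independent S" "finite S" and face: "\<kappa> face_of convex_cone hull S" "convex_cone \<kappa>"
  shows "\<kappa> = convex_cone hull (S \<inter> \<kappa>)"
proof
  show "convex_cone hull (S \<inter> \<kappa>) \<subseteq> \<kappa>"
    by (rule hull_minimal) (use face in auto)
  show "\<kappa> \<subseteq> convex_cone hull (S \<inter> \<kappa>)"
  proof
    fix x assume x: "x \<in> \<kappa>"
    then have xS: "x \<in> convex_cone hull S"
      using face face_of_imp_subset by blast
    have sum: "x = (\<Sum>s\<in>S. coord S s x *\<^sub>R s)"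
      using span_coord[OF S] xS convex_cone_hull_coord[OF S] by auto
    have "s \<in> \<kappa>" if s: "s \<in> S" "coord S s x \<noteq> 0" for s
    proof -
      have pos: "coord S s x > 0"
        using xS s convex_cone_hull_coord[OF S] by force
      let ?a = "(2 * coord S s x) *\<^sub>R s"
      let ?b = "2 *\<^sub>R (\<Sum>t\<in>S - {s}. coord S t x *\<^sub>R t)"
      have a: "?a \<in> convex_cone hull S"
        using pos s by (intro convex_cone_hull_mul) (auto intro: hull_inc)
      have "(\<Sum>t\<in>S - {s}. coord S t x *\<^sub>R t) \<in> convex_cone hull ((\<lambda>s. s) ` (S - {s}))"
        unfolding convex_cone_hull_image_finite[OF finite_Diff[OF S(2)]]
        using xS convex_cone_hull_coord[OF S] by force
      then have b: "?b \<in> convex_cone hull S"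
        using hull_mono[of "S - {s}" S convex_cone] by (intro convex_cone_hull_mul) auto
      have mid: "x = (1/2) *\<^sub>R ?a + (1/2) *\<^sub>R ?b"
        by (subst sum) (simp add: sum.remove[OF S(2) s(1)])
      have "?a \<in> \<kappa>"
      proof (cases "?a = ?b")
        \<comment> \<open>Here the open segment is empty, but then \<open>x\<close> is
          \<open>?a\<close> itself.\<close>
        case True
        have "x = (1/2) *\<^sub>R ?a + (1/2) *\<^sub>R ?a"
          using mid unfolding True[symmetric] .
        also have "\<dots> = ?a" by (simp flip: scaleR_left_distrib)
        finally show ?thesis using x by simp
      next
        case False
        then have "x \<in> open_segment ?a ?b"
          unfolding in_segment using mid by (intro conjI exI[of _ "1/2"]) auto
        then show ?thesis
          using face(1) a b x unfolding face_of_def by blast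
      qed
      then have "(1 / (2 * coord S s x)) *\<^sub>R ?a \<in> \<kappa>"
        using convex_cone_scaleR[OF face(2), of "1 / (2 * coord S s x)" ?a] pos by simp
      then show ?thesis using pos by simp
    qed
    then show "x \<in> convex_cone hull (S \<inter> \<kappa>)"
      using convex_cone_hull_subset_coord[OF S, of "S \<inter> \<kappa>"] xS by auto
  qed
qed

text \<open>Generators of extremal rays occur, up to scaling, in every generating set: writing
  \<open>s\<close> over \<open>S'\<close>, the coordinates other than that of \<open>s\<close> are
  sums of nonnegative terms equal to 0, so any \<open>t\<close> that really contributes is a
  multiple of \<open>s\<close>. This carries rationality from \<open>S'\<close> over to
  \<open>S\<close>.\<close>

lemma simplicial_cone_generator_multiple:
  assumes S: "independent S" "finite S" and S': "finite S'"
    and eq: "convex_cone hull S = convex_cone hull S'" and s: "s \<in> S"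
  shows "\<exists>r>0. r *\<^sub>R s \<in> S'"
proof -
  have "s \<in> convex_cone hull ((\<lambda>s. s) ` S')"
    using eq s hull_inc[of s S convex_cone] by simp
  then obtain c where c: "\<forall>t\<in>S'. 0 \<le> c t" "s = (\<Sum>t\<in>S'. c t *\<^sub>R t)"
    unfolding convex_cone_hull_image_finite[OF S'] by auto
  have S'S: "t \<in> span S" "\<forall>u\<in>S. 0 \<le> coord S u t" if "t \<in> S'" for t
  proof -
    have "t \<in> convex_cone hull S"
      unfolding eq using that by (rule hull_inc)
    then show "t \<in> span S" "\<forall>u\<in>S. 0 \<le> coord S u t"
      unfolding convex_cone_hull_coord[OF S] by auto
  qed
  have coord: "(\<Sum>t\<in>S'. c t * coord S u t) = (if u = s then 1 else 0)" if "u \<in> S" for u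
  proof -
    have "coord S u s = (if u = s then 1 else 0)"
      using coord_basis[OF S(1) s] by auto
    then show ?thesis
      by (subst (asm) c(2)) (simp add: coord_linear_simps[OF S(1)])
  qed
  have "(\<Sum>t\<in>S'. c t * coord S s t) \<noteq> 0" using coord[OF s] by simp
  then obtain t where t: "t \<in> S'" "c t * coord S s t \<noteq> 0"
    by (meson sum.neutral)
  have zero: "coord S u t = 0" if "u \<in> S" "u \<noteq> s" for u
  proof -
    have "(\<Sum>t\<in>S'. c t * coord S u t) = 0" using coord[OF that(1)] that by simp
    then have "c t * coord S u t = 0"
      using sum_nonneg_eq_0_iff[OF S', of "\<lambda>t. c t * coord S u t"] c(1) S'S(2) that t(1) by auto
    then show ?thesis using t by auto
  qed
  have "t = (\<Sum>u\<in>S. coord S u t *\<^sub>R u)"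
    using span_coord[OF S] S'S t by auto
  also have "\<dots> = coord S s t *\<^sub>R s"
    using S(2) s zero by (subst sum.remove[OF S(2) s]) auto
  finally have "coord S s t *\<^sub>R s \<in> S'" using t by simp
  moreover have "coord S s t > 0"
    using S'S(2)[OF t(1)] s t by force
  ultimately show ?thesis by blast
qed

lemma convex_cone_hull_scale:
  assumes "finite S" "\<And>s. s \<in> S \<Longrightarrow> r s > 0"
  shows "convex_cone hull ((\<lambda>s. r s *\<^sub>R s) ` S) = convex_cone hull S"
proof
  show "convex_cone hull ((\<lambda>s. r s *\<^sub>R s) ` S) \<subseteq> convex_cone hull S"
  proof (rule hull_minimal)
    show "(\<lambda>s. r s *\<^sub>R s) ` S \<subseteq> convex_cone hull S"
    proof (rule image_subsetI)
      fix s assume "s \<in> S"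
      then show "r s *\<^sub>R s \<in> convex_cone hull S"
        using convex_cone_hull_mul[OF hull_inc[of s S convex_cone], of "r s"] assms(2)[of s] by simp
    qed
  qed (rule convex_cone_convex_cone_hull)
  show "convex_cone hull S \<subseteq> convex_cone hull ((\<lambda>s. r s *\<^sub>R s) ` S)"
  proof (rule hull_minimal)
    show "S \<subseteq> convex_cone hull ((\<lambda>s. r s *\<^sub>R s) ` S)"
    proof
      fix s assume s: "s \<in> S"
      then have "(1 / r s) *\<^sub>R (r s *\<^sub>R s) \<in> convex_cone hull ((\<lambda>s. r s *\<^sub>R s) ` S)"
        using assms(2)[OF s] s by (intro convex_cone_hull_mul[OF hull_inc[OF imageI]]) simp_all
      then show "s \<in> convex_cone hull ((\<lambda>s. r s *\<^sub>R s) ` S)"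
        using assms(2)[OF s] by simp
    qed
  qed (rule convex_cone_convex_cone_hull)
qed

lemma dim_convex_cone_hull: "independent S \<Longrightarrow> dim (convex_cone hull S) = card S"
  by (metis dim_eq_card_independent dim_span span_convex_cone_hull)

section \<open>Lattices\<close>

lemma group_closure_sum_mem:
  "(\<And>i. i \<in> A \<Longrightarrow> f i \<in> group_closure S) \<Longrightarrow> sum f A \<in> group_closure S"
  by (induction A rule: infinite_finite_induct) (auto intro: group_closure_add)

lemma group_closure_scaleR_nat:
  fixes x :: "'a::real_vector"
  assumes "x \<in> group_closure S"
  shows "of_nat k *\<^sub>R x \<in> group_closure S"
  by (induction k) (auto simp: scaleR_left_distrib intro: group_closure_add assms)

lemma group_closure_scaleR_Ints:
  fixes x :: "'a::real_vector"
  assumes "x \<in> group_closure S" "r \<in> \<int>"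
  shows "r *\<^sub>R x \<in> group_closure S"
proof -
  obtain z where z: "r = of_int z" using assms(2) by (auto elim: Ints_cases)
  show ?thesis
  proof (cases "z \<ge> 0")
    case True
    then have "r = of_nat (nat z)" using z by simp
    then show ?thesis using group_closure_scaleR_nat[OF assms(1)] by simp
  next
    case False
    then have "r *\<^sub>R x = - (of_nat (nat (- z)) *\<^sub>R x)" using z by simp
    then show ?thesis using group_closure_scaleR_nat[OF assms(1), of "nat (- z)"] by simp
  qed
qed

lemma group_closure_subset:
  assumes "S \<subseteq> group_closure T"
  shows "group_closure S \<subseteq> group_closure T"
proof
  fix x assume "x \<in> group_closure S"
  then show "x \<in> group_closure T"
    by induction (use assms in \<open>auto intro: group_closure.diff\<close>)
qed

lemma group_closure_subset_span: "group_closure S \<subseteq> span S"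
proof
  fix x assume "x \<in> group_closure S"
  then show "x \<in> span S"
    by induction (auto intro: span_base span_zero span_diff)
qed

lemma lattice_basisD:
  fixes B :: "'v::euclidean_space set"
  assumes "lattice_basis N B"
  shows "independent B" "finite B" "group_closure B = N" "B \<subseteq> N" "span N = span B"
proof -
  show B: "independent B" "group_closure B = N"
    using assms by (auto simp: lattice_basis_def)
  show "finite B" using B(1) by (rule independent_imp_finite)
  show BN: "B \<subseteq> N"
    unfolding B(2)[symmetric] by (auto intro: group_closure.base)
  have "N \<subseteq> span B"
    unfolding B(2)[symmetric] by (rule group_closure_subset_span)
  then show "span N = span B"
    by (intro equalityI span_minimal span_mono BN) auto
qed

lemma lattice_coord_Ints:
  assumes "lattice_basis N B" "x \<in> N"
  shows "coord B b x \<in> \<int>"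
proof -
  note B = lattice_basisD[OF assms(1)]
  have "x \<in> group_closure B" using assms B by auto
  then show ?thesis
  proof induction
    case (base s)
    then show ?case
      using coord_basis[OF B(1), of s b] by (auto simp: coord_linear_simps[OF B(1)])
  next
    case (diff s t)
    then show ?case by (simp add: coord_linear_simps[OF B(1)])
  qed
qed

lemma lattice_coord_sum:
  assumes "lattice_basis N B" "x \<in> span N"
  shows "x = (\<Sum>b\<in>B. coord B b x *\<^sub>R b)"
  using span_coord[of B x] lattice_basisD[OF assms(1)] assms(2) by auto

lemma is_latticeD:
  assumes "is_lattice N"
  obtains B where "lattice_basis N B"
  using assms by (auto simp: is_lattice_def)

lemma lattice_add: "is_lattice N \<Longrightarrow> x \<in> N \<Longrightarrow> y \<in> N \<Longrightarrow> x + y \<in> N"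
  by (metis group_closure_add is_latticeD lattice_basisD(3))

lemma lattice_diff: "is_lattice N \<Longrightarrow> x \<in> N \<Longrightarrow> y \<in> N \<Longrightarrow> x - y \<in> N"
  by (metis group_closure.diff is_latticeD lattice_basisD(3))

lemma lattice_scaleR_Ints: "is_lattice N \<Longrightarrow> x \<in> N \<Longrightarrow> r \<in> \<int> \<Longrightarrow> r *\<^sub>R x \<in> N"
  by (metis group_closure_scaleR_Ints is_latticeD lattice_basisD(3))

lemma lattice_zero: "is_lattice N \<Longrightarrow> 0 \<in> N"
  by (metis zero_in_group_closure is_latticeD lattice_basisD(3))

lemma lattice_group_closure_subset:
  assumes "is_lattice N" "S \<subseteq> N"
  shows "group_closure S \<subseteq> N"
  by (metis assms group_closure_subset is_latticeD lattice_basisD(3))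

text \<open>Coordinates in a lattice basis are integers and are bounded by a multiple of the norm,
  so only a finite box of coordinate vectors remains.\<close>

lemma finite_lattice_bounded:
  fixes N :: "'v::euclidean_space set"
  assumes "is_lattice N"
  shows "finite {x \<in> N. norm x \<le> M}"
proof -
  obtain B where NB: "lattice_basis N B" using is_latticeD[OF assms] by blast
  note B = lattice_basisD[OF NB]
  have "\<exists>K. \<forall>x. \<bar>coord B b x\<bar> \<le> K * norm x \<and> K \<ge> 0" for b
    using linear_bounded_pos[OF linear_coord[OF B(1), of b]] by (metis less_imp_le real_norm_def)
  then obtain K where K: "\<And>b x. \<bar>coord B b x\<bar> \<le> K b * norm x" "\<And>b. K b \<ge> 0"
    by metis
  let ?G = "(\<Pi>\<^sub>E b\<in>B. {- \<lceil>K b * M\<rceil>..\<lceil>K b * M\<rceil>})"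
  have "{x \<in> N. norm x \<le> M} \<subseteq> (\<lambda>z. \<Sum>b\<in>B. of_int (z b) *\<^sub>R b) ` ?G"
  proof
    fix x assume "x \<in> {x \<in> N. norm x \<le> M}"
    then have x: "x \<in> N" "norm x \<le> M" by auto
    let ?z = "restrict (\<lambda>b. \<lfloor>coord B b x\<rfloor>) B"
    have z: "of_int \<lfloor>coord B b x\<rfloor> = coord B b x" for b
      using lattice_coord_Ints[OF NB x(1)] by (rule of_int_floor)
    have "\<bar>coord B b x\<bar> \<le> K b * M" for b
      using K(1)[of b x] mult_left_mono[OF x(2) K(2)[of b]] by linarith
    then have zb: "- \<lceil>K b * M\<rceil> \<le> \<lfloor>coord B b x\<rfloor> \<and> \<lfloor>coord B b x\<rfloor> \<le> \<lceil>K b * M\<rceil>" for b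
      by (smt (verit) le_of_int_ceiling of_int_le_iff of_int_minus z)
    have "?z \<in> ?G"
      by (rule PiE_I) (use zb in auto)
    moreover have "x = (\<Sum>b\<in>B. of_int (?z b) *\<^sub>R b)"
      using lattice_coord_sum[OF NB, of x] x(1) by (simp add: z span_base)
    ultimately show "x \<in> (\<lambda>z. \<Sum>b\<in>B. of_int (z b) *\<^sub>R b) ` ?G" 
      by (rule rev_image_eqI[where f = "\<lambda>z. \<Sum>b\<in>B. of_int (z b) *\<^sub>R b"])
  qed
  moreover have "finite ?G" by (rule finite_PiE) (auto simp: B)
  ultimately show ?thesis using finite_surj by blast
qed

lemma lattice_coord_nonzero:
  assumes "lattice_basis N B" "x \<in> N" "x \<noteq> 0"
  obtains b where "b \<in> B" "coord B b x \<noteq> 0"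
proof -
  have "x = (\<Sum>b\<in>B. coord B b x *\<^sub>R b)"
    using lattice_coord_sum[OF assms(1)] assms(2) by (simp add: span_base)
  then have "\<exists>b\<in>B. coord B b x \<noteq> 0"
    using assms(3) by (metis (no_types, lifting) scaleR_zero_left sum.neutral)
  then show thesis using that by blast
qed

text \<open>Take the largest \<open>k\<close> by which \<open>x\<close> is divisible in
  \<open>N\<close>. It exists because a nonzero coordinate of the quotient is an integer, of
  absolute value at least 1, so \<open>k\<close> is at most the corresponding coordinate of
  \<open>x\<close>.\<close>

lemma exists_primitive:
  fixes N :: "'v::euclidean_space set"
  assumes "is_lattice N" "x \<in> N" "x \<noteq> 0"
  obtains y k where "primitive N y" "k > 0" "x = of_nat k *\<^sub>R y"
proof -
  obtain B where NB: "lattice_basis N B" using is_latticeD[OF assms(1)] by blast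
  note B = lattice_basisD[OF NB]
  obtain b where b: "b \<in> B" "coord B b x \<noteq> 0"
    using lattice_coord_nonzero[OF NB assms(2,3)] .
  define P where "P k \<longleftrightarrow> k > 0 \<and> (\<exists>y\<in>N. x = of_nat k *\<^sub>R y)" for k
  have bound: "k \<le> nat \<lceil>\<bar>coord B b x\<bar>\<rceil>" if "P k" for k
  proof -
    obtain y where y: "y \<in> N" "x = of_nat k *\<^sub>R y" "k > 0" using \<open>P k\<close> by (auto simp: P_def)
    have c: "coord B b x = of_nat k * coord B b y"
      by (simp add: y(2) coord_linear_simps[OF B(1)])
    then have "coord B b y \<noteq> 0" using b by auto
    then have "\<bar>coord B b y\<bar> \<ge> 1"
      using lattice_coord_Ints[OF NB y(1)] by (rule Ints_nonzero_abs_ge1[rotated])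
    then have "real k \<le> \<bar>coord B b x\<bar>"
      unfolding c abs_mult using mult_left_mono[of 1 "\<bar>coord B b y\<bar>" "real k"] by simp
    then show ?thesis by linarith
  qed
  have "P 1" using assms by (auto simp: P_def)
  then obtain k where k: "P k" "\<And>j. P j \<Longrightarrow> j \<le> k"
    using ex_has_greatest_nat[of P 1 "\<lambda>k. k" "Suc (nat \<lceil>\<bar>coord B b x\<bar>\<rceil>)"] bound
    by (metis le_imp_less_Suc)
  obtain y where y: "y \<in> N" "x = of_nat k *\<^sub>R y" "k > 0" using \<open>P k\<close> by (auto simp: P_def)
  have "primitive N y"
    unfolding primitive_def
  proof (intro conjI ballI allI impI)
    show "y \<in> N" by fact
    show "y \<noteq> 0" using y assms by auto
    fix y' and m :: nat assume y': "y' \<in> N" "y = of_nat m *\<^sub>R y'"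
    then have "m > 0" using \<open>y \<noteq> 0\<close> by (cases m) auto
    moreover have "x = of_nat (k * m) *\<^sub>R y'" using y y' by simp
    ultimately have "P (k * m)" using y y' unfolding P_def by (intro conjI bexI[of _ y']) simp_all
    then have "k * m \<le> k" by (rule k)
    then show "m = 1" using \<open>m > 0\<close> y(3) by (cases m) auto
  qed
  then show thesis using that y by blast
qed

text \<open>Comparing integer coordinates shows that \<open>r\<close> is rational,
  \<open>r = p / q\<close> in lowest terms. By Bezout \<open>y / q\<close> is an integral
  combination of \<open>x\<close> and \<open>y\<close>, hence in \<open>N\<close>; both
  \<open>x\<close> and \<open>y\<close> are multiples of it, so primitivity forces
  \<open>p = q = 1\<close>.\<close>

lemma primitive_unique:
  fixes N :: "'v::euclidean_space set"
  assumes "is_lattice N" "primitive N x" "primitive N y" "r > 0" "x = r *\<^sub>R y"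
  shows "x = y"
proof -
  obtain B where NB: "lattice_basis N B" using is_latticeD[OF assms(1)] by blast
  note B = lattice_basisD[OF NB]
  have xy: "x \<in> N" "y \<in> N" "y \<noteq> 0" using assms by (auto simp: primitive_def)
  obtain b where b: "b \<in> B" "coord B b y \<noteq> 0"
    using lattice_coord_nonzero[OF NB xy(2,3)] .
  have cx: "coord B b x = r * coord B b y"
    by (simp add: assms(5) coord_linear_simps[OF B(1)])
  obtain m n :: int where mn: "coord B b x = of_int m" "coord B b y = of_int n"
    using lattice_coord_Ints[OF NB] xy by (metis Ints_cases)
  \<comment> \<open>Absolute values suffice: \<open>r > 0\<close> gives \<open>m\<close> and
    \<open>n\<close> the same sign.\<close>
  define p where "p = nat (\<bar>m\<bar> div gcd m n)"
  define q where "q = nat (\<bar>n\<bar> div gcd m n)"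
  have n0: "n \<noteq> 0" using b mn by auto
  then have m0: "m \<noteq> 0" using mn cx assms(4) by auto
  let ?g = "gcd m n"
  have g: "?g > 0" using n0 by simp
  have pg: "\<bar>m\<bar> = int p * ?g" "\<bar>n\<bar> = int q * ?g"
    unfolding p_def q_def using g by (simp_all add: pos_imp_zdiv_nonneg_iff)
  have pq0: "p > 0" "q > 0" using pg m0 n0 by (auto intro!: Nat.gr0I)
  have "?g = gcd (int p * ?g) (int q * ?g)"
    using pg by (metis gcd_abs1_int gcd_abs2_int)
  also have "\<dots> = gcd (int p) (int q) * ?g"
    using gcd_mult_distrib_int[of ?g "int p" "int q"] g by (simp only: mult.commute[of _ ?g] abs_of_pos)
  finally have cop: "gcd (int p) (int q) = 1" using g n0 by auto
  have "r * \<bar>of_int n\<bar> = \<bar>of_int m\<bar>"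
    using cx mn assms(4) by (simp add: abs_mult)
  then have "r * of_int \<bar>n\<bar> = of_int \<bar>m\<bar>" by simp
  then have "r * of_nat q * of_int ?g = of_nat p * of_int ?g"
    unfolding pg by simp
  then have r: "r = of_nat p / of_nat q"
    using n0 pq0 by (auto simp: field_simps)
  obtain a c where ac: "a * int p + c * int q = 1"
    using bezout_int[of "int p" "int q"] cop by auto
  let ?z = "(1 / of_nat q) *\<^sub>R y"
  have yz: "y = of_nat q *\<^sub>R ?z" and xz: "x = of_nat p *\<^sub>R ?z"
    using pq0 assms(5) r by simp_all
  have "of_int a *\<^sub>R x + of_int c *\<^sub>R y = (of_int (a * int p + c * int q) / of_nat q) *\<^sub>R y"
    by (simp add: assms(5) r scaleR_left_distrib[symmetric] add_divide_distrib pq0)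
  then have "?z = of_int a *\<^sub>R x + of_int c *\<^sub>R y" unfolding ac by simp
  then have "?z \<in> N"
    using lattice_add[OF assms(1)] lattice_scaleR_Ints[OF assms(1)] xy by simp
  then have "q = 1" "p = 1"
    using assms(2,3) yz xz unfolding primitive_def by blast+
  then show "x = y" using xz yz by simp
qed

lemma primitive_lattice_basis:
  fixes N :: "'v::euclidean_space set"
  assumes "lattice_basis N B" "b \<in> B"
  shows "primitive N b"
  unfolding primitive_def
proof (intro conjI ballI allI impI)
  note B = lattice_basisD[OF assms(1)]
  show "b \<in> N" using B assms by auto
  show "b \<noteq> 0" using B(1) assms(2) dependent_zero by blast
  fix y and k :: nat assume y: "y \<in> N" "b = of_nat k *\<^sub>R y"
  have "coord B b b = of_nat k * coord B b y"
    by (subst (2) y(2)) (simp add: coord_linear_simps[OF B(1)])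
  then have eq: "of_nat k * coord B b y = 1"
    using coord_basis[OF B(1) assms(2)] by simp
  obtain z where z: "coord B b y = of_int z"
    using lattice_coord_Ints[OF assms(1) y(1)] by (auto elim: Ints_cases)
  have "real_of_int (int k * z) = 1" using eq z by simp
  then have "int k * z = 1" by linarith
  then show "k = 1" using zmult_eq_1_iff[of "int k" z] by auto
qed

section \<open>The simplicial structure\<close>

text \<open>\<open>simplicial_fan\<close> provides generators that are merely real vectors; since
  the cone is also generated by lattice vectors, each of them can be rescaled to a primitive
  one.\<close>

lemma simplicial_cone_primitive_generators:
  fixes N :: "'v::euclidean_space set"
  assumes N: "is_lattice N" and C: "convex_cone hull S \<in> Cones N" and S: "independent S"
  obtains T where "independent T" "\<And>t. t \<in> T \<Longrightarrow> primitive N t"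
    "convex_cone hull T = convex_cone hull S"
proof -
  have fin: "finite S" using S by (rule independent_imp_finite)
  obtain S' where S': "finite S'" "S' \<subseteq> N" "convex_cone hull S = convex_cone hull S'"
    using C unfolding Cones_def by blast
  have "\<exists>c>0. primitive N (c *\<^sub>R s)" if s: "s \<in> S" for s
  proof -
    obtain r where r: "r > 0" "r *\<^sub>R s \<in> S'"
      using simplicial_cone_generator_multiple[OF S fin S'(1,3) s] by blast
    have "s \<noteq> 0" using S s dependent_zero by blast
    then have "r *\<^sub>R s \<in> N" "r *\<^sub>R s \<noteq> 0" using r S' by auto
    then obtain y k where y: "primitive N y" "k > 0" "r *\<^sub>R s = of_nat k *\<^sub>R y"
      using exists_primitive[OF N] by blast
    have "y = (1 / of_nat k) *\<^sub>R (of_nat k *\<^sub>R y)" using y(2) by simp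
    also have "\<dots> = (r / of_nat k) *\<^sub>R s" unfolding y(3)[symmetric] by simp
    finally have "primitive N ((r / of_nat k) *\<^sub>R s)" using y(1) by simp
    moreover have "r / of_nat k > 0" using r(1) y(2) by simp
    ultimately show ?thesis by blast
  qed
  then obtain c where c: "\<And>s. s \<in> S \<Longrightarrow> c s > 0" "\<And>s. s \<in> S \<Longrightarrow> primitive N (c s *\<^sub>R s)"
    by metis
  let ?T = "(\<lambda>s. c s *\<^sub>R s) ` S"
  have hull: "convex_cone hull ?T = convex_cone hull S"
    using fin c(1) by (rule convex_cone_hull_scale)
  then have span: "span ?T = span S"
    by (metis span_convex_cone_hull)
  \<comment> \<open>Independence by counting: \<open>?T\<close> spans the same space as
    \<open>S\<close> and has at most as many elements.\<close>
  have "card ?T \<le> card S" using fin by (rule card_image_le)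
  also have "card S = dim (span ?T)"
    by (simp add: span dim_eq_card_independent[OF S])
  finally have "independent ?T"
    by (intro card_le_dim_spanning[of ?T "span ?T"]) (auto simp: fin span_base)
  then show thesis using that[of ?T] hull c by auto
qed

lemma Cones_convex_cone: "\<sigma> \<in> Cones N \<Longrightarrow> convex_cone \<sigma>"
  by (auto simp: Cones_def convex_cone_convex_cone_hull)

text \<open>Justifies the definite description in \<open>ray_vec\<close>: the members of the ray are
  nonnegative multiples of \<open>s\<close>, and positive multiples of a primitive vector are
  primitive only trivially.\<close>

lemma ray_generator:
  assumes "is_lattice N" "primitive N s"
  shows "(THE x. x \<in> convex_cone hull {s} \<and> primitive N x) = s"
proof (rule the_equality)
  show "s \<in> convex_cone hull {s} \<and> primitive N s"
    using assms by (auto intro: hull_inc)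
  fix x assume x: "x \<in> convex_cone hull {s} \<and> primitive N x"
  then have "x \<in> convex_cone hull ((\<lambda>s. s) ` {s})" by simp
  then obtain c where c: "c \<ge> 0" "x = c *\<^sub>R s"
    by (subst (asm) convex_cone_hull_image_finite) auto
  moreover have "x \<noteq> 0" using x by (auto simp: primitive_def)
  ultimately have "c > 0" by (cases "c = 0") auto
  then show "x = s"
    using primitive_unique[OF assms(1) _ assms(2)] x c by blast
qed

locale simplicial_multi_fan =
  fixes \<Delta> :: "('s, 'v::euclidean_space) multi_fan"
  assumes multi_fan: "is_multi_fan \<Delta>" and simplicial: "simplicial_fan \<Delta>"
begin

lemma lattice: "is_lattice (lat \<Delta>)"
  and finite_faces: "finite (faces \<Delta>)"
  and partial_order: "partial_order_on (faces \<Delta>) (le_rel \<Delta>)"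
  and Cones: "I \<in> faces \<Delta> \<Longrightarrow> cone_of \<Delta> I \<in> Cones (lat \<Delta>)"
  and cone_bij: "J \<in> faces \<Delta> \<Longrightarrow> bij_betw (cone_of \<Delta>) {I. (I, J) \<in> le_rel \<Delta>}
          {\<kappa> \<in> Cones (lat \<Delta>). \<kappa> face_of cone_of \<Delta> J}"
  using multi_fan unfolding is_multi_fan_def by blast+

lemma le_facesD: "(I, J) \<in> le_rel \<Delta> \<Longrightarrow> I \<in> faces \<Delta>" "(I, J) \<in> le_rel \<Delta> \<Longrightarrow> J \<in> faces \<Delta>"
  using partial_order by (auto simp: partial_order_on_def preorder_on_def)

lemma le_trans: "(I, J) \<in> le_rel \<Delta> \<Longrightarrow> (J, K) \<in> le_rel \<Delta> \<Longrightarrow> (I, K) \<in> le_rel \<Delta>"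
  using partial_order by (auto simp: partial_order_on_def preorder_on_def dest: transD)

lemma face_of_le: "(I, J) \<in> le_rel \<Delta> \<Longrightarrow> cone_of \<Delta> I face_of cone_of \<Delta> J"
  using cone_bij[of J] le_facesD[of I J] by (auto simp: bij_betw_def)

lemma le_of_face:
  assumes "J \<in> faces \<Delta>" "\<kappa> \<in> Cones (lat \<Delta>)" "\<kappa> face_of cone_of \<Delta> J"
  obtains I where "(I, J) \<in> le_rel \<Delta>" "cone_of \<Delta> I = \<kappa>"
proof -
  have "\<kappa> \<in> cone_of \<Delta> ` {I. (I, J) \<in> le_rel \<Delta>}"
    using bij_betw_imp_surj_on[OF cone_bij[OF assms(1)]] assms by auto
  then show thesis using that by auto
qed

text \<open>Injectivity is stated below a common \<open>J\<close>, since in a multi-fan distinct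
  faces may carry the same cone.\<close>

lemma cone_inj:
  assumes "(I, J) \<in> le_rel \<Delta>" "(I', J) \<in> le_rel \<Delta>" "cone_of \<Delta> I = cone_of \<Delta> I'"
  shows "I = I'"
  using cone_bij[OF le_facesD(2)[OF assms(1)]] assms by (auto simp: bij_betw_def inj_on_def)

section \<open>A face with a chosen set of primitive generators\<close>

context
  fixes I S
  assumes I: "I \<in> faces \<Delta>" and S: "independent S" "\<And>s. s \<in> S \<Longrightarrow> primitive (lat \<Delta>) s"
    and hull: "cone_of \<Delta> I = convex_cone hull S"
begin

lemma finite_generators: "finite S"
  using S(1) by (rule independent_imp_finite)

lemma subface_generators:
  assumes "(K, I) \<in> le_rel \<Delta>"
  obtains T where "T \<subseteq> S" "cone_of \<Delta> K = convex_cone hull T"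
proof -
  have "cone_of \<Delta> K face_of convex_cone hull S"
    using face_of_le[OF assms] hull by simp
  then show thesis
    using face_of_simplicial_coneD[OF S(1) finite_generators, of "cone_of \<Delta> K"] that[of "S \<inter> cone_of \<Delta> K"]
      Cones_convex_cone[OF Cones[OF le_facesD(1)[OF assms]]] by auto
qed

text \<open>The cone over \<open>T\<close> belongs to \<open>Cones\<close> because its generators
  are lattice vectors and a line in it would be a line in the cone of \<open>I\<close>; the axiom on
  faces then supplies \<open>K\<close>.\<close>

lemma subface_of_generators:
  assumes "T \<subseteq> S"
  obtains K where "(K, I) \<in> le_rel \<Delta>" "cone_of \<Delta> K = convex_cone hull T"
proof -
  have "T \<subseteq> lat \<Delta>" using assms S(2) by (auto simp: primitive_def)
  moreover have "\<not> contains_line (convex_cone hull T)"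
  proof -
    have "\<not> contains_line (cone_of \<Delta> I)"
      using Cones[OF I] by (auto simp: Cones_def)
    then show ?thesis
      using hull_mono[OF assms, of convex_cone] unfolding hull contains_line_def by blast
  qed
  moreover have "finite T" using assms finite_generators finite_subset by blast
  ultimately have "convex_cone hull T \<in> Cones (lat \<Delta>)"
    unfolding Cones_def by blast
  moreover have "convex_cone hull T face_of cone_of \<Delta> I"
    unfolding hull using S(1) finite_generators assms by (rule face_of_simplicial_cone)
  ultimately show thesis using le_of_face[OF I] that by blast
qed

lemma ray_vec_generator:
  assumes "i \<in> verts \<Delta> I"
  shows "ray_vec \<Delta> i \<in> S" "cone_of \<Delta> i = convex_cone hull {ray_vec \<Delta> i}"
proof -
  have i: "(i, I) \<in> le_rel \<Delta>" "dim (cone_of \<Delta> i) = 1"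
    using assms by (auto simp: verts_def skel_def)
  obtain T where T: "T \<subseteq> S" "cone_of \<Delta> i = convex_cone hull T"
    using subface_generators[OF i(1)] .
  have "card T = 1"
    using i(2) dim_convex_cone_hull[of T] T independent_mono[OF S(1) T(1)] by simp
  then obtain s where s: "T = {s}" by (auto simp: card_1_singleton_iff)
  then have "ray_vec \<Delta> i = s"
    unfolding ray_vec_def T(2) s using T(1) S(2) s by (intro ray_generator lattice) auto
  then show "ray_vec \<Delta> i \<in> S" "cone_of \<Delta> i = convex_cone hull {ray_vec \<Delta> i}"
    using s T by auto
qed

lemma ray_vecs_eq_generators: "ray_vec \<Delta> ` verts \<Delta> I = S"
proof
  show "ray_vec \<Delta> ` verts \<Delta> I \<subseteq> S" using ray_vec_generator by auto
  show "S \<subseteq> ray_vec \<Delta> ` verts \<Delta> I"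
  proof
    fix s assume s: "s \<in> S"
    then obtain i where i: "(i, I) \<in> le_rel \<Delta>" "cone_of \<Delta> i = convex_cone hull {s}"
      using subface_of_generators[of "{s}"] by auto
    have "independent {s}" using independent_mono[OF S(1), of "{s}"] s by blast
    then have "dim (cone_of \<Delta> i) = 1" using dim_convex_cone_hull[of "{s}"] i by simp
    then have iv: "i \<in> verts \<Delta> I" using i le_facesD(1) by (auto simp: verts_def skel_def)
    have "{ray_vec \<Delta> i} = {s}"
      by (rule convex_cone_hull_inj[OF S(1) finite_generators])
        (use ray_vec_generator[OF iv] i s in auto)
    then show "s \<in> ray_vec \<Delta> ` verts \<Delta> I" using iv by auto
  qed
qed

lemma inj_ray_vec_generators: "inj_on (ray_vec \<Delta>) (verts \<Delta> I)"
proof (rule inj_onI)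
  fix i j assume ij: "i \<in> verts \<Delta> I" "j \<in> verts \<Delta> I" "ray_vec \<Delta> i = ray_vec \<Delta> j"
  show "i = j"
    by (rule cone_inj[of i I j]) (use ij ray_vec_generator(2) in \<open>auto simp: verts_def\<close>)
qed

end

lemma generators:
  assumes "I \<in> faces \<Delta>"
  obtains S where "independent S" "\<And>s. s \<in> S \<Longrightarrow> primitive (lat \<Delta>) s"
    "cone_of \<Delta> I = convex_cone hull S"
proof -
  obtain S where "independent S" "cone_of \<Delta> I = convex_cone hull S"
    using simplicial assms by (auto simp: simplicial_fan_def)
  then show thesis
    using simplicial_cone_primitive_generators[of "lat \<Delta>" S thesis] lattice Cones[OF assms] that by metis
qed

lemma rays:
  assumes "I \<in> faces \<Delta>"
  shows independent_rays: "independent (ray_vec \<Delta> ` verts \<Delta> I)"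
    and cone_rays: "cone_of \<Delta> I = convex_cone hull (ray_vec \<Delta> ` verts \<Delta> I)"
    and inj_rays: "inj_on (ray_vec \<Delta>) (verts \<Delta> I)"
    and primitive_ray: "i \<in> verts \<Delta> I \<Longrightarrow> primitive (lat \<Delta>) (ray_vec \<Delta> i)"
    and finite_verts: "finite (verts \<Delta> I)"
    and card_verts: "card (verts \<Delta> I) = dim (cone_of \<Delta> I)"
proof -
  obtain S where S: "independent S" "\<And>s. s \<in> S \<Longrightarrow> primitive (lat \<Delta>) s"
    "cone_of \<Delta> I = convex_cone hull S" using generators[OF assms] by metis
  have eq: "ray_vec \<Delta> ` verts \<Delta> I = S" using ray_vecs_eq_generators[OF assms S] .
  show "independent (ray_vec \<Delta> ` verts \<Delta> I)" using eq S by simp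
  show "cone_of \<Delta> I = convex_cone hull (ray_vec \<Delta> ` verts \<Delta> I)" using eq S by simp
  show inj: "inj_on (ray_vec \<Delta>) (verts \<Delta> I)" using inj_ray_vec_generators[OF assms S] .
  show "i \<in> verts \<Delta> I \<Longrightarrow> primitive (lat \<Delta>) (ray_vec \<Delta> i)" using eq S(2) by auto
  show "finite (verts \<Delta> I)"
    using finite_imageD[OF _ inj] eq independent_imp_finite[OF S(1)] by simp
  show "card (verts \<Delta> I) = dim (cone_of \<Delta> I)"
    using card_image[OF inj] eq dim_convex_cone_hull[OF S(1)] S(3) by simp
qed

lemma finite_rays: "I \<in> faces \<Delta> \<Longrightarrow> finite (ray_vec \<Delta> ` verts \<Delta> I)"
  using finite_verts by simp

lemma verts_mono: "(K, I) \<in> le_rel \<Delta> \<Longrightarrow> verts \<Delta> K \<subseteq> verts \<Delta> I"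
  using le_trans by (auto simp: verts_def)

text \<open>The identification of a simplicial multi-fan with a simplicial set, in the form in which
  a sum over subsets of \<open>I\<close> becomes a sum over the faces below
  \<open>I\<close>.\<close>

lemma verts_bij:
  assumes I: "I \<in> faces \<Delta>"
  shows "bij_betw (verts \<Delta>) {K. (K, I) \<in> le_rel \<Delta>} (Pow (verts \<Delta> I))"
  unfolding bij_betw_def
proof (intro conjI)
  show "inj_on (verts \<Delta>) {K. (K, I) \<in> le_rel \<Delta>}"
  proof (rule inj_onI)
    fix K K' assume "K \<in> {K. (K, I) \<in> le_rel \<Delta>}" "K' \<in> {K. (K, I) \<in> le_rel \<Delta>}"
      "verts \<Delta> K = verts \<Delta> K'"
    then show "K = K'"
      using cone_inj[of K I K'] cone_rays le_facesD(1) by auto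
  qed
  show "verts \<Delta> ` {K. (K, I) \<in> le_rel \<Delta>} = Pow (verts \<Delta> I)"
  proof
    show "verts \<Delta> ` {K. (K, I) \<in> le_rel \<Delta>} \<subseteq> Pow (verts \<Delta> I)"
      using verts_mono by auto
    show "Pow (verts \<Delta> I) \<subseteq> verts \<Delta> ` {K. (K, I) \<in> le_rel \<Delta>}"
    proof
      fix A assume "A \<in> Pow (verts \<Delta> I)"
      then have A: "A \<subseteq> verts \<Delta> I" by simp
      obtain K where K: "(K, I) \<in> le_rel \<Delta>" "cone_of \<Delta> K = convex_cone hull (ray_vec \<Delta> ` A)"
        using subface_of_generators[OF I independent_rays[OF I] _ cone_rays[OF I], of "ray_vec \<Delta> ` A"]
          primitive_ray[OF I] A by (metis (no_types, lifting) image_iff image_mono)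
      have KI: "verts \<Delta> K \<subseteq> verts \<Delta> I" using K by (intro verts_mono)
      have "ray_vec \<Delta> ` A = ray_vec \<Delta> ` verts \<Delta> K"
        by (rule convex_cone_hull_inj[OF independent_rays[OF I] finite_rays[OF I]])
          (use A KI K cone_rays[OF le_facesD(1)[OF K(1)]] in auto)
      then have "A = verts \<Delta> K"
        using inj_on_image_eq_iff[OF inj_rays[OF I] A KI] by simp
      then show "A \<in> verts \<Delta> ` {K. (K, I) \<in> le_rel \<Delta>}" using K by auto
    qed
  qed
qed

section \<open>Maximal faces and their rays\<close>

lemma top_faces: "I \<in> top_skel \<Delta> \<Longrightarrow> I \<in> faces \<Delta>"
  by (simp add: top_skel_def skel_def)

lemma finite_top: "finite (top_skel \<Delta>)"
  by (rule finite_subset[OF _ finite_faces]) (auto simp: top_faces)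

lemma ray_in_lattice: "I \<in> faces \<Delta> \<Longrightarrow> i \<in> verts \<Delta> I \<Longrightarrow> ray_vec \<Delta> i \<in> lat \<Delta>"
  using primitive_ray by (auto simp: primitive_def)

lemma span_rays_top:
  assumes "I \<in> top_skel \<Delta>"
  shows "span (ray_vec \<Delta> ` verts \<Delta> I) = span (lat \<Delta>)"
proof (rule subspace_dim_equal)
  note I = top_faces[OF assms]
  show "span (ray_vec \<Delta> ` verts \<Delta> I) \<subseteq> span (lat \<Delta>)"
    by (rule span_mono) (use ray_in_lattice[OF I] in auto)
  have "card (verts \<Delta> I) = dim (lat \<Delta>)"
    using card_verts[OF I] assms by (simp add: top_skel_def skel_def fan_rank_def)
  then show "dim (span (lat \<Delta>)) \<le> dim (span (ray_vec \<Delta> ` verts \<Delta> I))"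
    using dim_eq_card_independent[OF independent_rays[OF I]] card_image[OF inj_rays[OF I]] by simp
qed (rule subspace_span)+

end

section \<open>Dual vectors and vertices\<close>

lemma orthogonal_decomposition:
  fixes U :: "'v::euclidean_space set"
  assumes "subspace U"
  obtains y z where "y \<in> U" "z \<in> U\<^sup>\<bottom>" "x = y + z"
proof -
  have "x \<in> U + U\<^sup>\<bottom>"
    using subspace_sum_orthogonal_comp[OF assms] by simp
  then show thesis using that by (auto elim: set_plus_elim)
qed

lemma dual_space_zero: "0 \<in> dual_space N"
  by (simp add: dual_space_def)

lemma dual_space_add: "u \<in> dual_space N \<Longrightarrow> u' \<in> dual_space N \<Longrightarrow> u + u' \<in> dual_space N"
  by (simp add: dual_space_def blinfun.add_left)

lemma dual_space_diff: "u \<in> dual_space N \<Longrightarrow> u' \<in> dual_space N \<Longrightarrow> u - u' \<in> dual_space N"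
  by (simp add: dual_space_def blinfun.diff_left)

lemma dual_space_scaleR: "u \<in> dual_space N \<Longrightarrow> r *\<^sub>R u \<in> dual_space N"
  by (simp add: dual_space_def blinfun.scaleR_left)

lemma dual_space_sum: "(\<And>i. i \<in> A \<Longrightarrow> f i \<in> dual_space N) \<Longrightarrow> sum f A \<in> dual_space N"
  by (induction A rule: infinite_finite_induct) (auto intro: dual_space_add dual_space_zero)

text \<open>Members of \<open>dual_space\<close> vanish on the orthogonal complement, so their
  values on a spanning set of \<open>span N\<close> determine them everywhere.\<close>

lemma dual_space_eqI:
  fixes N :: "'v::euclidean_space set"
  assumes u: "u \<in> dual_space N" "u' \<in> dual_space N" and S: "span S = span N"
    and eq: "\<And>x. x \<in> S \<Longrightarrow> blinfun_apply u x = blinfun_apply u' x"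
  shows "u = u'"
proof (rule blinfun_eqI)
  fix x
  obtain y z where yz: "y \<in> span N" "z \<in> (span N)\<^sup>\<bottom>" "x = y + z"
    using orthogonal_decomposition[OF subspace_span] by blast
  have "blinfun_apply u y = blinfun_apply u' y"
    by (rule linear_eq_on_span[of "blinfun_apply u" "blinfun_apply u'" S])
      (use eq yz S in \<open>auto intro: bounded_linear.linear[OF blinfun.bounded_linear_right]\<close>)
  moreover have "blinfun_apply u z = 0" "blinfun_apply u' z = 0"
    using u yz(2) by (auto simp: dual_space_def)
  ultimately show "blinfun_apply u x = blinfun_apply u' x"
    by (simp add: yz(3) blinfun.add_right)
qed

lemma inner_in_dual_space: "y \<in> span N \<Longrightarrow> blinfun_inner_right y \<in> dual_space N"
  by (auto simp: dual_space_def orthogonal_comp_def orthogonal_def)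

lemma dual_space_exists:
  fixes N :: "'v::euclidean_space set"
  assumes "independent S" "span S = span N"
  obtains u where "u \<in> dual_space N" "\<And>x. x \<in> S \<Longrightarrow> blinfun_apply u x = g x"
proof -
  obtain h where h: "linear h" "\<And>x. x \<in> S \<Longrightarrow> h x = g x"
    using linear_independent_extend[OF assms(1), of g] by blast
  \<comment> \<open>\<open>adjoint h 1\<close> represents \<open>h\<close> as an inner product;
    dropping its component orthogonal to \<open>span N\<close> keeps the values there and lands in
    \<open>dual_space\<close>.\<close>
  obtain y z where yz: "y \<in> span N" "z \<in> (span N)\<^sup>\<bottom>" "adjoint h 1 = y + z"
    using orthogonal_decomposition[OF subspace_span] by blast
  have "blinfun_apply (blinfun_inner_right y) x = g x" if "x \<in> S" for x
  proof -
    have "x \<in> span N" using that assms(2) span_base by blast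
    then have "x \<bullet> z = 0"
      using yz(2) by (auto simp: orthogonal_comp_def orthogonal_def)
    then have "x \<bullet> y = x \<bullet> adjoint h 1" by (simp add: yz(3) inner_add_right)
    also have "\<dots> = h x" using adjoint_works[OF h(1), of x 1] by simp
    finally show ?thesis using h(2)[OF that] by (simp add: inner_commute)
  qed
  then show thesis using that inner_in_dual_space[OF yz(1)] by blast
qed

text \<open>The hyperplane is given by some functional \<open>l\<close> on the dual space. Constancy
  of the evaluation at \<open>x\<close> makes it vanish on the kernel of \<open>l\<close>, so it is
  a multiple of \<open>l\<close>; the multiple is nonzero because \<open>x\<close> pairs
  nontrivially with its own inner product functional.\<close>

lemma hyperplane_level:
  fixes N :: "'v::euclidean_space set"
  assumes H: "affine_hyperplane_in (dual_space N) H"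
    and x: "x \<in> span N" "x \<noteq> 0" and const: "\<exists>c. \<forall>u\<in>H. blinfun_apply u x = c"
  obtains c where "H = {u \<in> dual_space N. blinfun_apply u x = c}"
proof -
  obtain l c0 u1 where l: "linear l" "u1 \<in> dual_space N" "l u1 \<noteq> (0::real)"
    "H = {u \<in> dual_space N. l u = c0}"
    using H unfolding affine_hyperplane_in_def by blast
  obtain c where c: "\<And>u. u \<in> H \<Longrightarrow> blinfun_apply u x = c" using const by blast
  note lin = linear_add[OF l(1)] linear_diff[OF l(1)] linear_scale[OF l(1)]
  define u0 where "u0 = (c0 / l u1) *\<^sub>R u1"
  have u0: "u0 \<in> H"
    using l by (auto simp: u0_def lin intro: dual_space_scaleR)
  have ker: "blinfun_apply h x = 0" if "h \<in> dual_space N" "l h = 0" for h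
  proof -
    have "u0 + h \<in> H" using u0 that l by (auto simp: lin intro: dual_space_add)
    then show ?thesis using c[of "u0 + h"] c[OF u0] by (simp add: blinfun.add_left)
  qed
  have split: "blinfun_apply h x = l h / l u1 * blinfun_apply u1 x" if "h \<in> dual_space N" for h
  proof -
    have "h - (l h / l u1) *\<^sub>R u1 \<in> dual_space N"
      using that l by (intro dual_space_diff dual_space_scaleR)
    then have "blinfun_apply (h - (l h / l u1) *\<^sub>R u1) x = 0"
      using l(3) by (intro ker) (auto simp: lin)
    then show ?thesis by (simp add: blinfun.diff_left blinfun.scaleR_left)
  qed
  have "blinfun_apply (blinfun_inner_right x) x \<noteq> 0" using x(2) by simp
  then have u1x: "blinfun_apply u1 x \<noteq> 0"
    using split[OF inner_in_dual_space[OF x(1)]] by auto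
  have "H = {u \<in> dual_space N. blinfun_apply u x = c}"
  proof (intro equalityI subsetI)
    fix u assume "u \<in> H"
    then show "u \<in> {u \<in> dual_space N. blinfun_apply u x = c}"
      using c[of u] l(4) by auto
  next
    fix u assume u: "u \<in> {u \<in> dual_space N. blinfun_apply u x = c}"
    have d: "u - u0 \<in> dual_space N" using u u0 l(4) by (auto intro: dual_space_diff)
    have "blinfun_apply (u - u0) x = 0" using u c[OF u0] by (simp add: blinfun.diff_left)
    then have "l (u - u0) = 0" using split[OF d] u1x l(3) by simp
    then show "u \<in> H" using u u0 l(4) by (auto simp: lin)
  qed
  then show thesis by (rule that)
qed

lemma prod_of_bool:
  "finite A \<Longrightarrow> (\<Prod>i\<in>A. of_bool (P i)) = (of_bool (\<forall>i\<in>A. P i) :: 'a::comm_semiring_1)"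
  by (induction A rule: finite_induct) auto

context simplicial_multi_fan
begin

abbreviation "rv \<equiv> ray_vec \<Delta>"

text \<open>The source of well-definedness for both \<open>dual_vec\<close> (indicator values) and
  \<open>vertex\<close> (levels as values).\<close>

lemma ex1_dual_space_on_rays:
  assumes "I \<in> top_skel \<Delta>"
  shows "\<exists>!u. u \<in> dual_space (lat \<Delta>) \<and> (\<forall>i\<in>verts \<Delta> I. blinfun_apply u (rv i) = c i)"
proof -
  note I = top_faces[OF assms]
  \<comment> \<open>Values are prescribed on vectors but \<open>c\<close> is indexed by rays;
    injectivity of \<open>rv\<close> on \<open>verts\<close> translates.\<close>
  obtain u where u: "u \<in> dual_space (lat \<Delta>)"
    "\<And>x. x \<in> rv ` verts \<Delta> I \<Longrightarrow> blinfun_apply u x = c (the_inv_into (verts \<Delta> I) rv x)"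
    using dual_space_exists[OF independent_rays[OF I] span_rays_top[OF assms],
        of "\<lambda>x. c (the_inv_into (verts \<Delta> I) rv x)"] by metis
  have "\<forall>i\<in>verts \<Delta> I. blinfun_apply u (rv i) = c i"
    using u(2) the_inv_into_f_f[OF inj_rays[OF I]] by auto
  moreover have "u' = u" if "u' \<in> dual_space (lat \<Delta>)"
    "\<forall>i\<in>verts \<Delta> I. blinfun_apply u' (rv i) = blinfun_apply u (rv i)" for u'
    by (rule dual_space_eqI[OF that(1) u(1) span_rays_top[OF assms]]) (use that in auto)
  ultimately show ?thesis using u(1) by (metis (no_types, lifting))
qed

lemma dual_vec:
  assumes "I \<in> top_skel \<Delta>"
  shows dual_vec_in_dual_space: "dual_vec \<Delta> I i \<in> dual_space (lat \<Delta>)"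
    and dual_vec_ray: "j \<in> verts \<Delta> I \<Longrightarrow> blinfun_apply (dual_vec \<Delta> I i) (rv j) = (if j = i then 1 else 0)"
  using theI'[OF ex1_dual_space_on_rays[OF assms, of "\<lambda>j. if j = i then 1 else 0"]]
  unfolding dual_vec_def by auto

lemma dual_space_expansion:
  assumes "I \<in> top_skel \<Delta>" "u \<in> dual_space (lat \<Delta>)"
  shows "u = (\<Sum>i\<in>verts \<Delta> I. blinfun_apply u (rv i) *\<^sub>R dual_vec \<Delta> I i)"
proof (rule dual_space_eqI[OF assms(2) _ span_rays_top[OF assms(1)]])
  show "(\<Sum>i\<in>verts \<Delta> I. blinfun_apply u (rv i) *\<^sub>R dual_vec \<Delta> I i) \<in> dual_space (lat \<Delta>)"
    by (intro dual_space_sum dual_space_scaleR dual_vec_in_dual_space assms)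
  fix x assume "x \<in> rv ` verts \<Delta> I"
  then obtain j where j: "j \<in> verts \<Delta> I" "x = rv j" by auto
  have "blinfun_apply (\<Sum>i\<in>verts \<Delta> I. blinfun_apply u (rv i) *\<^sub>R dual_vec \<Delta> I i) x =
      (\<Sum>i\<in>verts \<Delta> I. if j = i then blinfun_apply u (rv i) else 0)"
    unfolding blinfun.sum_left j(2)
    by (rule sum.cong) (auto simp: blinfun.scaleR_left dual_vec_ray[OF assms(1) j(1)])
  then show "blinfun_apply u x = blinfun_apply (\<Sum>i\<in>verts \<Delta> I. blinfun_apply u (rv i) *\<^sub>R dual_vec \<Delta> I i) x"
    using j finite_verts[OF top_faces[OF assms(1)]] by simp
qed

lemma dual_vec_sum_ray:
  assumes "I \<in> top_skel \<Delta>" "j \<in> verts \<Delta> I"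
  shows "blinfun_apply (\<Sum>i\<in>verts \<Delta> I. c i *\<^sub>R dual_vec \<Delta> I i) (rv j) = c j"
proof -
  have "blinfun_apply (\<Sum>i\<in>verts \<Delta> I. c i *\<^sub>R dual_vec \<Delta> I i) (rv j) =
      (\<Sum>i\<in>verts \<Delta> I. if j = i then c i else 0)"
    unfolding blinfun.sum_left
    by (rule sum.cong) (auto simp: blinfun.scaleR_left dual_vec_ray[OF assms])
  then show ?thesis using assms(2) finite_verts[OF top_faces[OF assms(1)]] by simp
qed

lemma span_expansion:
  assumes "I \<in> top_skel \<Delta>" "x \<in> span (lat \<Delta>)"
  shows "x = (\<Sum>i\<in>verts \<Delta> I. blinfun_apply (dual_vec \<Delta> I i) x *\<^sub>R rv i)"
proof (rule linear_eq_on_span[of "\<lambda>x. x" "\<lambda>x. \<Sum>i\<in>verts \<Delta> I. blinfun_apply (dual_vec \<Delta> I i) x *\<^sub>R rv i" "rv ` verts \<Delta> I"])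
  show "linear (\<lambda>x. \<Sum>i\<in>verts \<Delta> I. blinfun_apply (dual_vec \<Delta> I i) x *\<^sub>R rv i)"
    by (intro linearI)
      (simp_all add: blinfun.add_right blinfun.scaleR_right scaleR_left_distrib sum.distrib scaleR_sum_right)
  show "x \<in> span (rv ` verts \<Delta> I)" using assms span_rays_top by auto
  fix y assume "y \<in> rv ` verts \<Delta> I"
  then obtain j where j: "j \<in> verts \<Delta> I" "y = rv j" by auto
  have "(\<Sum>i\<in>verts \<Delta> I. blinfun_apply (dual_vec \<Delta> I i) y *\<^sub>R rv i) = (\<Sum>i\<in>verts \<Delta> I. if j = i then rv i else 0)"
    by (rule sum.cong) (auto simp: dual_vec_ray[OF assms(1)] j)
  then show "y = (\<Sum>i\<in>verts \<Delta> I. blinfun_apply (dual_vec \<Delta> I i) y *\<^sub>R rv i)"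
    using j finite_verts[OF top_faces[OF assms(1)]] by simp
qed (simp add: linear_id[unfolded id_def])

text \<open>Stated for arbitrary levels, to serve the given hyperplanes as well as the shifted
  ones.\<close>

lemma vertex_of_levels:
  assumes I: "I \<in> top_skel \<Delta>"
    and H: "\<And>i. i \<in> verts \<Delta> I \<Longrightarrow> H i = {u \<in> dual_space (lat \<Delta>). blinfun_apply u (rv i) = c i}"
  shows "vertex \<Delta> H I \<in> dual_space (lat \<Delta>)"
    and "i \<in> verts \<Delta> I \<Longrightarrow> blinfun_apply (vertex \<Delta> H I) (rv i) = c i"
proof -
  have "vertex \<Delta> H I = (THE u. u \<in> dual_space (lat \<Delta>) \<and> (\<forall>i\<in>verts \<Delta> I. blinfun_apply u (rv i) = c i))"
    unfolding vertex_def by (rule arg_cong[of _ _ The]) (use H in auto)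
  then have "vertex \<Delta> H I \<in> dual_space (lat \<Delta>) \<and> (\<forall>i\<in>verts \<Delta> I. blinfun_apply (vertex \<Delta> H I) (rv i) = c i)"
    using theI'[OF ex1_dual_space_on_rays[OF I, of c]] by simp
  then show "vertex \<Delta> H I \<in> dual_space (lat \<Delta>)"
    "i \<in> verts \<Delta> I \<Longrightarrow> blinfun_apply (vertex \<Delta> H I) (rv i) = c i" by auto
qed

text \<open>In the basis \<open>dual_vec\<close>, the coordinates of \<open>u\<close> minus the
  vertex are the pairings of \<open>u\<close> with the rays minus the levels; membership is a sign
  condition on each of them.\<close>

lemma vertex_cone_iff:
  assumes I: "I \<in> top_skel \<Delta>"
    and H: "\<And>i. i \<in> verts \<Delta> I \<Longrightarrow> H i = {u \<in> dual_space (lat \<Delta>). blinfun_apply u (rv i) = c i}"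
    and u: "u \<in> dual_space (lat \<Delta>)"
  shows "u \<in> vertex_cone \<Delta> H v I \<longleftrightarrow>
    (\<forall>i\<in>verts \<Delta> I. if blinfun_apply (dual_vec \<Delta> I i) v > 0 then c i \<le> blinfun_apply u (rv i)
                    else blinfun_apply u (rv i) \<le> c i)"
    (is "_ \<longleftrightarrow> ?R")
proof -
  \<comment> \<open>A zero pairing counts as negative, in agreement with
    \<open>dual_vec_pos\<close>.\<close>
  let ?s = "\<lambda>i. if blinfun_apply (dual_vec \<Delta> I i) v > 0 then 1 else -1 :: real"
  have pos: "dual_vec_pos \<Delta> v I i = ?s i *\<^sub>R dual_vec \<Delta> I i" for i
    by (simp add: dual_vec_pos_def)
  have hull: "convex_cone hull (dual_vec_pos \<Delta> v I ` verts \<Delta> I) =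
      {(\<Sum>i\<in>verts \<Delta> I. (d i * ?s i) *\<^sub>R dual_vec \<Delta> I i) | d. \<forall>i\<in>verts \<Delta> I. 0 \<le> d i}"
    unfolding convex_cone_hull_image_finite[OF finite_verts[OF top_faces[OF I]]] pos by simp
  note vert = vertex_of_levels[OF I H]
  show ?thesis
  proof
    assume "u \<in> vertex_cone \<Delta> H v I"
    then obtain d where d: "\<forall>i\<in>verts \<Delta> I. 0 \<le> d i"
      and eq: "u = vertex \<Delta> H I + (\<Sum>i\<in>verts \<Delta> I. (d i * ?s i) *\<^sub>R dual_vec \<Delta> I i)"
      unfolding vertex_cone_def hull by blast
    have "blinfun_apply u (rv i) = c i + d i * ?s i" if "i \<in> verts \<Delta> I" for i
      by (simp only: eq blinfun.add_left vert(2)[OF _ that] dual_vec_sum_ray[OF I that])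
    then show ?R using d by auto
  next
    assume R: ?R
    let ?d = "\<lambda>i. ?s i * (blinfun_apply u (rv i) - c i)"
    have "u - vertex \<Delta> H I = (\<Sum>i\<in>verts \<Delta> I. blinfun_apply (u - vertex \<Delta> H I) (rv i) *\<^sub>R dual_vec \<Delta> I i)"
      using dual_space_expansion[OF I dual_space_diff[OF u vert(1)]] by simp
    also have "\<dots> = (\<Sum>i\<in>verts \<Delta> I. (?d i * ?s i) *\<^sub>R dual_vec \<Delta> I i)"
      by (rule sum.cong) (auto simp: blinfun.diff_left vert(2))
    finally have eq: "u - vertex \<Delta> H I = (\<Sum>i\<in>verts \<Delta> I. (?d i * ?s i) *\<^sub>R dual_vec \<Delta> I i)" .
    moreover have "\<forall>i\<in>verts \<Delta> I. 0 \<le> ?d i" using R by auto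
    ultimately have "u - vertex \<Delta> H I \<in> convex_cone hull (dual_vec_pos \<Delta> v I ` verts \<Delta> I)"
      unfolding hull by (intro CollectI exI[of _ ?d]) simp
    then have "vertex \<Delta> H I + (u - vertex \<Delta> H I) \<in> vertex_cone \<Delta> H v I"
      unfolding vertex_cone_def by (rule imageI)
    then show "u \<in> vertex_cone \<Delta> H v I" by simp
  qed
qed

text \<open>The global sign is distributed over the factors: each \<open>i\<close> with positive
  pairing contributes one minus sign.\<close>

lemma DH_eq_sum_prod:
  assumes H: "\<And>I i. I \<in> top_skel \<Delta> \<Longrightarrow> i \<in> verts \<Delta> I \<Longrightarrow>
      H i = {u \<in> dual_space (lat \<Delta>). blinfun_apply u (rv i) = c i}"
    and u: "u \<in> dual_space (lat \<Delta>)"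
  shows "DH \<Delta> H v u = (\<Sum>I\<in>top_skel \<Delta>. weight \<Delta> I *
    (\<Prod>i\<in>verts \<Delta> I. if blinfun_apply (dual_vec \<Delta> I i) v > 0
       then - of_bool (c i \<le> blinfun_apply u (rv i)) else of_bool (blinfun_apply u (rv i) \<le> c i)))"
  unfolding DH_def
proof (rule sum.cong)
  fix I assume I: "I \<in> top_skel \<Delta>"
  note fin = finite_verts[OF top_faces[OF I]]
  let ?P = "\<lambda>i. blinfun_apply (dual_vec \<Delta> I i) v > 0"
  let ?Q = "\<lambda>i. if ?P i then c i \<le> blinfun_apply u (rv i) else blinfun_apply u (rv i) \<le> c i"
  have "(\<Prod>i\<in>verts \<Delta> I. if ?P i then - of_bool (c i \<le> blinfun_apply u (rv i))
        else of_bool (blinfun_apply u (rv i) \<le> c i)) =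
      (\<Prod>i\<in>verts \<Delta> I. (if ?P i then -1 else 1) * (of_bool (?Q i) :: int))"
    by (rule prod.cong) auto
  also have "\<dots> = (-1) ^ card {i \<in> verts \<Delta> I. ?P i} * (\<Prod>i\<in>verts \<Delta> I. of_bool (?Q i))"
    unfolding prod.distrib by (simp add: prod.If_cases[OF fin] Int_def)
  also have "(\<Prod>i\<in>verts \<Delta> I. of_bool (?Q i) :: int) = of_bool (\<forall>i\<in>verts \<Delta> I. ?Q i)"
    using fin by (rule prod_of_bool)
  also have "(\<forall>i\<in>verts \<Delta> I. ?Q i) \<longleftrightarrow> u \<in> vertex_cone \<Delta> H v I"
    using vertex_cone_iff[OF I H[OF I] u] by simp
  finally show "(-1) ^ card {i \<in> verts \<Delta> I. ?P i} * weight \<Delta> I * indicator (vertex_cone \<Delta> H v I) u =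
     weight \<Delta> I * (\<Prod>i\<in>verts \<Delta> I. if ?P i then - of_bool (c i \<le> blinfun_apply u (rv i))
        else of_bool (blinfun_apply u (rv i) \<le> c i))"
    by (simp add: indicator_def)
qed simp

end

section \<open>Signed sums and degrees of projected multi-fans\<close>

lemma quotient_map_works:
  assumes "subspace W"
  shows "quotient_map W x \<in> W\<^sup>\<bottom>" "x - quotient_map W x \<in> W"
proof -
  obtain y z where yz: "y \<in> W" "z \<in> W\<^sup>\<bottom>" "x = y + z"
    using orthogonal_decomposition[OF assms] by blast
  have "\<exists>!p. p \<in> W\<^sup>\<bottom> \<and> x - p \<in> W"
  proof (rule ex1I[of _ z])
    show "z \<in> W\<^sup>\<bottom> \<and> x - z \<in> W" using yz by simp
    fix p assume p: "p \<in> W\<^sup>\<bottom> \<and> x - p \<in> W"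
    then have "p - z \<in> W\<^sup>\<bottom>"
      using yz subspace_diff[OF subspace_orthogonal_comp] by blast
    moreover have "(x - z) - (x - p) \<in> W"
      by (rule subspace_diff[OF assms]) (use p yz in auto)
    ultimately have "orthogonal (p - z) (p - z)" by (auto simp: orthogonal_comp_def)
    then show "p = z" by (simp add: orthogonal_def)
  qed
  from theI'[OF this] show "quotient_map W x \<in> W\<^sup>\<bottom>" "x - quotient_map W x \<in> W"
    unfolding quotient_map_def by auto
qed

lemma quotient_map_eqI:
  assumes W: "subspace W" and p: "p \<in> W\<^sup>\<bottom>" "x - p \<in> W"
  shows "quotient_map W x = p"
proof -
  let ?q = "quotient_map W x"
  have "p - ?q \<in> W\<^sup>\<bottom>"
    using p quotient_map_works[OF W] subspace_diff[OF subspace_orthogonal_comp] by blast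
  moreover have "(x - ?q) - (x - p) \<in> W"
    by (rule subspace_diff[OF W]) (use p quotient_map_works[OF W] in auto)
  ultimately have "orthogonal (p - ?q) (p - ?q)" by (auto simp: orthogonal_comp_def)
  then show ?thesis by (simp add: orthogonal_def)
qed

lemma linear_quotient_map:
  assumes W: "subspace W"
  shows "linear (quotient_map W)"
proof (rule linearI)
  note q = quotient_map_works[OF W]
  fix x y and r :: real
  show "quotient_map W (x + y) = quotient_map W x + quotient_map W y"
  proof (rule quotient_map_eqI[OF W])
    show "quotient_map W x + quotient_map W y \<in> W\<^sup>\<bottom>"
      using q by (intro subspace_add[OF subspace_orthogonal_comp])
    have "(x - quotient_map W x) + (y - quotient_map W y) \<in> W"
      using q by (intro subspace_add[OF W])
    then show "x + y - (quotient_map W x + quotient_map W y) \<in> W"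
      by (simp add: algebra_simps)
  qed
  show "quotient_map W (r *\<^sub>R x) = r *\<^sub>R quotient_map W x"
  proof (rule quotient_map_eqI[OF W])
    show "r *\<^sub>R quotient_map W x \<in> W\<^sup>\<bottom>"
      using q by (intro subspace_scale[OF subspace_orthogonal_comp])
    have "r *\<^sub>R (x - quotient_map W x) \<in> W"
      using q by (intro subspace_scale[OF W])
    then show "r *\<^sub>R x - r *\<^sub>R quotient_map W x \<in> W"
      by (simp add: algebra_simps)
  qed
qed

lemma quotient_map_eq_iff:
  assumes W: "subspace W"
  shows "quotient_map W x = quotient_map W y \<longleftrightarrow> x - y \<in> W"
proof
  assume "quotient_map W x = quotient_map W y"
  then have "x - y = (x - quotient_map W x) - (y - quotient_map W y)" by simp
  also have "\<dots> \<in> W"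
    by (rule subspace_diff[OF W]) (rule quotient_map_works[OF W])+
  finally show "x - y \<in> W" .
next
  assume xy: "x - y \<in> W"
  have "(x - y) + (y - quotient_map W y) \<in> W"
    using xy quotient_map_works[OF W] by (intro subspace_add[OF W])
  then show "quotient_map W x = quotient_map W y"
    using quotient_map_works[OF W] by (intro quotient_map_eqI[OF W]) auto
qed

text \<open>Because the kernel \<open>W\<close> lies in \<open>span A\<close>, the span is a union
  of fibres and nothing is lost by projecting. This transports dimensions and genericity to the
  projected multi-fans.\<close>

lemma quotient_map_in_span_iff:
  assumes W: "subspace W" "W \<subseteq> span A"
  shows "quotient_map W x \<in> span (quotient_map W ` A) \<longleftrightarrow> x \<in> span A"
proof -
  have "x \<in> span A" if y: "y \<in> span A" "quotient_map W x = quotient_map W y" for y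
  proof -
    have "x - y \<in> span A" using y(2) W quotient_map_eq_iff[OF W(1)] by blast
    then have "(x - y) + y \<in> span A" using y(1) by (rule span_add)
    then show ?thesis by simp
  qed
  then show ?thesis
    unfolding linear_span_image[OF linear_quotient_map[OF W(1)]] by auto
qed

context simplicial_multi_fan
begin

text \<open>For \<open>\<beta> i\<close> telling whether \<open>u\<close> lies beyond the hyperplane
  of \<open>i\<close>, this is the Duistermaat-Heckman value at \<open>u\<close>. With
  \<open>\<beta>\<close> left free it is a polynomial whose coefficients can be compared for
  different \<open>x\<close>.\<close>

definition signed_sum :: "'v \<Rightarrow> ('s \<Rightarrow> int) \<Rightarrow> int" where
  "signed_sum x \<beta> = (\<Sum>I\<in>top_skel \<Delta>. weight \<Delta> I *
     (\<Prod>i\<in>verts \<Delta> I. if blinfun_apply (dual_vec \<Delta> I i) x > 0 then - \<beta> i else 1 - \<beta> i))"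

lemma span_cone_le:
  assumes "(K, I) \<in> le_rel \<Delta>"
  shows "span (cone_of \<Delta> K) \<subseteq> span (cone_of \<Delta> I)"
  using face_of_imp_subset[OF face_of_le[OF assms]] by (rule span_mono)

lemma span_cone: "I \<in> faces \<Delta> \<Longrightarrow> span (cone_of \<Delta> I) = span (rv ` verts \<Delta> I)"
  by (simp add: cone_rays span_convex_cone_hull)

lemma span_cone_subset: "I \<in> faces \<Delta> \<Longrightarrow> span (cone_of \<Delta> I) \<subseteq> span (lat \<Delta>)"
  unfolding span_cone by (rule span_mono) (use ray_in_lattice in auto)

lemma top_skel_iff:
  "I \<in> top_skel \<Delta> \<longleftrightarrow> I \<in> faces \<Delta> \<and> span (cone_of \<Delta> I) = span (lat \<Delta>)"
proof
  assume "I \<in> top_skel \<Delta>"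
  then show "I \<in> faces \<Delta> \<and> span (cone_of \<Delta> I) = span (lat \<Delta>)"
    using top_faces span_rays_top span_cone by auto
next
  assume I: "I \<in> faces \<Delta> \<and> span (cone_of \<Delta> I) = span (lat \<Delta>)"
  then have "dim (cone_of \<Delta> I) = dim (lat \<Delta>)" by (metis dim_span)
  then show "I \<in> top_skel \<Delta>" using I by (simp add: top_skel_def skel_def fan_rank_def)
qed

section \<open>The multi-fan projected along a face \<open>K\<close>\<close>

context
  fixes K
  assumes K: "K \<in> faces \<Delta>"
begin

abbreviation (input) "qmap \<equiv> quotient_map (span (cone_of \<Delta> K))"

lemma span_projected_cone_iff:
  assumes "(K, I) \<in> le_rel \<Delta>"
  shows "qmap x \<in> span (qmap ` cone_of \<Delta> I) \<longleftrightarrow> x \<in> span (cone_of \<Delta> I)"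
  by (rule quotient_map_in_span_iff[OF subspace_span span_cone_le[OF assms]])

lemma span_projected_lattice_iff:
  "qmap x \<in> span (qmap ` lat \<Delta>) \<longleftrightarrow> x \<in> span (lat \<Delta>)"
  by (rule quotient_map_in_span_iff[OF subspace_span span_cone_subset[OF K]])

text \<open>Comparing spans instead of numbers avoids computing the rank of the quotient lattice:
  equality of the projected spans lifts, since both original spans contain the kernel.\<close>

lemma dim_projected_cone_eq_iff:
  assumes KI: "(K, I) \<in> le_rel \<Delta>"
  shows "dim (qmap ` cone_of \<Delta> I) = dim (qmap ` lat \<Delta>) \<longleftrightarrow> I \<in> top_skel \<Delta>"
proof -
  note I = le_facesD(2)[OF KI]
  note lin = linear_quotient_map[OF subspace_span[of "cone_of \<Delta> K"]]
  have sub: "span (qmap ` cone_of \<Delta> I) \<subseteq> span (qmap ` lat \<Delta>)"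
    unfolding linear_span_image[OF lin] using span_cone_subset[OF I] by blast
  show ?thesis
  proof
    assume "dim (qmap ` cone_of \<Delta> I) = dim (qmap ` lat \<Delta>)"
    then have eq: "span (qmap ` cone_of \<Delta> I) = span (qmap ` lat \<Delta>)"
      using sub by (intro subspace_dim_equal) auto
    have "span (lat \<Delta>) \<subseteq> span (cone_of \<Delta> I)"
      using span_projected_cone_iff[OF KI] span_projected_lattice_iff unfolding eq by blast
    then show "I \<in> top_skel \<Delta>"
      using top_skel_iff I span_cone_subset[OF I] by blast
  next
    assume "I \<in> top_skel \<Delta>"
    then have "span (qmap ` cone_of \<Delta> I) = span (qmap ` lat \<Delta>)"
      unfolding linear_span_image[OF lin] using top_skel_iff by simp
    then show "dim (qmap ` cone_of \<Delta> I) = dim (qmap ` lat \<Delta>)" by (metis dim_span)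
  qed
qed

lemma projected_simps:
  "lat (projected \<Delta> K) = qmap ` lat \<Delta>"
  "faces (projected \<Delta> K) = {J \<in> faces \<Delta>. (K, J) \<in> le_rel \<Delta>}"
  "cone_of (projected \<Delta> K) J = qmap ` cone_of \<Delta> J"
  "weight (projected \<Delta> K) = weight \<Delta>"
  by (simp_all add: projected_def Let_def weight_def fun_eq_iff)

lemma top_skel_projected:
  "top_skel (projected \<Delta> K) = {I \<in> top_skel \<Delta>. (K, I) \<in> le_rel \<Delta>}"
  using dim_projected_cone_eq_iff top_faces
  by (auto simp: top_skel_def[of "projected \<Delta> K"] skel_def fan_rank_def projected_simps)

lemma generic_projected:
  assumes "generic \<Delta> x"
  shows "generic (projected \<Delta> K) (qmap x)"
  unfolding generic_def projected_simps fan_rank_def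
proof (intro conjI ballI impI)
  show "qmap x \<in> span (qmap ` lat \<Delta>)"
    using assms span_projected_lattice_iff by (simp add: generic_def)
  fix I assume "I \<in> {J \<in> faces \<Delta>. (K, J) \<in> le_rel \<Delta>}" "dim (qmap ` cone_of \<Delta> I) < dim (qmap ` lat \<Delta>)"
  then have KI: "(K, I) \<in> le_rel \<Delta>" and I: "I \<in> faces \<Delta>"
    and dim: "dim (qmap ` cone_of \<Delta> I) \<noteq> dim (qmap ` lat \<Delta>)" by auto
  have not_top: "I \<notin> top_skel \<Delta>" using dim dim_projected_cone_eq_iff[OF KI] by blast
  have "dim (cone_of \<Delta> I) \<le> dim (lat \<Delta>)"
    using dim_subset[OF span_cone_subset[OF I]] by simp
  then have "dim (cone_of \<Delta> I) < fan_rank \<Delta>"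
    using I not_top by (auto simp: top_skel_def skel_def fan_rank_def)
  then show "qmap x \<notin> span (qmap ` cone_of \<Delta> I)"
    using assms I span_projected_cone_iff[OF KI] by (simp add: generic_def)
qed

text \<open>Modulo the span of the cone of \<open>K\<close> the coordinates at the vertices of
  \<open>K\<close> are arbitrary, so only the signs of the others matter.\<close>

lemma projected_cone_iff:
  assumes I: "I \<in> top_skel \<Delta>" and KI: "(K, I) \<in> le_rel \<Delta>" and x: "x \<in> span (lat \<Delta>)"
  shows "qmap x \<in> qmap ` cone_of \<Delta> I \<longleftrightarrow>
    (\<forall>i\<in>verts \<Delta> I - verts \<Delta> K. 0 \<le> blinfun_apply (dual_vec \<Delta> I i) x)"
proof -
  note fin = finite_verts[OF top_faces[OF I]]
  have cone: "cone_of \<Delta> I = {(\<Sum>i\<in>verts \<Delta> I. c i *\<^sub>R rv i) | c. \<forall>i\<in>verts \<Delta> I. 0 \<le> c i}"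
    unfolding cone_rays[OF top_faces[OF I]] convex_cone_hull_image_finite[OF fin] by simp
  have dual_W: "blinfun_apply (dual_vec \<Delta> I i) w = 0"
    if "i \<in> verts \<Delta> I - verts \<Delta> K" "w \<in> span (rv ` verts \<Delta> K)" for i w
    using that(2)
  proof (induction rule: span_induct_alt)
    case (step c z y)
    then obtain j where "j \<in> verts \<Delta> K" "z = rv j" by auto
    then have "blinfun_apply (dual_vec \<Delta> I i) z = 0"
      using dual_vec_ray[OF I, of j i] verts_mono[OF KI] that(1) by auto
    then show ?case using step by (simp add: blinfun.add_right blinfun.scaleR_right)
  qed simp
  have mem: "qmap x \<in> qmap ` cone_of \<Delta> I \<longleftrightarrow> (\<exists>y\<in>cone_of \<Delta> I. x - y \<in> span (rv ` verts \<Delta> K))"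
    unfolding image_iff quotient_map_eq_iff[OF subspace_span] span_cone[OF K] ..
  show ?thesis
    unfolding mem
  proof
    assume "\<exists>y\<in>cone_of \<Delta> I. x - y \<in> span (rv ` verts \<Delta> K)"
    then obtain c where c: "\<forall>i\<in>verts \<Delta> I. 0 \<le> c i"
      "x - (\<Sum>i\<in>verts \<Delta> I. c i *\<^sub>R rv i) \<in> span (rv ` verts \<Delta> K)"
      unfolding cone by blast
    show "\<forall>i\<in>verts \<Delta> I - verts \<Delta> K. 0 \<le> blinfun_apply (dual_vec \<Delta> I i) x"
    proof
      fix i assume i: "i \<in> verts \<Delta> I - verts \<Delta> K"
      have "blinfun_apply (dual_vec \<Delta> I i) (\<Sum>j\<in>verts \<Delta> I. c j *\<^sub>R rv j) = (\<Sum>j\<in>verts \<Delta> I. if j = i then c j else 0)"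
        unfolding blinfun.sum_right
        by (rule sum.cong) (auto simp: blinfun.scaleR_right dual_vec_ray[OF I])
      then have "blinfun_apply (dual_vec \<Delta> I i) x = c i"
        using dual_W[OF i c(2)] i fin by (simp add: blinfun.diff_right)
      then show "0 \<le> blinfun_apply (dual_vec \<Delta> I i) x" using c(1) i by simp
    qed
  next
    assume pos: "\<forall>i\<in>verts \<Delta> I - verts \<Delta> K. 0 \<le> blinfun_apply (dual_vec \<Delta> I i) x"
    let ?l = "\<lambda>i. blinfun_apply (dual_vec \<Delta> I i) x"
    \<comment> \<open>The lift of the projected point obtained by setting the coordinates at the
      vertices of \<open>K\<close> to 0.\<close>
    let ?y = "\<Sum>i\<in>verts \<Delta> I. (if i \<in> verts \<Delta> K then 0 else ?l i) *\<^sub>R rv i"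
    have "?y \<in> cone_of \<Delta> I" unfolding cone
      by (intro CollectI exI[of _ "\<lambda>i. if i \<in> verts \<Delta> K then 0 else ?l i"]) (use pos in auto)
    moreover have "x - ?y = (\<Sum>i\<in>verts \<Delta> I. ?l i *\<^sub>R rv i) - ?y"
      using span_expansion[OF I x] by simp
    then have "x - ?y = (\<Sum>i\<in>verts \<Delta> I. if i \<in> verts \<Delta> K then ?l i *\<^sub>R rv i else 0)"
      by (simp add: sum_subtractf[symmetric] if_distrib if_distribR cong: sum.cong)
        (auto intro: sum.cong)
    then have "x - ?y \<in> span (rv ` verts \<Delta> K)"
      by (auto intro!: span_sum span_scale span_zero intro: span_base[OF imageI])
    ultimately show "\<exists>y\<in>cone_of \<Delta> I. x - y \<in> span (rv ` verts \<Delta> K)" by blast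
  qed
qed

text \<open>Evaluating at \<open>- x\<close> turns the condition of nonnegative coordinates into the
  negation of a positive pairing with \<open>x\<close>, the form occurring in
  \<open>signed_sum\<close>.\<close>

lemma covering_degree_projected:
  assumes x: "x \<in> span (lat \<Delta>)"
  shows "covering_degree (projected \<Delta> K) (qmap (- x)) =
    (\<Sum>I\<in>{I \<in> top_skel \<Delta>. (K, I) \<in> le_rel \<Delta>}.
       weight \<Delta> I * (\<Prod>i\<in>verts \<Delta> I - verts \<Delta> K. of_bool (\<not> blinfun_apply (dual_vec \<Delta> I i) x > 0)))"
proof -
  have "covering_degree (projected \<Delta> K) (qmap (- x)) =
    (\<Sum>I\<in>{I \<in> {I \<in> top_skel \<Delta>. (K, I) \<in> le_rel \<Delta>}. qmap (- x) \<in> qmap ` cone_of \<Delta> I}. weight \<Delta> I)"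
    unfolding covering_degree_def top_skel_projected projected_simps by simp
  also have "\<dots> = (\<Sum>I\<in>{I \<in> top_skel \<Delta>. (K, I) \<in> le_rel \<Delta>}.
      if qmap (- x) \<in> qmap ` cone_of \<Delta> I then weight \<Delta> I else 0)"
    by (rule sum.inter_filter) (simp add: finite_top)
  also have "\<dots> = (\<Sum>I\<in>{I \<in> top_skel \<Delta>. (K, I) \<in> le_rel \<Delta>}.
       weight \<Delta> I * (\<Prod>i\<in>verts \<Delta> I - verts \<Delta> K. of_bool (\<not> blinfun_apply (dual_vec \<Delta> I i) x > 0)))"
  proof (rule sum.cong)
    fix I assume "I \<in> {I \<in> top_skel \<Delta>. (K, I) \<in> le_rel \<Delta>}"
    then have I: "I \<in> top_skel \<Delta>" "(K, I) \<in> le_rel \<Delta>" by auto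
    have fin: "finite (verts \<Delta> I - verts \<Delta> K)"
      using finite_verts[OF top_faces[OF I(1)]] by simp
    have "- x \<in> span (lat \<Delta>)" using x by (rule span_neg)
    then show "(if qmap (- x) \<in> qmap ` cone_of \<Delta> I then weight \<Delta> I else 0) =
       weight \<Delta> I * (\<Prod>i\<in>verts \<Delta> I - verts \<Delta> K. of_bool (\<not> blinfun_apply (dual_vec \<Delta> I i) x > 0))"
      unfolding prod_of_bool[OF fin] using projected_cone_iff[OF I]
      by (simp add: blinfun.minus_right not_less)
  qed simp
  finally show ?thesis .
qed

end

text \<open>
  Each factor is \<open>[\<langle>u\<^sub>i\<^sup>I, x\<rangle> \<le> 0] - \<beta>\<^sub>i\<close>; expanding the product over the subsets of \<open>I\<close>, which are
  the \<open>K \<le> I\<close>, leaves the degree of \<open>\<Delta>\<^sub>K\<close> as coefficient of the monomial belonging to \<open>K\<close>.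
\<close>

lemma signed_sum_eq_degrees:
  assumes x: "x \<in> span (lat \<Delta>)"
  shows "signed_sum x \<beta> = (\<Sum>K\<in>faces \<Delta>. (\<Prod>i\<in>verts \<Delta> K. - \<beta> i) *
    covering_degree (projected \<Delta> K) (quotient_map (span (cone_of \<Delta> K)) (- x)))"
proof -
  let ?n = "\<lambda>I i. of_bool (\<not> blinfun_apply (dual_vec \<Delta> I i) x > 0) :: int"
  let ?t = "\<lambda>I K. (\<Prod>i\<in>verts \<Delta> K. - \<beta> i) * (weight \<Delta> I * (\<Prod>i\<in>verts \<Delta> I - verts \<Delta> K. ?n I i))"
  have "signed_sum x \<beta> = (\<Sum>I\<in>top_skel \<Delta>. \<Sum>K\<in>{K. K \<in> faces \<Delta> \<and> (K, I) \<in> le_rel \<Delta>}. ?t I K)"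
    unfolding signed_sum_def
  proof (rule sum.cong)
    fix I assume I: "I \<in> top_skel \<Delta>"
    note fin = finite_verts[OF top_faces[OF I]]
    have le: "{K. K \<in> faces \<Delta> \<and> (K, I) \<in> le_rel \<Delta>} = {K. (K, I) \<in> le_rel \<Delta>}"
      using le_facesD by auto
    have "(\<Prod>i\<in>verts \<Delta> I. if blinfun_apply (dual_vec \<Delta> I i) x > 0 then - \<beta> i else 1 - \<beta> i) =
        (\<Prod>i\<in>verts \<Delta> I. - \<beta> i + ?n I i)"
      by (rule prod.cong) auto
    also have "\<dots> = (\<Sum>A\<in>Pow (verts \<Delta> I). (\<Prod>i\<in>A. - \<beta> i) * (\<Prod>i\<in>verts \<Delta> I - A. ?n I i))"
      by (rule prod_add[OF fin])
    also have "\<dots> = (\<Sum>K\<in>{K. (K, I) \<in> le_rel \<Delta>}.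
        (\<Prod>i\<in>verts \<Delta> K. - \<beta> i) * (\<Prod>i\<in>verts \<Delta> I - verts \<Delta> K. ?n I i))"
      by (rule sum.reindex_bij_betw[OF verts_bij[OF top_faces[OF I]], symmetric])
    finally show "weight \<Delta> I * (\<Prod>i\<in>verts \<Delta> I. if blinfun_apply (dual_vec \<Delta> I i) x > 0 then - \<beta> i else 1 - \<beta> i) =
        (\<Sum>K\<in>{K. K \<in> faces \<Delta> \<and> (K, I) \<in> le_rel \<Delta>}. ?t I K)"
      unfolding le by (simp add: sum_distrib_left mult.left_commute)
  qed simp
  also have "\<dots> = (\<Sum>K\<in>faces \<Delta>. \<Sum>I\<in>{I. I \<in> top_skel \<Delta> \<and> (K, I) \<in> le_rel \<Delta>}. ?t I K)"
    by (rule sum.swap_restrict[OF finite_top finite_faces])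
  also have "\<dots> = (\<Sum>K\<in>faces \<Delta>. (\<Prod>i\<in>verts \<Delta> K. - \<beta> i) *
      covering_degree (projected \<Delta> K) (quotient_map (span (cone_of \<Delta> K)) (- x)))"
    by (rule sum.cong) (simp_all add: covering_degree_projected x sum_distrib_left)
  finally show ?thesis .
qed

lemma generic_uminus: "generic \<Delta> x \<Longrightarrow> generic \<Delta> (- x)"
  unfolding generic_def using span_neg[of x] span_neg[of "- x"] by auto

lemma signed_sum_independent:
  assumes "complete_fan \<Delta>" "generic \<Delta> x" "generic \<Delta> y"
  shows "signed_sum x \<beta> = signed_sum y \<beta>"
proof -
  have "covering_degree (projected \<Delta> K) (quotient_map (span (cone_of \<Delta> K)) (- x)) =
      covering_degree (projected \<Delta> K) (quotient_map (span (cone_of \<Delta> K)) (- y))" if "K \<in> faces \<Delta>" for K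
    using assms(1) that generic_projected[OF that generic_uminus[OF assms(2)]]
      generic_projected[OF that generic_uminus[OF assms(3)]]
    unfolding complete_fan_def pre_complete_def by metis
  then show ?thesis
    using assms(2,3) by (simp add: signed_sum_eq_degrees generic_def)
qed

text \<open>Since \<open>x\<close> lies in none of the finitely many smaller spans, the line meets
  each of them for at most one \<open>t\<close>.\<close>

lemma generic_line:
  assumes x: "generic \<Delta> x" and y: "y \<in> span (lat \<Delta>)"
  obtains t where "generic \<Delta> (y + t *\<^sub>R x)"
proof -
  let ?B = "\<lambda>I. {t. y + t *\<^sub>R x \<in> span (cone_of \<Delta> I)}"
  let ?L = "{I \<in> faces \<Delta>. dim (cone_of \<Delta> I) < fan_rank \<Delta>}"
  have "finite (?B I)" if I: "I \<in> ?L" for I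
  proof -
    have eq: "t = s" if "t \<in> ?B I" "s \<in> ?B I" for t s
    proof (rule ccontr)
      assume "t \<noteq> s"
      have "(y + t *\<^sub>R x) - (y + s *\<^sub>R x) \<in> span (cone_of \<Delta> I)"
        using that by (intro span_diff) auto
      then have "(t - s) *\<^sub>R x \<in> span (cone_of \<Delta> I)" by (simp add: algebra_simps)
      then have "(1 / (t - s)) *\<^sub>R ((t - s) *\<^sub>R x) \<in> span (cone_of \<Delta> I)" by (rule span_scale)
      then show False using \<open>t \<noteq> s\<close> x I by (auto simp: generic_def)
    qed
    show ?thesis
    proof (cases "?B I = {}")
      case False
      then obtain s where "s \<in> ?B I" by blast
      then have "?B I \<subseteq> {s}" using eq by blast
      then show ?thesis by (rule finite_subset) simp
    qed simp
  qed
  moreover have "finite ?L" using finite_faces by simp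
  ultimately have "finite (\<Union>I\<in>?L. ?B I)" by blast
  then obtain t where "t \<notin> (\<Union>I\<in>?L. ?B I)"
    using ex_new_if_finite[OF infinite_UNIV_char_0] by blast
  then have "generic \<Delta> (y + t *\<^sub>R x)"
    using x y by (auto simp: generic_def intro: span_add span_scale)
  then show thesis by (rule that)
qed

end

section \<open>Finiteness of the support\<close>

context simplicial_multi_fan
begin

lemma ray_in_cone:
  assumes "I \<in> faces \<Delta>" "i \<in> verts \<Delta> I"
  shows "rv i \<in> cone_of \<Delta> i"
  using ray_vec_generator(2)[OF assms(1) independent_rays[OF assms(1)] _ cone_rays[OF assms(1)] assms(2)]
    primitive_ray[OF assms(1)] by (auto intro: hull_inc)

end

locale simple_lattice_polytope = simplicial_multi_fan +
  fixes F :: "'a \<Rightarrow> ('b \<Rightarrow>\<^sub>L real) set"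
  assumes polytope: "simple_lattice_multi_polytope \<Delta> F"
begin

abbreviation "lvl \<equiv> level \<Delta> F"

lemma complete: "complete_fan \<Delta>"
  using polytope by (simp add: simple_lattice_multi_polytope_def simple_multi_polytope_def multi_polytope_def)

lemma hyperplane_eq:
  assumes I: "I \<in> faces \<Delta>" and i: "i \<in> verts \<Delta> I"
  shows "F i = {u \<in> dual_space (lat \<Delta>). blinfun_apply u (rv i) = lvl i}"
proof -
  have x: "rv i \<in> span (lat \<Delta>)" "rv i \<noteq> 0"
    using primitive_ray[OF I i] by (auto simp: primitive_def intro: span_base)
  have "i \<in> skel \<Delta> 1" using i by (simp add: verts_def)
  then have "affine_hyperplane_in (dual_space (lat \<Delta>)) (F i)"
    "\<exists>c. \<forall>u\<in>F i. blinfun_apply u (rv i) = c"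
    using polytope ray_in_cone[OF I i]
    by (auto simp: simple_lattice_multi_polytope_def simple_multi_polytope_def multi_polytope_def)
  then obtain c where c: "F i = {u \<in> dual_space (lat \<Delta>). blinfun_apply u (rv i) = c}"
    using hyperplane_level[OF _ x] by blast
  have "c' = c" if eq: "F i = {u \<in> dual_space (lat \<Delta>). blinfun_apply u (rv i) = c'}" for c'
  proof -
    \<comment> \<open>A functional with value \<open>c\<close> at the ray: the hyperplane is
      nonempty, so its level is unique.\<close>
    let ?u = "(c / (rv i \<bullet> rv i)) *\<^sub>R blinfun_inner_right (rv i)"
    have "blinfun_apply ?u (rv i) = c" using x(2) by (simp add: blinfun.scaleR_left)
    moreover have "?u \<in> dual_space (lat \<Delta>)"
      by (intro dual_space_scaleR inner_in_dual_space x)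
    ultimately have "?u \<in> F i" unfolding c by simp
    then show "c' = c" using \<open>blinfun_apply ?u (rv i) = c\<close> eq by simp
  qed
  then have "lvl i = c" unfolding level_def using c by (intro the_equality) auto
  then show ?thesis using c by simp
qed

lemma vertex_props:
  assumes "I \<in> top_skel \<Delta>"
  shows vertex_in_dual_lattice: "vertex \<Delta> F I \<in> dual_lattice (lat \<Delta>)"
    and vertex_ray: "i \<in> verts \<Delta> I \<Longrightarrow> blinfun_apply (vertex \<Delta> F I) (rv i) = lvl i"
    and level_Ints: "i \<in> verts \<Delta> I \<Longrightarrow> lvl i \<in> \<int>"
proof -
  show d: "vertex \<Delta> F I \<in> dual_lattice (lat \<Delta>)"
    using polytope assms by (simp add: simple_lattice_multi_polytope_def)
  show *: "blinfun_apply (vertex \<Delta> F I) (rv i) = lvl i" if "i \<in> verts \<Delta> I" for i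
    by (rule vertex_of_levels(2)[OF assms hyperplane_eq[OF top_faces[OF assms]]]) (use that in auto)
  show "lvl i \<in> \<int>" if i: "i \<in> verts \<Delta> I"
    using d ray_in_lattice[OF top_faces[OF assms] i] *[OF i] by (auto simp: dual_lattice_def)
qed

text \<open>For lattice points and integer levels, lying on or beyond a hyperplane moved outwards by
  less than 1 means lying strictly beyond the original one; so \<open>\<epsilon>\<close> no longer
  occurs.\<close>

definition beyond :: "('b \<Rightarrow>\<^sub>L real) \<Rightarrow> 'a \<Rightarrow> int" where
  "beyond u i = of_bool (lvl i < blinfun_apply u (rv i))"

lemma DH_shifted:
  assumes \<epsilon>: "0 < \<epsilon>" "\<epsilon> < 1" and u: "u \<in> dual_lattice (lat \<Delta>)"
  shows "DH \<Delta> (shifted \<Delta> F \<epsilon>) v u = signed_sum v (beyond u)"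
proof -
  have "u \<in> dual_space (lat \<Delta>)" using u by (simp add: dual_lattice_def)
  then have "DH \<Delta> (shifted \<Delta> F \<epsilon>) v u = (\<Sum>I\<in>top_skel \<Delta>. weight \<Delta> I *
    (\<Prod>i\<in>verts \<Delta> I. if blinfun_apply (dual_vec \<Delta> I i) v > 0
       then - of_bool (lvl i + \<epsilon> \<le> blinfun_apply u (rv i)) else of_bool (blinfun_apply u (rv i) \<le> lvl i + \<epsilon>)))"
    by (intro DH_eq_sum_prod) (simp add: shifted_def)
  also have "\<dots> = signed_sum v (beyond u)"
    unfolding signed_sum_def beyond_def
  proof (intro sum.cong arg_cong2[of _ _ _ _ "(*)"] prod.cong refl)
    fix I i assume I: "I \<in> top_skel \<Delta>" and i: "i \<in> verts \<Delta> I"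
    obtain m n :: int where "blinfun_apply u (rv i) = of_int m" "lvl i = of_int n"
      using u ray_in_lattice[OF top_faces[OF I] i] level_Ints[OF I i]
      by (auto simp: dual_lattice_def elim!: Ints_cases)
    \<comment> \<open>No integer equals a shifted level, so the two comparisons are complementary
      and the second factor becomes \<open>1 - beyond u i\<close>.\<close>
    moreover have "of_int n + \<epsilon> \<le> of_int m \<longleftrightarrow> n < m" "of_int m \<le> of_int n + \<epsilon> \<longleftrightarrow> \<not> n < m" for m n :: int
      using \<epsilon> by linarith+
    ultimately show "(if blinfun_apply (dual_vec \<Delta> I i) v > 0
       then - of_bool (lvl i + \<epsilon> \<le> blinfun_apply u (rv i)) else of_bool (blinfun_apply u (rv i) \<le> lvl i + \<epsilon>)) =
      (if blinfun_apply (dual_vec \<Delta> I i) v > 0 then - of_bool (lvl i < blinfun_apply u (rv i))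
       else 1 - (of_bool (lvl i < blinfun_apply u (rv i)) :: int))"
      by auto
  qed
  finally show ?thesis .
qed

text \<open>In a nonzero summand every factor is nonzero, which forces the pairing of
  \<open>dual_vec\<close> with \<open>x\<close> and the excess of \<open>u\<close> over the level to
  have the same weak sign. The pairing of \<open>u\<close> minus the vertex with \<open>x\<close> is
  the sum of their products.\<close>

lemma signed_sum_nonzero:
  assumes nz: "signed_sum x (beyond u) \<noteq> 0" and x: "x \<in> span (lat \<Delta>)"
  obtains I where "I \<in> top_skel \<Delta>" "blinfun_apply (vertex \<Delta> F I) x \<le> blinfun_apply u x"
proof -
  obtain I where I: "I \<in> top_skel \<Delta>" and
    prod: "(\<Prod>i\<in>verts \<Delta> I. if blinfun_apply (dual_vec \<Delta> I i) x > 0 then - beyond u i else 1 - beyond u i) \<noteq> 0"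
    using nz unfolding signed_sum_def by (metis (no_types, lifting) mult_zero_right sum.neutral)
  have factor: "(if blinfun_apply (dual_vec \<Delta> I i) x > 0 then - beyond u i else 1 - beyond u i) \<noteq> 0"
    if "i \<in> verts \<Delta> I" for i
    using prod that unfolding prod_zero_iff[OF finite_verts[OF top_faces[OF I]]] by blast
  let ?d = "u - vertex \<Delta> F I"
  have "0 \<le> (\<Sum>i\<in>verts \<Delta> I. blinfun_apply (dual_vec \<Delta> I i) x * blinfun_apply ?d (rv i))"
  proof (rule sum_nonneg)
    fix i assume i: "i \<in> verts \<Delta> I"
    have d: "blinfun_apply ?d (rv i) = blinfun_apply u (rv i) - lvl i"
      using vertex_ray[OF I i] by (simp add: blinfun.diff_left)
    show "0 \<le> blinfun_apply (dual_vec \<Delta> I i) x * blinfun_apply ?d (rv i)"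
      using factor[OF i] unfolding d beyond_def
      by (cases "blinfun_apply (dual_vec \<Delta> I i) x > 0") (auto intro: mult_nonpos_nonpos)
  qed
  also have "\<dots> = blinfun_apply ?d (\<Sum>i\<in>verts \<Delta> I. blinfun_apply (dual_vec \<Delta> I i) x *\<^sub>R rv i)"
    by (simp add: blinfun.sum_right blinfun.scaleR_right)
  also have "\<dots> = blinfun_apply ?d x" using span_expansion[OF I x] by simp
  finally show thesis using that[OF I] by (simp add: blinfun.diff_left)
qed

text \<open>The bounds hold in generic directions only, and a basis vector \<open>b\<close> need not
  be generic. It is replaced by a generic \<open>b + t v\<close>; the bounds there and at
  \<open>v\<close> together control the value at \<open>b\<close>. Integer values on a lattice basis
  determine an element of the dual lattice.\<close>

lemma finite_support:
  assumes v: "generic \<Delta> v"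
  shows "finite {u \<in> dual_lattice (lat \<Delta>). signed_sum v (beyond u) \<noteq> 0}" (is "finite ?U")
proof -
  obtain B where NB: "lattice_basis (lat \<Delta>) B" using is_latticeD[OF lattice] by blast
  note B = lattice_basisD[OF NB]
  \<comment> \<open>A bound free of \<open>u\<close> and even in \<open>x\<close>, so that the lower
    estimate at \<open>- x\<close> is the upper estimate at \<open>x\<close>.\<close>
  define m where "m x = (\<Sum>I\<in>top_skel \<Delta>. \<bar>blinfun_apply (vertex \<Delta> F I) x\<bar>)" for x
  have bound: "\<bar>blinfun_apply u x\<bar> \<le> m x" if u: "u \<in> ?U" and x: "generic \<Delta> x" for u x
  proof -
    have lower: "- m y \<le> blinfun_apply u y" if y: "generic \<Delta> y" for y
    proof -
      have "signed_sum y (beyond u) \<noteq> 0"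
        using u signed_sum_independent[OF complete v y, of "beyond u"] by simp
      then obtain I where I: "I \<in> top_skel \<Delta>" "blinfun_apply (vertex \<Delta> F I) y \<le> blinfun_apply u y"
        using signed_sum_nonzero[of y u] y by (auto simp: generic_def)
      have "\<bar>blinfun_apply (vertex \<Delta> F I) y\<bar> \<le> m y"
        unfolding m_def using finite_top I(1) by (intro member_le_sum) auto
      then show ?thesis using I(2) by linarith
    qed
    have "m (- x) = m x" by (simp add: m_def blinfun.minus_right)
    then show ?thesis
      using lower[OF x] lower[OF generic_uminus[OF x]] by (simp add: blinfun.minus_right)
  qed
  have "\<exists>t. generic \<Delta> (b + t *\<^sub>R v)" if "b \<in> B" for b
    using generic_line[OF v, of b] B that by (metis span_base)
  then obtain t where t: "\<And>b. b \<in> B \<Longrightarrow> generic \<Delta> (b + t b *\<^sub>R v)" by metis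
  define M where "M b = \<lceil>m (b + t b *\<^sub>R v) + \<bar>t b\<bar> * m v\<rceil>" for b
  let ?G = "\<Pi>\<^sub>E b\<in>B. {- M b..M b}"
  let ?f = "\<lambda>u :: 'b \<Rightarrow>\<^sub>L real. restrict (\<lambda>b. \<lfloor>blinfun_apply u b\<rfloor>) B"
  have floor: "of_int \<lfloor>blinfun_apply u b\<rfloor> = blinfun_apply u b" if "u \<in> ?U" "b \<in> B" for u b
    using that B(4) by (intro of_int_floor) (auto simp: dual_lattice_def)
  have "?f u \<in> ?G" if u: "u \<in> ?U" for u
  proof (rule PiE_I)
    fix b assume b: "b \<in> B"
    have "blinfun_apply u b = blinfun_apply u (b + t b *\<^sub>R v) - t b * blinfun_apply u v"
      by (simp add: blinfun.add_right blinfun.scaleR_right)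
    moreover have "\<bar>t b * blinfun_apply u v\<bar> \<le> \<bar>t b\<bar> * m v"
      unfolding abs_mult by (rule mult_left_mono[OF bound[OF u v]]) simp
    ultimately have "\<bar>blinfun_apply u b\<bar> \<le> m (b + t b *\<^sub>R v) + \<bar>t b\<bar> * m v"
      using bound[OF u t[OF b]] by linarith
    then have "\<bar>of_int \<lfloor>blinfun_apply u b\<rfloor>\<bar> \<le> real_of_int (M b)"
      unfolding floor[OF u b] M_def by linarith
    then have "\<bar>\<lfloor>blinfun_apply u b\<rfloor>\<bar> \<le> M b" by linarith
    then show "?f u b \<in> {- M b..M b}" using b by auto
  qed auto
  then have "?f ` ?U \<subseteq> ?G" by blast
  moreover have "finite ?G" using B(2) by (intro finite_PiE) auto
  ultimately have "finite (?f ` ?U)" by (rule finite_subset)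
  moreover have "inj_on ?f ?U"
  proof (rule inj_onI)
    fix u u' assume u: "u \<in> ?U" "u' \<in> ?U" "?f u = ?f u'"
    show "u = u'"
    proof (rule dual_space_eqI[of _ "lat \<Delta>" _ B])
      fix b assume b: "b \<in> B"
      have "\<lfloor>blinfun_apply u b\<rfloor> = \<lfloor>blinfun_apply u' b\<rfloor>" using fun_cong[OF u(3), of b] b by simp
      then show "blinfun_apply u b = blinfun_apply u' b"
        using floor[OF u(1) b] floor[OF u(2) b] by metis
    qed (use u(1,2) B(5) in \<open>simp_all add: dual_lattice_def\<close>)
  qed
  ultimately show ?thesis by (rule finite_imageD)
qed

end

section \<open>Characters of the finite quotient groups\<close>

text \<open>\<open>chi\<close> depends on a chosen representative; an explicit point
  \<open>x\<close> allows changes of representative to be expressed.\<close>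

definition character_at :: "'v::euclidean_space \<Rightarrow> ('v \<Rightarrow>\<^sub>L real) \<Rightarrow> complex" where
  "character_at x u = exp (2 * of_real pi * \<i> * of_real (blinfun_apply u x))"

lemma chi_eq: "chi u g = character_at (SOME x. x \<in> g) u"
  by (simp add: chi_def character_at_def)

lemma character_at_add: "character_at x (u + u') = character_at x u * character_at x u'"
  by (simp add: character_at_def blinfun.add_left distrib_left exp_add)

lemma character_at_add_point: "character_at (x + y) u = character_at x u * character_at y u"
  by (simp add: character_at_def blinfun.add_right distrib_left exp_add)

lemma character_at_eq_1_iff: "character_at x u = 1 \<longleftrightarrow> blinfun_apply u x \<in> \<int>"
proof -
  let ?r = "blinfun_apply u x"
  have "character_at x u = exp (\<i> * of_real (2 * pi * ?r))"
    unfolding character_at_def by (simp add: algebra_simps)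
  then have "character_at x u = 1 \<longleftrightarrow> (\<exists>n::int. 2 * pi * ?r = of_int (2 * n) * pi)"
    by (simp only: exp_eq_1) simp
  also have "\<dots> \<longleftrightarrow> (\<exists>n::int. 2 * pi * ?r = 2 * pi * of_int n)"
    by (simp only: of_int_mult of_int_numeral mult_ac)
  also have "\<dots> \<longleftrightarrow> (\<exists>n::int. ?r = of_int n)"
    by (subst mult_left_cancel) auto
  also have "\<dots> \<longleftrightarrow> blinfun_apply u x \<in> \<int>" by (auto elim: Ints_cases)
  finally show ?thesis .
qed

lemma group_closure_Ints:
  assumes "x \<in> group_closure S" "\<And>s. s \<in> S \<Longrightarrow> blinfun_apply u s \<in> \<int>"
  shows "blinfun_apply u x \<in> \<int>"
  using assms(1) by induction (auto simp: assms(2) blinfun.diff_right)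

context simplicial_multi_fan
begin

definition coset :: "'s \<Rightarrow> 'v \<Rightarrow> 'v set" where
  "coset I x = {y \<in> lat \<Delta>. x - y \<in> sublat \<Delta> I}"

lemma quot_grp_eq: "quot_grp \<Delta> I = coset I ` lat \<Delta>"
  unfolding quot_grp_def quotient_def coset_def by auto

lemma sublat_closed:
  "0 \<in> sublat \<Delta> I" "a \<in> sublat \<Delta> I \<Longrightarrow> b \<in> sublat \<Delta> I \<Longrightarrow> a - b \<in> sublat \<Delta> I"
  "a \<in> sublat \<Delta> I \<Longrightarrow> b \<in> sublat \<Delta> I \<Longrightarrow> a + b \<in> sublat \<Delta> I"
  by (auto simp: sublat_def intro: group_closure.diff group_closure_add)

lemma in_coset: "x \<in> lat \<Delta> \<Longrightarrow> x \<in> coset I x"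
  by (simp add: coset_def sublat_closed)

lemma coset_diff:
  assumes "y \<in> coset I x" "z \<in> coset I x"
  shows "y - z \<in> sublat \<Delta> I"
proof -
  have "(x - z) - (x - y) \<in> sublat \<Delta> I"
    by (rule sublat_closed(2)) (use assms in \<open>auto simp: coset_def\<close>)
  then show ?thesis by simp
qed

lemma coset_eqI:
  assumes "x - y \<in> sublat \<Delta> I"
  shows "coset I x = coset I y"
proof -
  have "x - z \<in> sublat \<Delta> I \<longleftrightarrow> y - z \<in> sublat \<Delta> I" for z
    using sublat_closed(2)[of "x - z" I "x - y"] sublat_closed(3)[of "y - z" I "x - y"] assms
    by (auto simp: algebra_simps)
  then show ?thesis by (simp add: coset_def)
qed

lemma some_in_quot_grp:
  assumes "g \<in> quot_grp \<Delta> I"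
  shows "(SOME x. x \<in> g) \<in> g" "g \<subseteq> lat \<Delta>"
proof -
  obtain x where "x \<in> lat \<Delta>" "g = coset I x"
    using assms by (auto simp: quot_grp_eq)
  then have "x \<in> g" "g \<subseteq> lat \<Delta>" using in_coset by (auto simp: coset_def)
  then show "(SOME x. x \<in> g) \<in> g" "g \<subseteq> lat \<Delta>" by (auto intro: someI)
qed

text \<open>Replacing the coordinates along the rays by their fractional parts moves every coset
  representative into a bounded parallelepiped, which contains finitely many lattice points.\<close>

lemma finite_quot_grp:
  assumes I: "I \<in> top_skel \<Delta>"
  shows "finite (quot_grp \<Delta> I)"
proof -
  let ?P = "{x \<in> lat \<Delta>. norm x \<le> (\<Sum>i\<in>verts \<Delta> I. norm (rv i))}"
  have "quot_grp \<Delta> I \<subseteq> coset I ` ?P"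
  proof
    fix g assume "g \<in> quot_grp \<Delta> I"
    then obtain x where x: "x \<in> lat \<Delta>" "g = coset I x" by (auto simp: quot_grp_eq)
    let ?l = "\<lambda>i. blinfun_apply (dual_vec \<Delta> I i) x"
    let ?s = "\<Sum>i\<in>verts \<Delta> I. of_int \<lfloor>?l i\<rfloor> *\<^sub>R rv i"
    have s: "?s \<in> sublat \<Delta> I"
      unfolding sublat_def
      by (intro group_closure_sum_mem group_closure_scaleR_Ints) (auto intro: group_closure.base)
    have "sublat \<Delta> I \<subseteq> lat \<Delta>"
      unfolding sublat_def using ray_in_lattice[OF top_faces[OF I]]
      by (intro lattice_group_closure_subset[OF lattice]) auto
    then have mem: "x - ?s \<in> lat \<Delta>"
      using x s by (intro lattice_diff[OF lattice]) auto
    have "x = (\<Sum>i\<in>verts \<Delta> I. ?l i *\<^sub>R rv i)"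
      using span_expansion[OF I] x(1) span_base by blast
    then have "x - ?s = (\<Sum>i\<in>verts \<Delta> I. ?l i *\<^sub>R rv i) - ?s" by simp
    also have "\<dots> = (\<Sum>i\<in>verts \<Delta> I. frac (?l i) *\<^sub>R rv i)"
      by (simp add: frac_def scaleR_left_diff_distrib sum_subtractf)
    finally have eq: "x - ?s = (\<Sum>i\<in>verts \<Delta> I. frac (?l i) *\<^sub>R rv i)" .
    have "norm (frac r *\<^sub>R y) \<le> norm y" for r and y :: 'v
      using frac_ge_0[of r] frac_lt_1[of r] by (simp add: mult_left_le_one_le)
    then have "norm (x - ?s) \<le> (\<Sum>i\<in>verts \<Delta> I. norm (rv i))"
      unfolding eq by (intro order.trans[OF norm_sum] sum_mono)
    moreover have "g = coset I (x - ?s)"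
      unfolding x(2) by (rule coset_eqI) (simp add: s)
    ultimately show "g \<in> coset I ` ?P" using mem by blast
  qed
  then show ?thesis
    by (rule finite_subset) (intro finite_imageI finite_lattice_bounded lattice)
qed

lemma card_quot_grp_pos: "I \<in> top_skel \<Delta> \<Longrightarrow> card (quot_grp \<Delta> I) > 0"
  using finite_quot_grp lattice_zero[OF lattice] by (auto simp: card_gt_0_iff quot_grp_eq)

text \<open>Orthogonality of characters. Integrality on the rays makes the character constant on
  cosets; if \<open>a\<close> in the lattice has a non-integral value, translation by
  \<open>a\<close> permutes the cosets and multiplies the sum by a number different from 1.\<close>

lemma sum_character_quot_grp:
  assumes I: "I \<in> top_skel \<Delta>" and u: "u \<in> dual_space (lat \<Delta>)"
    and int: "\<And>i. i \<in> verts \<Delta> I \<Longrightarrow> blinfun_apply u (rv i) \<in> \<int>"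
  shows "(\<Sum>g\<in>quot_grp \<Delta> I. character_at (SOME x. x \<in> g) u) =
    (if u \<in> dual_lattice (lat \<Delta>) then of_nat (card (quot_grp \<Delta> I)) else 0)"
proof (cases "u \<in> dual_lattice (lat \<Delta>)")
  case True
  have "character_at (SOME x. x \<in> g) u = 1" if "g \<in> quot_grp \<Delta> I" for g
    using some_in_quot_grp[OF that] True by (auto simp: character_at_eq_1_iff dual_lattice_def)
  then show ?thesis using True by simp
next
  case False
  then obtain a where a: "a \<in> lat \<Delta>" "blinfun_apply u a \<notin> \<int>"
    using u by (auto simp: dual_lattice_def)
  let ?f = "\<lambda>g. character_at (SOME x. x \<in> g) u"
  let ?\<tau> = "\<lambda>g. (+) a ` g"
  have rep: "character_at x u = character_at y u" if "x - y \<in> sublat \<Delta> I" for x y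
  proof -
    have "character_at (x - y) u = 1"
      using group_closure_Ints[OF that[unfolded sublat_def]] int
      by (auto simp: character_at_eq_1_iff)
    then show ?thesis using character_at_add_point[of "x - y" y u] by simp
  qed
  have \<tau>: "?\<tau> (coset I x) = coset I (a + x)" if "x \<in> lat \<Delta>" for x
  proof (intro equalityI subsetI)
    fix y assume "y \<in> ?\<tau> (coset I x)"
    then show "y \<in> coset I (a + x)" using a(1) lattice_add[OF lattice] by (auto simp: coset_def)
  next
    fix y assume "y \<in> coset I (a + x)"
    then have "y - a \<in> coset I x"
      using a(1) lattice_diff[OF lattice] by (auto simp: coset_def algebra_simps)
    then show "y \<in> ?\<tau> (coset I x)" by (rule rev_image_eqI) simp
  qed
  have "?\<tau> ` quot_grp \<Delta> I \<subseteq> quot_grp \<Delta> I"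
    using \<tau> a(1) lattice_add[OF lattice] by (auto simp: quot_grp_eq)
  moreover have inj: "inj_on ?\<tau> (quot_grp \<Delta> I)"
    by (intro inj_onI) (simp add: inj_image_eq_iff)
  ultimately have bij: "bij_betw ?\<tau> (quot_grp \<Delta> I) (quot_grp \<Delta> I)"
    using endo_inj_surj[OF finite_quot_grp[OF I]] by (auto simp: bij_betw_def)
  have shift: "?f (?\<tau> g) = character_at a u * ?f g" if g: "g \<in> quot_grp \<Delta> I" for g
  proof -
    obtain x where x: "x \<in> lat \<Delta>" "g = coset I x" using g by (auto simp: quot_grp_eq)
    \<comment> \<open>The representative chosen for the translated coset need not be the translated
      representative; both lie in the same coset.\<close>
    have "(SOME y. y \<in> ?\<tau> g) \<in> ?\<tau> g"
      using some_in_quot_grp(1) bij_betwE[OF bij] g by blast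
    then have "(SOME y. y \<in> ?\<tau> g) - (a + (SOME y. y \<in> g)) \<in> sublat \<Delta> I"
      using coset_diff[of _ I x "SOME y. y \<in> g"] some_in_quot_grp(1)[OF g] x(2)
      by auto
    then show ?thesis
      using rep character_at_add_point by metis
  qed
  have "(\<Sum>g\<in>quot_grp \<Delta> I. ?f g) = (\<Sum>g\<in>quot_grp \<Delta> I. ?f (?\<tau> g))"
    by (rule sum.reindex_bij_betw[OF bij, symmetric])
  also have "\<dots> = character_at a u * (\<Sum>g\<in>quot_grp \<Delta> I. ?f g)"
    by (simp add: shift sum_distrib_left)
  finally have "(1 - character_at a u) * (\<Sum>g\<in>quot_grp \<Delta> I. ?f g) = 0"
    by (simp add: left_diff_distrib)
  moreover have "character_at a u \<noteq> 1" using a(2) character_at_eq_1_iff by blast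
  ultimately show ?thesis using False by simp
qed

end

section \<open>Expansion in a generic direction\<close>

context simple_lattice_polytope
begin

text \<open>
  In the direction \<open>v\<close> the geometric series of \<open>1 / (1 - \<chi> t\<^sup>-\<^sup>u)\<close> runs over the multiples \<open>k u\<close> with
  \<open>k \<le> 0\<close> if \<open>\<langle>u, v\<rangle> \<le> 0\<close>, and with \<open>k > 0\<close> otherwise. \<open>expansion v I x T\<close> is the expansion of
  the monomial of \<open>u\<^sub>I\<close> divided by these factors for all \<open>i \<notin> T\<close>, at the character of \<open>x\<close>.
\<close>

definition expansion ::
  "'b \<Rightarrow> 'a \<Rightarrow> 'b \<Rightarrow> 'a set \<Rightarrow> ('b \<Rightarrow>\<^sub>L real) \<Rightarrow> complex" where
  "expansion v I x T u =
     (if u \<in> dual_space (lat \<Delta>) \<and> (\<forall>i\<in>verts \<Delta> I. blinfun_apply u (rv i) \<in> \<int>)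
      then (\<Prod>i\<in>verts \<Delta> I. if i \<in> T then of_bool (blinfun_apply u (rv i) = lvl i)
              else if blinfun_apply (dual_vec \<Delta> I i) v > 0 then - of_bool (lvl i < blinfun_apply u (rv i))
              else of_bool (blinfun_apply u (rv i) \<le> lvl i)) * character_at x (vertex \<Delta> F I - u)
      else 0)"

lemma conv_act_binomial:
  "conv_act (1 - Poly_Mapping.single k a) f u = f u - a * f (u - k)"
proof -
  have "1 - Poly_Mapping.single k a = 1 + Poly_Mapping.single k (- a)"
    by (simp add: single_uminus)
  then show ?thesis
    by (simp only: conv_act_add conv_act_one conv_act_single) simp
qed

text \<open>Telescoping: the binomial compares the coefficients at \<open>u\<close> and at
  \<open>u + dual_vec \<Delta> I i\<close>, whose pairings with the rays of \<open>I\<close> differ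
  by 1 at \<open>i\<close> and agree elsewhere. Both one-sided series, \<open>- [lvl i < y]\<close>
  and \<open>[y \<le> lvl i]\<close>, have the difference \<open>[y = lvl i]\<close>, so either
  choice of direction gives the same result.\<close>

lemma expansion_step:
  assumes I: "I \<in> top_skel \<Delta>" and i: "i \<in> verts \<Delta> I" "i \<notin> T"
  shows "conv_act (1 - Poly_Mapping.single (- dual_vec \<Delta> I i) (character_at x (dual_vec \<Delta> I i)))
    (expansion v I x T) = expansion v I x (insert i T)"
proof
  fix u
  let ?w = "dual_vec \<Delta> I i"
  note fin = finite_verts[OF top_faces[OF I]]
  have w: "?w \<in> dual_space (lat \<Delta>)" by (rule dual_vec_in_dual_space[OF I])
  have rays: "blinfun_apply (u + ?w) (rv j) = blinfun_apply u (rv j) + (if j = i then 1 else 0)"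
    if "j \<in> verts \<Delta> I" for j
    using dual_vec_ray[OF I that] by (simp add: blinfun.add_left)
  have "u + ?w \<in> dual_space (lat \<Delta>) \<longleftrightarrow> u \<in> dual_space (lat \<Delta>)"
    using dual_space_add[OF _ w, of u] dual_space_diff[OF _ w, of "u + ?w"] by auto
  moreover have "(\<forall>j\<in>verts \<Delta> I. blinfun_apply (u + ?w) (rv j) \<in> \<int>) \<longleftrightarrow>
      (\<forall>j\<in>verts \<Delta> I. blinfun_apply u (rv j) \<in> \<int>)"
  proof (rule ball_cong[OF refl])
    fix j assume "j \<in> verts \<Delta> I"
    then show "blinfun_apply (u + ?w) (rv j) \<in> \<int> \<longleftrightarrow> blinfun_apply u (rv j) \<in> \<int>"
      using rays[of j] Ints_add[of "blinfun_apply u (rv j)" 1] Ints_diff[of "blinfun_apply u (rv j) + 1" 1]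
      by auto
  qed
  ultimately have cond: "u + ?w \<in> dual_space (lat \<Delta>) \<and> (\<forall>j\<in>verts \<Delta> I. blinfun_apply (u + ?w) (rv j) \<in> \<int>)
      \<longleftrightarrow> u \<in> dual_space (lat \<Delta>) \<and> (\<forall>j\<in>verts \<Delta> I. blinfun_apply u (rv j) \<in> \<int>)"
    by blast
  show "conv_act (1 - Poly_Mapping.single (- ?w) (character_at x ?w)) (expansion v I x T) u =
      expansion v I x (insert i T) u"
  proof (cases "u \<in> dual_space (lat \<Delta>) \<and> (\<forall>j\<in>verts \<Delta> I. blinfun_apply u (rv j) \<in> \<int>)")
    case False
    then have "\<not> (u + ?w \<in> dual_space (lat \<Delta>) \<and> (\<forall>j\<in>verts \<Delta> I. blinfun_apply (u + ?w) (rv j) \<in> \<int>))"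
      using cond by blast
    then show ?thesis
      using False unfolding conv_act_binomial expansion_def by auto
  next
    case True
    let ?c = "\<lambda>S j y. if j \<in> S then of_bool (y = lvl j)
              else if blinfun_apply (dual_vec \<Delta> I j) v > 0 then - of_bool (lvl j < y)
              else (of_bool (y \<le> lvl j) :: complex)"
    let ?E = "character_at x (vertex \<Delta> F I - u)"
    have e: "expansion v I x S u = (\<Prod>j\<in>verts \<Delta> I. ?c S j (blinfun_apply u (rv j))) * ?E" for S
      unfolding expansion_def using True by simp
    have e': "expansion v I x T (u + ?w) =
        (\<Prod>j\<in>verts \<Delta> I. ?c T j (blinfun_apply (u + ?w) (rv j))) * character_at x (vertex \<Delta> F I - (u + ?w))"
      unfolding expansion_def using True cond by simp
    \<comment> \<open>The coefficient is the character of the vertex minus \<open>u\<close>, because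
      each step by \<open>- dual_vec\<close> contributes one factor; hence the factor of the
      binomial is absorbed.\<close>
    have E: "character_at x ?w * character_at x (vertex \<Delta> F I - (u + ?w)) = ?E"
      by (simp flip: character_at_add)
    let ?R = "\<Prod>j\<in>verts \<Delta> I - {i}. ?c T j (blinfun_apply u (rv j))"
    have p1: "(\<Prod>j\<in>verts \<Delta> I. ?c T j (blinfun_apply u (rv j))) = ?c T i (blinfun_apply u (rv i)) * ?R"
      by (rule prod.remove[OF fin i(1)])
    have "(\<Prod>j\<in>verts \<Delta> I. ?c T j (blinfun_apply (u + ?w) (rv j))) =
        ?c T i (blinfun_apply (u + ?w) (rv i)) *
        (\<Prod>j\<in>verts \<Delta> I - {i}. ?c T j (blinfun_apply (u + ?w) (rv j)))"
      by (rule prod.remove[OF fin i(1)])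
    also have "(\<Prod>j\<in>verts \<Delta> I - {i}. ?c T j (blinfun_apply (u + ?w) (rv j))) = ?R"
      by (rule prod.cong) (auto simp: rays)
    finally have p2: "(\<Prod>j\<in>verts \<Delta> I. ?c T j (blinfun_apply (u + ?w) (rv j))) =
        ?c T i (blinfun_apply u (rv i) + 1) * ?R"
      using rays[OF i(1)] by simp
    have "(\<Prod>j\<in>verts \<Delta> I. ?c (insert i T) j (blinfun_apply u (rv j))) =
        ?c (insert i T) i (blinfun_apply u (rv i)) *
        (\<Prod>j\<in>verts \<Delta> I - {i}. ?c (insert i T) j (blinfun_apply u (rv j)))"
      by (rule prod.remove[OF fin i(1)])
    also have "(\<Prod>j\<in>verts \<Delta> I - {i}. ?c (insert i T) j (blinfun_apply u (rv j))) = ?R"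
      by (rule prod.cong) auto
    finally have p3: "(\<Prod>j\<in>verts \<Delta> I. ?c (insert i T) j (blinfun_apply u (rv j))) =
        of_bool (blinfun_apply u (rv i) = lvl i) * ?R" by simp
    obtain m n :: int where mn: "blinfun_apply u (rv i) = of_int m" "lvl i = of_int n"
      using True i level_Ints[OF I i(1)] by (auto elim!: Ints_cases)
    have "real_of_int n < of_int m + 1 \<longleftrightarrow> n \<le> m" "real_of_int m + 1 \<le> of_int n \<longleftrightarrow> m < n"
      by linarith+
    then have key: "?c T i (blinfun_apply u (rv i)) - ?c T i (blinfun_apply u (rv i) + 1) =
        of_bool (blinfun_apply u (rv i) = lvl i)"
      using i(2) unfolding mn by auto
    have "conv_act (1 - Poly_Mapping.single (- ?w) (character_at x ?w)) (expansion v I x T) u =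
        expansion v I x T u - character_at x ?w * expansion v I x T (u + ?w)"
      by (simp add: conv_act_binomial)
    also have "\<dots> = (?c T i (blinfun_apply u (rv i)) * ?R) * ?E
        - (?c T i (blinfun_apply u (rv i) + 1) * ?R) * (character_at x ?w * character_at x (vertex \<Delta> F I - (u + ?w)))"
      unfolding e e' p1 p2 by (simp only: mult_ac)
    also have "\<dots> = (?c T i (blinfun_apply u (rv i)) - ?c T i (blinfun_apply u (rv i) + 1)) * (?R * ?E)"
      unfolding E by (simp only: left_diff_distrib mult.assoc)
    also have "\<dots> = expansion v I x (insert i T) u"
      unfolding key e p3 by (simp only: mult.assoc)
    finally show ?thesis .
  qed
qed

text \<open>The factors of the denominator are cleared one at a time. Afterwards every pairing with
  a ray is pinned to its level, which leaves the vertex alone.\<close>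

lemma conv_act_expansion:
  assumes I: "I \<in> top_skel \<Delta>"
  shows "conv_act (\<Prod>i\<in>verts \<Delta> I. 1 - Poly_Mapping.single (- dual_vec \<Delta> I i) (character_at x (dual_vec \<Delta> I i)))
    (expansion v I x {}) = Poly_Mapping.lookup (Poly_Mapping.single (vertex \<Delta> F I) 1)"
proof -
  note fin = finite_verts[OF top_faces[OF I]]
  let ?q = "\<lambda>i. 1 - Poly_Mapping.single (- dual_vec \<Delta> I i) (character_at x (dual_vec \<Delta> I i))"
  have "conv_act (prod ?q T) (expansion v I x {}) = expansion v I x T" if "T \<subseteq> verts \<Delta> I" for T
    using finite_subset[OF that fin] that
  proof (induction T rule: finite_induct)
    case empty
    then show ?case by (simp add: fun_eq_iff conv_act_one)
  next
    case (insert i T)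
    have "conv_act (prod ?q (insert i T)) (expansion v I x {}) u = expansion v I x (insert i T) u" for u
    proof -
      have "conv_act (prod ?q (insert i T)) (expansion v I x {}) u =
          conv_act (?q i) (conv_act (prod ?q T) (expansion v I x {})) u"
        unfolding prod.insert[OF insert.hyps] by (rule conv_act_mult)
      also have "conv_act (prod ?q T) (expansion v I x {}) = expansion v I x T"
        using insert by simp
      also have "conv_act (?q i) (expansion v I x T) = expansion v I x (insert i T)"
        by (rule expansion_step[OF I]) (use insert in auto)
      finally show ?thesis .
    qed
    then show ?case by blast
  qed
  then have "conv_act (prod ?q (verts \<Delta> I)) (expansion v I x {}) = expansion v I x (verts \<Delta> I)"
    by simp
  also have "\<dots> = Poly_Mapping.lookup (Poly_Mapping.single (vertex \<Delta> F I) 1)"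
  proof
    fix u
    have vert: "vertex \<Delta> F I \<in> dual_space (lat \<Delta>)"
      using vertex_in_dual_lattice[OF I] by (simp add: dual_lattice_def)
    have prod: "(\<Prod>i\<in>verts \<Delta> I. if i \<in> verts \<Delta> I then of_bool (blinfun_apply u (rv i) = lvl i)
              else if blinfun_apply (dual_vec \<Delta> I i) v > 0 then - of_bool (lvl i < blinfun_apply u (rv i))
              else of_bool (blinfun_apply u (rv i) \<le> lvl i)) =
        (of_bool (\<forall>i\<in>verts \<Delta> I. blinfun_apply u (rv i) = lvl i) :: complex)"
      unfolding prod_of_bool[OF fin, symmetric] by (rule prod.cong) auto
    show "expansion v I x (verts \<Delta> I) u = Poly_Mapping.lookup (Poly_Mapping.single (vertex \<Delta> F I) 1) u"
    proof (cases "u = vertex \<Delta> F I")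
      case True
      moreover have "\<forall>i\<in>verts \<Delta> I. blinfun_apply u (rv i) = lvl i"
        using True vertex_ray[OF I] by simp
      ultimately have "expansion v I x (verts \<Delta> I) u = 1"
        unfolding expansion_def prod using vert level_Ints[OF I] by (simp add: character_at_def)
      then show ?thesis using True by simp
    next
      case False
      have "u = vertex \<Delta> F I"
        if "u \<in> dual_space (lat \<Delta>)" "\<forall>i\<in>verts \<Delta> I. blinfun_apply u (rv i) = lvl i"
        by (rule dual_space_eqI[OF that(1) vert span_rays_top[OF I]])
          (use that vertex_ray[OF I] in auto)
      then have "expansion v I x (verts \<Delta> I) u = 0"
        unfolding expansion_def prod using False by auto
      then show ?thesis using False by (simp add: lookup_single)
    qed
  qed
  finally show ?thesis .
qed

text \<open>Only the character depends on \<open>g\<close>, and it is evaluated at the vertex minus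
  \<open>u\<close>. As the vertex is in the dual lattice, that difference lies there exactly if
  \<open>u\<close> does.\<close>

lemma sum_expansion:
  assumes I: "I \<in> top_skel \<Delta>"
  shows "(\<Sum>g\<in>quot_grp \<Delta> I. expansion v I (SOME x. x \<in> g) {} u) =
    (if u \<in> dual_lattice (lat \<Delta>)
     then of_nat (card (quot_grp \<Delta> I)) * of_int (\<Prod>i\<in>verts \<Delta> I.
       if blinfun_apply (dual_vec \<Delta> I i) v > 0 then - beyond u i else 1 - beyond u i)
     else 0)"
proof (cases "u \<in> dual_space (lat \<Delta>) \<and> (\<forall>i\<in>verts \<Delta> I. blinfun_apply u (rv i) \<in> \<int>)")
  case False
  then have "u \<notin> dual_lattice (lat \<Delta>)"
    using ray_in_lattice[OF top_faces[OF I]] by (auto simp: dual_lattice_def)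
  moreover have "expansion v I x {} u = 0" for x
    unfolding expansion_def using False by auto
  ultimately show ?thesis by simp
next
  case True
  let ?y = "vertex \<Delta> F I - u"
  note vert = vertex_in_dual_lattice[OF I]
  have y: "?y \<in> dual_space (lat \<Delta>)"
    using vert True by (auto simp: dual_lattice_def intro: dual_space_diff)
  have yint: "blinfun_apply ?y (rv i) \<in> \<int>" if "i \<in> verts \<Delta> I" for i
    using True vertex_ray[OF I that] level_Ints[OF I that] that by (simp add: blinfun.diff_left)
  have "blinfun_apply ?y x \<in> \<int> \<longleftrightarrow> blinfun_apply u x \<in> \<int>" if "x \<in> lat \<Delta>" for x
  proof -
    have v: "blinfun_apply (vertex \<Delta> F I) x \<in> \<int>" using vert that by (simp add: dual_lattice_def)
    then show ?thesis
      using Ints_diff[OF v, of "blinfun_apply u x"] Ints_diff[OF v, of "blinfun_apply ?y x"]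
      by (auto simp: blinfun.diff_left)
  qed
  then have mem: "?y \<in> dual_lattice (lat \<Delta>) \<longleftrightarrow> u \<in> dual_lattice (lat \<Delta>)"
    using y True by (auto simp: dual_lattice_def)
  have prod: "(\<Prod>i\<in>verts \<Delta> I. if i \<in> {} then of_bool (blinfun_apply u (rv i) = lvl i)
        else if blinfun_apply (dual_vec \<Delta> I i) v > 0 then - of_bool (lvl i < blinfun_apply u (rv i))
        else of_bool (blinfun_apply u (rv i) \<le> lvl i)) =
      (of_int (\<Prod>i\<in>verts \<Delta> I. if blinfun_apply (dual_vec \<Delta> I i) v > 0 then - beyond u i else 1 - beyond u i) :: complex)"
    unfolding of_int_prod by (rule prod.cong) (auto simp: beyond_def)
  have "(\<Sum>g\<in>quot_grp \<Delta> I. expansion v I (SOME x. x \<in> g) {} u) =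
      of_int (\<Prod>i\<in>verts \<Delta> I. if blinfun_apply (dual_vec \<Delta> I i) v > 0 then - beyond u i else 1 - beyond u i) *
      (\<Sum>g\<in>quot_grp \<Delta> I. character_at (SOME x. x \<in> g) ?y)"
    unfolding expansion_def prod sum_distrib_left by (rule sum.cong) (use True in auto)
  moreover have "(\<Sum>g\<in>quot_grp \<Delta> I. character_at (SOME x. x \<in> g) ?y) =
      (if u \<in> dual_lattice (lat \<Delta>) then of_nat (card (quot_grp \<Delta> I)) else 0)"
    using sum_character_quot_grp[OF I y] yint mem by simp
  ultimately show ?thesis by simp
qed

end

section \<open>The lattice point formula\<close>

lemma of_int_fract: "of_int k = Fract (of_int k) (1 :: 'a::idom)"
proof (cases "k \<ge> 0")
  case True
  then have "of_int k = (of_nat (nat k) :: 'a fract)" "of_int k = (of_nat (nat k) :: 'a)" by simp_all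
  then show ?thesis using of_nat_fract[of "nat k"] by metis
next
  case False
  then have "of_int k = - (of_nat (nat (- k)) :: 'a fract)" "of_int k = - (of_nat (nat (- k)) :: 'a)" by simp_all
  then show ?thesis using of_nat_fract[of "nat (- k)"] by (metis minus_fract)
qed

lemma prod_Fract_one: "(\<Prod>i\<in>A. Fract (f i) 1) = Fract (\<Prod>i\<in>A. f i) (1 :: 'a::idom)"
  by (induction A rule: infinite_finite_induct) (simp_all add: One_fract_def)

lemma one_minus_tmon: "1 - tmon a u = Fract (1 - Poly_Mapping.single u a) 1"
  by (simp add: tmon_def One_fract_def)

lemma weighted_tmon:
  assumes "c > 0"
  shows "of_int k * tmon 1 u / of_nat c = Fract (Poly_Mapping.single u (of_int k / of_nat c)) 1"
proof -
  have "(of_int k :: ('a \<Rightarrow>\<^sub>L real) \<Rightarrow>\<^sub>0 complex) * Poly_Mapping.single u 1 =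
      Poly_Mapping.single u (of_int k / of_nat c) * of_nat c"
    using assms unfolding single_of_int[symmetric] single_of_nat[symmetric] mult_single by simp
  moreover have "(of_nat c :: ('a \<Rightarrow>\<^sub>L real) \<Rightarrow>\<^sub>0 complex) \<noteq> 0"
    using assms by (simp flip: single_of_nat) (metis lookup_single_eq lookup_zero of_nat_eq_0_iff less_irrefl)
  ultimately show ?thesis
    by (simp add: tmon_def of_int_fract of_nat_fract eq_fract)
qed

text \<open>The coefficient at \<open>0\<close> stays 1, since \<open>u\<close> is a different
  exponent.\<close>

lemma binomial_nonzero:
  fixes u :: "'a::euclidean_space \<Rightarrow>\<^sub>L real"
  assumes "u \<noteq> 0"
  shows "1 - Poly_Mapping.single u (a :: complex) \<noteq> 0"
proof
  assume "1 - Poly_Mapping.single u a = 0"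
  then have "Poly_Mapping.lookup (1 - Poly_Mapping.single u a) 0 = 0" by simp
  then show False using assms by (simp add: lookup_minus lookup_single)
qed

context simplicial_multi_fan
begin

text \<open>The rays lie in the lattice, so the coordinates of a dual lattice element in the basis
  \<open>dual_vec\<close> of any one maximal face are integers.\<close>

lemma dual_lattice_subset_fan:
  assumes "top_skel \<Delta> \<noteq> {}"
  shows "dual_lattice (lat \<Delta>) \<subseteq> dual_lattice_fan \<Delta>"
proof
  fix u assume u: "u \<in> dual_lattice (lat \<Delta>)"
  obtain I where I: "I \<in> top_skel \<Delta>" using assms by blast
  have "u = (\<Sum>i\<in>verts \<Delta> I. blinfun_apply u (rv i) *\<^sub>R dual_vec \<Delta> I i)"
    using dual_space_expansion[OF I] u by (simp add: dual_lattice_def)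
  also have "\<dots> \<in> dual_lattice_fan \<Delta>"
    unfolding dual_lattice_fan_def
  proof (intro group_closure_sum_mem group_closure_scaleR_Ints)
    fix i assume i: "i \<in> verts \<Delta> I"
    show "blinfun_apply u (rv i) \<in> \<int>"
      using u ray_in_lattice[OF top_faces[OF I] i] by (auto simp: dual_lattice_def)
    show "dual_vec \<Delta> I i \<in> group_closure {dual_vec \<Delta> I i | I i. I \<in> top_skel \<Delta> \<and> i \<in> verts \<Delta> I}"
      using I i by (auto intro: group_closure.base)
  qed
  finally show "u \<in> dual_lattice_fan \<Delta>" .
qed

section \<open>The non-singular case\<close>

context
  assumes nonsingular: "nonsingular_fan \<Delta>"
begin

text \<open>The rays form part of a lattice basis, and being of full dimension they exhaust
  it.\<close>

lemma lattice_basis_rays: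
  assumes I: "I \<in> top_skel \<Delta>"
  shows "lattice_basis (lat \<Delta>) (rv ` verts \<Delta> I)"
proof -
  obtain B S where NB: "lattice_basis (lat \<Delta>) B" and S: "S \<subseteq> B" "cone_of \<Delta> I = convex_cone hull S"
    using nonsingular top_faces[OF I] unfolding nonsingular_fan_def by blast
  note B = lattice_basisD[OF NB]
  have rays: "rv ` verts \<Delta> I = S"
    using primitive_lattice_basis[OF NB] S
    by (intro ray_vecs_eq_generators[OF top_faces[OF I] independent_mono[OF B(1)]]) auto
  \<comment> \<open>A basis element outside \<open>S\<close> would lie in \<open>span S\<close> and
    yet have its own coordinate equal to 1.\<close>
  have "B \<subseteq> S"
  proof
    fix b assume b: "b \<in> B"
    then have "b \<in> span S" using span_rays_top[OF I] rays B(5) span_base by blast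
    then have "\<forall>s\<in>B - S. coord B s b = 0"
      using span_subset_coord[OF B(1,2) S(1)] by blast
    then show "b \<in> S" using coord_basis[OF B(1) b, of b] b by force
  qed
  then show ?thesis using NB S rays by auto
qed

lemma sublat_nonsingular: "I \<in> top_skel \<Delta> \<Longrightarrow> sublat \<Delta> I = lat \<Delta>"
  using lattice_basis_rays lattice_basisD(3) by (auto simp: sublat_def)

lemma quot_grp_nonsingular:
  assumes I: "I \<in> top_skel \<Delta>"
  shows "quot_grp \<Delta> I = {lat \<Delta>}"
proof -
  have "coset I x = lat \<Delta>" if "x \<in> lat \<Delta>" for x
    unfolding coset_def sublat_nonsingular[OF I] using that lattice_diff[OF lattice] by auto
  then show ?thesis
    using lattice_zero[OF lattice] by (auto simp: quot_grp_eq)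
qed

lemma dual_vec_nonsingular:
  assumes I: "I \<in> top_skel \<Delta>"
  shows "dual_vec \<Delta> I i \<in> dual_lattice (lat \<Delta>)"
proof -
  have "blinfun_apply (dual_vec \<Delta> I i) x \<in> \<int>" if "x \<in> lat \<Delta>" for x
    by (rule group_closure_Ints[of x "rv ` verts \<Delta> I"])
      (use that sublat_nonsingular[OF I] dual_vec_ray[OF I] in \<open>auto simp: sublat_def\<close>)
  then show ?thesis using dual_vec_in_dual_space[OF I] by (simp add: dual_lattice_def)
qed

lemma dual_lattice_fan_nonsingular:
  assumes "top_skel \<Delta> \<noteq> {}"
  shows "dual_lattice_fan \<Delta> = dual_lattice (lat \<Delta>)"
proof
  show "dual_lattice_fan \<Delta> \<subseteq> dual_lattice (lat \<Delta>)"
  proof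
    fix u assume "u \<in> dual_lattice_fan \<Delta>"
    then show "u \<in> dual_lattice (lat \<Delta>)"
      unfolding dual_lattice_fan_def
    proof induction
      case (base s)
      then show ?case
        using dual_vec_nonsingular by (auto simp: dual_lattice_def dual_space_zero)
    next
      case (diff s t)
      then show ?case by (auto simp: dual_lattice_def blinfun.diff_left intro: dual_space_diff)
    qed
  qed
qed (rule dual_lattice_subset_fan[OF assms])

lemma chi_dual_vec_nonsingular:
  assumes I: "I \<in> top_skel \<Delta>"
  shows "chi (dual_vec \<Delta> I i) (lat \<Delta>) = 1"
proof -
  have "(SOME x. x \<in> lat \<Delta>) \<in> lat \<Delta>"
    using lattice_zero[OF lattice] by (rule someI)
  then show ?thesis
    using dual_vec_nonsingular[OF I] by (auto simp: chi_eq character_at_eq_1_iff dual_lattice_def)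
qed

end

end

context simple_lattice_polytope
begin

lemma top_nonempty: "top_skel \<Delta> \<noteq> {}"
  using complete by (simp add: complete_fan_def pre_complete_def)

lemma dual_vec_nonzero:
  assumes "I \<in> top_skel \<Delta>" "i \<in> verts \<Delta> I"
  shows "dual_vec \<Delta> I i \<noteq> 0"
  using dual_vec_ray[OF assms, of i] by auto

lemma sum_fractions_eq:
  assumes v: "generic \<Delta> v" and S: "finite S" "S = {u \<in> dual_lattice (lat \<Delta>). signed_sum v (beyond u) \<noteq> 0}"
  shows "(\<Sum>I\<in>top_skel \<Delta>.
     of_int (weight \<Delta> I) * tmon 1 (vertex \<Delta> F I) / of_nat (card (quot_grp \<Delta> I)) *
     (\<Sum>g\<in>quot_grp \<Delta> I. 1 / (\<Prod>i\<in>verts \<Delta> I. 1 - tmon (chi (dual_vec \<Delta> I i) g) (- dual_vec \<Delta> I i)))) =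
   Fract (\<Sum>u\<in>S. Poly_Mapping.single u (of_int (signed_sum v (beyond u)))) 1"
proof -
  \<comment> \<open>The weight divided by the group order goes into the numerators, so that each
    pair \<open>(I, g)\<close> gives one fraction with its own denominator and expansion.\<close>
  define c :: "'a \<Rightarrow> complex" where "c I = of_int (weight \<Delta> I) / of_nat (card (quot_grp \<Delta> I))" for I
  define q where "q = (\<lambda>(I, g). \<Prod>i\<in>verts \<Delta> I. 1 - Poly_Mapping.single (- dual_vec \<Delta> I i) (chi (dual_vec \<Delta> I i) g))"
  define p where "p = (\<lambda>(I, g :: 'b set). Poly_Mapping.single (vertex \<Delta> F I) (c I))"
  define e where "e = (\<lambda>(I, g :: 'b set) u. c I * expansion v I (SOME x. x \<in> g) {} u)"
  define X where "X = (SIGMA I:top_skel \<Delta>. quot_grp \<Delta> I)"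
  let ?R = "\<Sum>u\<in>S. Poly_Mapping.single u (of_int (signed_sum v (beyond u)) :: complex)"
  have "(\<Sum>x\<in>X. Fract (p x) (q x)) = Fract ?R 1"
  proof (rule sum_Fract_eq_of_expansion[of X q e p])
    show "finite X" unfolding X_def using finite_top finite_quot_grp by (intro finite_SigmaI)
    fix x assume "x \<in> X"
    then obtain I g where x: "x = (I, g)" and I: "I \<in> top_skel \<Delta>" by (auto simp: X_def)
    have "\<forall>i\<in>verts \<Delta> I. 1 - Poly_Mapping.single (- dual_vec \<Delta> I i) (chi (dual_vec \<Delta> I i) g) \<noteq> 0"
      using dual_vec_nonzero[OF I] by (intro ballI binomial_nonzero) simp
    then show "q x \<noteq> 0"
      using finite_verts[OF top_faces[OF I]] by (simp add: q_def x)
    show "conv_act (q x) (e x) = Poly_Mapping.lookup (p x)"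
    proof
      fix u
      have "conv_act (q x) (e x) u = c I * conv_act (q x) (expansion v I (SOME x. x \<in> g) {}) u"
        unfolding e_def x prod.case by (rule conv_act_fun_mult)
      also have "conv_act (q x) (expansion v I (SOME x. x \<in> g) {}) =
          Poly_Mapping.lookup (Poly_Mapping.single (vertex \<Delta> F I) 1)"
        unfolding q_def x prod.case chi_eq by (rule conv_act_expansion[OF I])
      finally show "conv_act (q x) (e x) u = Poly_Mapping.lookup (p x) u"
        by (simp add: p_def x lookup_single when_def)
    qed
  next
    fix u
    have "(\<Sum>x\<in>X. e x u) = (\<Sum>I\<in>top_skel \<Delta>. c I * (\<Sum>g\<in>quot_grp \<Delta> I. expansion v I (SOME x. x \<in> g) {} u))"
      unfolding X_def e_def sum_distrib_left
      by (subst sum.Sigma) (auto simp: finite_top finite_quot_grp split_def)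
    also have "\<dots> = (if u \<in> dual_lattice (lat \<Delta>) then of_int (signed_sum v (beyond u)) else 0)"
    proof -
      \<comment> \<open>The group order in \<open>c I\<close> cancels the cardinality produced by
        the character sum.\<close>
      have "c I * of_nat (card (quot_grp \<Delta> I)) = of_int (weight \<Delta> I)" if "I \<in> top_skel \<Delta>" for I
        using card_quot_grp_pos[OF that] by (simp add: c_def)
      then show ?thesis
        by (simp add: sum_expansion signed_sum_def mult.assoc[symmetric])
    qed
    also have "\<dots> = Poly_Mapping.lookup ?R u"
    proof -
      have "Poly_Mapping.lookup ?R u = (\<Sum>u'\<in>S. if u' = u then of_int (signed_sum v (beyond u)) else 0)"
        unfolding lookup_sum by (rule sum.cong) (auto simp: lookup_single when_def)
      then show ?thesis using S by auto
    qed
    finally show "(\<Sum>x\<in>X. e x u) = Poly_Mapping.lookup ?R u" .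
  qed
  moreover have "(\<Sum>x\<in>X. Fract (p x) (q x)) = (\<Sum>I\<in>top_skel \<Delta>. \<Sum>g\<in>quot_grp \<Delta> I.
      Fract (Poly_Mapping.single (vertex \<Delta> F I) (c I)) 1 *
      (1 / (\<Prod>i\<in>verts \<Delta> I. 1 - tmon (chi (dual_vec \<Delta> I i) g) (- dual_vec \<Delta> I i))))"
    unfolding X_def
    by (subst sum.Sigma)
      (auto simp: finite_top finite_quot_grp split_def p_def q_def one_minus_tmon prod_Fract_one)
  moreover have "of_int (weight \<Delta> I) * tmon 1 (vertex \<Delta> F I) / of_nat (card (quot_grp \<Delta> I)) =
      Fract (Poly_Mapping.single (vertex \<Delta> F I) (c I)) 1" if "I \<in> top_skel \<Delta>" for I
    unfolding c_def by (rule weighted_tmon[OF card_quot_grp_pos[OF that]])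
  ultimately show ?thesis
    by (simp add: sum_distrib_left)
qed

lemma lattice_point_formula:
  assumes \<epsilon>: "0 < \<epsilon>" "\<epsilon> < 1" and v: "generic \<Delta> v"
  defines "S \<equiv> {u \<in> dual_lattice (lat \<Delta>). DH \<Delta> (shifted \<Delta> F \<epsilon>) v u \<noteq> 0}"
  defines "L \<equiv> \<Sum>I\<in>top_skel \<Delta>.
     of_int (weight \<Delta> I) * tmon 1 (vertex \<Delta> F I) / of_nat (card (quot_grp \<Delta> I)) *
     (\<Sum>g\<in>quot_grp \<Delta> I. 1 / (\<Prod>i\<in>verts \<Delta> I. 1 - tmon (chi (dual_vec \<Delta> I i) g) (- dual_vec \<Delta> I i)))"
  defines "R \<equiv> \<Sum>u\<in>S. Poly_Mapping.single u (of_int (DH \<Delta> (shifted \<Delta> F \<epsilon>) v u))"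
  shows "finite S" "R \<in> group_ring (dual_lattice (lat \<Delta>))" "L = Fract R 1"
    "L \<in> quot_field (dual_lattice_fan \<Delta>)"
proof -
  have S: "S = {u \<in> dual_lattice (lat \<Delta>). signed_sum v (beyond u) \<noteq> 0}"
    unfolding S_def using DH_shifted[OF \<epsilon>] by auto
  show fin: "finite S" unfolding S using finite_support[OF v] .
  have R: "R = (\<Sum>u\<in>S. Poly_Mapping.single u (of_int (signed_sum v (beyond u))))"
    unfolding R_def by (rule sum.cong) (auto simp: S DH_shifted[OF \<epsilon>])
  show L: "L = Fract R 1" unfolding L_def R using sum_fractions_eq[OF v fin S] .
  have "Poly_Mapping.keys R \<subseteq> S"
    unfolding R by (rule order.trans[OF keys_sum]) auto
  then have keys: "Poly_Mapping.keys R \<subseteq> dual_lattice (lat \<Delta>)" unfolding S by auto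
  then show "R \<in> group_ring (dual_lattice (lat \<Delta>))" by (simp add: group_ring_def)
  have "R \<in> group_ring (dual_lattice_fan \<Delta>)"
    using keys dual_lattice_subset_fan[OF top_nonempty] by (auto simp: group_ring_def)
  moreover have "1 \<in> group_ring (dual_lattice_fan \<Delta>)"
    by (simp add: group_ring_def dual_lattice_fan_def)
  ultimately show "L \<in> quot_field (dual_lattice_fan \<Delta>)"
    unfolding L quot_field_def by (intro CollectI exI[of _ R] exI[of _ 1]) auto
qed

end

theorem corollary7p4:
  fixes \<Delta> :: "('s, 'v::euclidean_space) multi_fan"
    and F :: "'s \<Rightarrow> ('v \<Rightarrow>\<^sub>L real) set"
  assumes "simple_lattice_multi_polytope \<Delta> F"
  shows
    "(\<forall>\<^sub>F \<epsilon> in at_right 0. \<forall>v. generic \<Delta> v \<longrightarrow>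
       (let S = {u \<in> dual_lattice (lat \<Delta>). DH \<Delta> (shifted \<Delta> F \<epsilon>) v u \<noteq> 0};
            L = (\<Sum>I\<in>top_skel \<Delta>.
                   of_int (weight \<Delta> I) * tmon 1 (vertex \<Delta> F I) / of_nat (card (quot_grp \<Delta> I)) *
                   (\<Sum>g\<in>quot_grp \<Delta> I.
                      1 / (\<Prod>i\<in>verts \<Delta> I.
                             1 - tmon (chi (dual_vec \<Delta> I i) g) (- dual_vec \<Delta> I i))));
            R = (\<Sum>u\<in>S. Poly_Mapping.single u (of_int (DH \<Delta> (shifted \<Delta> F \<epsilon>) v u)))
        in finite S \<and> R \<in> group_ring (dual_lattice (lat \<Delta>)) \<and>
           L \<in> quot_field (dual_lattice_fan \<Delta>) \<and> L = Fraction_Field.Fract R 1)) \<and>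
     (nonsingular_fan \<Delta> \<longrightarrow>
        dual_lattice_fan \<Delta> = dual_lattice (lat \<Delta>) \<and>
        (\<forall>\<^sub>F \<epsilon> in at_right 0. \<forall>v. generic \<Delta> v \<longrightarrow>
          (let S = {u \<in> dual_lattice (lat \<Delta>). DH \<Delta> (shifted \<Delta> F \<epsilon>) v u \<noteq> 0};
               L = (\<Sum>I\<in>top_skel \<Delta>.
                      of_int (weight \<Delta> I) * tmon 1 (vertex \<Delta> F I) /
                      (\<Prod>i\<in>verts \<Delta> I. 1 - tmon 1 (- dual_vec \<Delta> I i)));
               R = (\<Sum>u\<in>S. Poly_Mapping.single u (of_int (DH \<Delta> (shifted \<Delta> F \<epsilon>) v u)))
           in finite S \<and> L = Fraction_Field.Fract R 1)))"
proof -
  interpret simple_lattice_polytope \<Delta> F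
    using assms
    by unfold_locales
      (auto simp: simple_lattice_multi_polytope_def simple_multi_polytope_def multi_polytope_def)
  \<comment> \<open>The bound 1 works for all generic \<open>v\<close> at once, as the order of
    quantifiers demands.\<close>
  have small: "\<forall>\<^sub>F \<epsilon> :: real in at_right 0. 0 < \<epsilon> \<and> \<epsilon> < 1"
    unfolding eventually_at_right[OF zero_less_one] by (intro exI[of _ 1]) auto
  \<comment> \<open>Each quotient group is trivial and its only character value is 1, so the inner
    average collapses to one term.\<close>
  have nonsing: "(\<Sum>I\<in>top_skel \<Delta>.
      of_int (weight \<Delta> I) * tmon 1 (vertex \<Delta> F I) / (\<Prod>i\<in>verts \<Delta> I. 1 - tmon 1 (- dual_vec \<Delta> I i))) =
    (\<Sum>I\<in>top_skel \<Delta>.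
      of_int (weight \<Delta> I) * tmon 1 (vertex \<Delta> F I) / of_nat (card (quot_grp \<Delta> I)) *
      (\<Sum>g\<in>quot_grp \<Delta> I. 1 / (\<Prod>i\<in>verts \<Delta> I. 1 - tmon (chi (dual_vec \<Delta> I i) g) (- dual_vec \<Delta> I i))))"
    if "nonsingular_fan \<Delta>"
    by (rule sum.cong[OF refl])
      (simp add: quot_grp_nonsingular[OF that] chi_dual_vec_nonsingular[OF that])
  show ?thesis
  proof (intro conjI impI)
    show "\<forall>\<^sub>F \<epsilon> in at_right 0. \<forall>v. generic \<Delta> v \<longrightarrow>
       (let S = {u \<in> dual_lattice (lat \<Delta>). DH \<Delta> (shifted \<Delta> F \<epsilon>) v u \<noteq> 0};
            L = (\<Sum>I\<in>top_skel \<Delta>.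
                   of_int (weight \<Delta> I) * tmon 1 (vertex \<Delta> F I) / of_nat (card (quot_grp \<Delta> I)) *
                   (\<Sum>g\<in>quot_grp \<Delta> I.
                      1 / (\<Prod>i\<in>verts \<Delta> I.
                             1 - tmon (chi (dual_vec \<Delta> I i) g) (- dual_vec \<Delta> I i))));
            R = (\<Sum>u\<in>S. Poly_Mapping.single u (of_int (DH \<Delta> (shifted \<Delta> F \<epsilon>) v u)))
        in finite S \<and> R \<in> group_ring (dual_lattice (lat \<Delta>)) \<and>
           L \<in> quot_field (dual_lattice_fan \<Delta>) \<and> L = Fraction_Field.Fract R 1)"
      unfolding Let_def
      by (rule eventually_mono[OF small]) (use lattice_point_formula in blast)
    assume ns: "nonsingular_fan \<Delta>"
    show "dual_lattice_fan \<Delta> = dual_lattice (lat \<Delta>)"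
      by (rule dual_lattice_fan_nonsingular[OF ns top_nonempty])
    show "\<forall>\<^sub>F \<epsilon> in at_right 0. \<forall>v. generic \<Delta> v \<longrightarrow>
          (let S = {u \<in> dual_lattice (lat \<Delta>). DH \<Delta> (shifted \<Delta> F \<epsilon>) v u \<noteq> 0};
               L = (\<Sum>I\<in>top_skel \<Delta>.
                      of_int (weight \<Delta> I) * tmon 1 (vertex \<Delta> F I) /
                      (\<Prod>i\<in>verts \<Delta> I. 1 - tmon 1 (- dual_vec \<Delta> I i)));
               R = (\<Sum>u\<in>S. Poly_Mapping.single u (of_int (DH \<Delta> (shifted \<Delta> F \<epsilon>) v u)))
           in finite S \<and> L = Fraction_Field.Fract R 1)"
      unfolding Let_def nonsing[OF ns]
      by (rule eventually_mono[OF small]) (use lattice_point_formula in blast)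
  qed
qed

end
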